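(* Let $k\ge3$ and let $\Lambda$ be chosen uniformly at random among all subsets of $\{0,\dots,n-1\}^2$ of cardinality $k$. Suppose that $\boldsymbol{x}\in\mathbb{C}^{n\times n}$ has support $\Lambda$ with random phases $(\operatorname{sgn}(x_{\ell p}))_{(\ell,p)\in\Lambda}$ that are independent and uniformly distributed on the torus $\{z\in\mathbb{C}:|z|=1\}$. Let $$\Gamma=\sum_{(\ell,p)\in\Lambda}x_{\ell p}\boldsymbol{M}_\ell\boldsymbol{T}_p .$$ (a) Let $n$ be prime and let $\boldsymbol{h}^A\in\mathbb{C}^n$ be the Alltop window, $h^A_q=\frac1{\sqrt n}e^{2\pi iq^3/n}$, $q=0,\dots,n-1$. Assume that for $\epsilon>0$ $$k\le\frac{n}{8\log(2n^2/\epsilon)}$$ and $$s:=\frac1{144}\left(\frac{e^{-1/4}}{2}-\frac{2k}{n}\right)^2\frac{n}{k\log(k/2+1)}\ge1.$$ Then with probability at least $1-(\epsilon+(k/2)^{-s})$ Basis Pursuit recovers $\Gamma$ from $\Gamma\boldsymbol{h}^A$. (b) Let $n$ be even and let $\boldsymbol{h}^R\in\mathbb{C}^n$ be the random window with entries $h^R_q=\frac1{\sqrt n}\epsilon_q$, $q=0,\dots,n-1$, where the $\epsilon_q$ are independent and uniformly distributed on the torus $\{z\in\mathbb{C}:|z|=1\}$. Let $\epsilon>0$ and assume $$k\le\frac{n}{32(\sigma+2)\log(n)\log(2n^2/\epsilon)}$$ for some $\sigma>0$ and $$s:=\frac1{576(\sigma+2)}\left(\frac{e^{-1/4}}{2}-\frac{2k}{n}\right)^2\frac{n}{k\log(k/2+1)}\ge1.$$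 Then with probability at least $1-(\epsilon+4n^{-\sigma}+(k/2)^{-s})$ Basis Pursuit recovers $\Gamma$ from $\Gamma\boldsymbol{h}^R$. (A similar result also holds for $n$ odd.)
   Context: On $\mathbb{C}^n$ (indices $q=0,\dots,n-1$, understood modulo $n$) the translation and modulation operators are $(\boldsymbol{T}_p\boldsymbol{h})_q=h_{(p+q)\bmod n}$ and $(\boldsymbol{M}_\ell\boldsymbol{h})_q=e^{2\pi i\ell q/n}h_q$. The dictionary is $\mathcal{G}=\{\boldsymbol{M}_\ell\boldsymbol{T}_p:\ \ell,p=0,\dots,n-1\}$, and for a window $\boldsymbol{h}$, $(\mathcal{G}\boldsymbol{h})$ is the $n\times n^2$ matrix with columns $\boldsymbol{M}_\ell\boldsymbol{T}_p\boldsymbol{h}$; thus $\Gamma\boldsymbol{h}=(\mathcal{G}\boldsymbol{h})\boldsymbol{x}$ with $\boldsymbol{x}$ regarded as a vector with $n^2$ entries. Basis Pursuit is the program: $\min\|\boldsymbol{x}'\|_1$ subject to $(\mathcal{G}\boldsymbol{h})\boldsymbol{x}'=\Gamma\boldsymbol{h}$, where $\|\boldsymbol{x}'\|_1$ is the sum of the moduli of the entries. It recovers $\Gamma$ from $\Gamma\boldsymbol{h}$ if $\boldsymbol{x}$ is its unique solution. $\operatorname{sgn}(z)=z/|z|$ for $z\ne0$. The magnitudes $|x_{\ell p}|$, $(\ell,p)\in\Lambda$, are arbitrary positive numbers; conditionally on $\Lambda$ and the magnitudes, the phases are independent and uniform. In (b) the window $\boldsymbol{h}^R$ is independent of $\Lambda$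 and $\boldsymbol{x}$. $\log$ is the natural logarithm. *)

theory Defs
  imports "HOL-Probability.Probability" "HOL-Computational_Algebra.Primes"
begin

text \<open>
  A vector in \<open>\<complex>\<^sup>n\<close> is a function \<open>nat \<Rightarrow> complex\<close> of which only the entries
  \<open>q < n\<close> matter; a coefficient array in \<open>\<complex>\<^bsup>n\<times>n\<^esup>\<close> is a function \<open>nat \<times> nat \<Rightarrow> complex\<close> of
  which only the entries in \<open>tf_grid n\<close> matter.  An index is a pair \<open>(l, p)\<close>
  of a modulation \<open>l\<close> and a translation \<open>p\<close>.
\<close>

definition tf_grid :: "nat \<Rightarrow> (nat \<times> nat) set" where
  "tf_grid n = {..<n} \<times> {..<n}"

definition translation :: "nat \<Rightarrow> nat \<Rightarrow> (nat \<Rightarrow> complex) \<Rightarrow> nat \<Rightarrow> complex" where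
  "translation n p h q = h ((p + q) mod n)"

definition modulation :: "nat \<Rightarrow> nat \<Rightarrow> (nat \<Rightarrow> complex) \<Rightarrow> nat \<Rightarrow> complex" where
  "modulation n l h q = cis (2 * pi * real l * real q / real n) * h q"

definition tf_operator ::
  "nat \<Rightarrow> (nat \<times> nat) set \<Rightarrow> (nat \<times> nat \<Rightarrow> complex) \<Rightarrow> (nat \<Rightarrow> complex) \<Rightarrow> nat \<Rightarrow> complex" where
  "tf_operator n \<Lambda> x h q = (\<Sum>(l, p)\<in>\<Lambda>. x (l, p) * modulation n l (translation n p h) q)"

definition gabor_matrix :: "nat \<Rightarrow> (nat \<Rightarrow> complex) \<Rightarrow> nat \<Rightarrow> nat \<times> nat \<Rightarrow> complex" where
  "gabor_matrix n h q = (\<lambda>(l, p). modulation n l (translation n p h) q)"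

definition l1_norm :: "nat \<Rightarrow> (nat \<times> nat \<Rightarrow> complex) \<Rightarrow> real" where
  "l1_norm n x = (\<Sum>i\<in>tf_grid n. cmod (x i))"

definition bp_feasible ::
  "nat \<Rightarrow> (nat \<Rightarrow> complex) \<Rightarrow> (nat \<Rightarrow> complex) \<Rightarrow> (nat \<times> nat \<Rightarrow> complex) \<Rightarrow> bool" where
  "bp_feasible n h y x' \<longleftrightarrow> (\<forall>q<n. (\<Sum>i\<in>tf_grid n. gabor_matrix n h q i * x' i) = y q)"

definition bp_solution ::
  "nat \<Rightarrow> (nat \<Rightarrow> complex) \<Rightarrow> (nat \<Rightarrow> complex) \<Rightarrow> (nat \<times> nat \<Rightarrow> complex) \<Rightarrow> bool" where
  "bp_solution n h y x' \<longleftrightarrow>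
     bp_feasible n h y x' \<and> (\<forall>x''. bp_feasible n h y x'' \<longrightarrow> l1_norm n x' \<le> l1_norm n x'')"

text \<open>Uniqueness is uniqueness in \<open>\<complex>\<^bsup>n\<times>n\<^esup>\<close>, i.e. up to the irrelevant entries outside the grid.\<close>

definition bp_recovers ::
  "nat \<Rightarrow> (nat \<Rightarrow> complex) \<Rightarrow> (nat \<Rightarrow> complex) \<Rightarrow> (nat \<times> nat \<Rightarrow> complex) \<Rightarrow> bool" where
  "bp_recovers n h y x \<longleftrightarrow>
     bp_solution n h y x \<and> (\<forall>x'. bp_solution n h y x' \<longrightarrow> (\<forall>i\<in>tf_grid n. x' i = x i))"

definition alltop_window :: "nat \<Rightarrow> nat \<Rightarrow> complex" where
  "alltop_window n q = cis (2 * pi * real q ^ 3 / real n) / complex_of_real (sqrt (real n))"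

definition scaled_window :: "nat \<Rightarrow> (nat \<Rightarrow> complex) \<Rightarrow> nat \<Rightarrow> complex" where
  "scaled_window n \<epsilon> q = \<epsilon> q / complex_of_real (sqrt (real n))"

definition torus_uniform :: "complex measure" where
  "torus_uniform = distr (uniform_measure lborel {0..<2 * pi}) borel cis"

definition k_subsets :: "nat \<Rightarrow> nat \<Rightarrow> (nat \<times> nat) set set" where
  "k_subsets n k = {S. S \<subseteq> tf_grid n \<and> card S = k}"

definition uniform_random_support ::
  "'w measure \<Rightarrow> nat \<Rightarrow> nat \<Rightarrow> ('w \<Rightarrow> (nat \<times> nat) set) \<Rightarrow> bool" where
  "uniform_random_support M n k \<Lambda> \<longleftrightarrow>
     \<Lambda> \<in> measurable M (count_space (k_subsets n k)) \<and>
     distr M (count_space (k_subsets n k)) \<Lambda> = uniform_count_measure (k_subsets n k)"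

definition random_array_with_support ::
  "'w measure \<Rightarrow> nat \<Rightarrow> ('w \<Rightarrow> (nat \<times> nat) set) \<Rightarrow> ('w \<Rightarrow> nat \<times> nat \<Rightarrow> complex) \<Rightarrow> bool" where
  "random_array_with_support M n \<Lambda> x \<longleftrightarrow>
     (\<forall>i\<in>tf_grid n. (\<lambda>\<omega>. x \<omega> i) \<in> borel_measurable M) \<and>
     (\<forall>\<omega>\<in>space M. {i \<in> tf_grid n. x \<omega> i \<noteq> 0} = \<Lambda> \<omega>)"

text \<open>
  Conditionally on \<open>\<Lambda>\<close> and on the magnitudes of \<open>x\<close>, the phases on \<open>\<Lambda>\<close> are independent and uniform
  on the torus.  The conditioning events \<open>{\<Lambda> = S, |x| \<in> A}\<close> are closed under intersection and
  generate the sigma-algebra of the pair (support, magnitudes), so quantifying over those of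
  positive probability says exactly that the conditional law of the phases given this
  sigma-algebra is almost surely the uniform product law on the torus. The joint law of the
  support and the magnitudes is left arbitrary; deterministic magnitudes are a special case.
\<close>

definition uniform_random_phases ::
  "'w measure \<Rightarrow> nat \<Rightarrow> ('w \<Rightarrow> (nat \<times> nat) set) \<Rightarrow> ('w \<Rightarrow> nat \<times> nat \<Rightarrow> complex) \<Rightarrow> bool" where
  "uniform_random_phases M n \<Lambda> x \<longleftrightarrow>
     (\<forall>S. \<forall>A\<in>sets (PiM (tf_grid n) (\<lambda>_. borel :: real measure)).
        let E = {\<omega> \<in> space M. \<Lambda> \<omega> = S \<and> (\<lambda>i\<in>tf_grid n. cmod (x \<omega> i)) \<in> A} in
        measure M E > 0 \<longrightarrow>
          prob_space.indep_vars (uniform_measure M E) (\<lambda>_. borel) (\<lambda>i \<omega>. sgn (x \<omega> i)) S \<and>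
          (\<forall>i\<in>S. distr (uniform_measure M E) borel (\<lambda>\<omega>. sgn (x \<omega> i)) = torus_uniform))"

definition uniform_random_torus_vector ::
  "'w measure \<Rightarrow> nat \<Rightarrow> ('w \<Rightarrow> nat \<Rightarrow> complex) \<Rightarrow> bool" where
  "uniform_random_torus_vector M n \<epsilon> \<longleftrightarrow>
     prob_space.indep_vars M (\<lambda>_. borel) (\<lambda>q \<omega>. \<epsilon> \<omega> q) {..<n} \<and>
     (\<forall>q<n. distr M borel (\<lambda>\<omega>. \<epsilon> \<omega> q) = torus_uniform)"

text \<open>
  Independence of the vector \<open>\<epsilon>\<close> and the pair \<open>(\<Lambda>, x)\<close>, via the generated sigma-algebras
  (the library's \<open>indep_var\<close> needs both random variables to have the same type).
\<close>

definition indep_of_signal ::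
  "'w measure \<Rightarrow> nat \<Rightarrow> nat \<Rightarrow> ('w \<Rightarrow> nat \<Rightarrow> complex) \<Rightarrow>
   ('w \<Rightarrow> (nat \<times> nat) set) \<Rightarrow> ('w \<Rightarrow> nat \<times> nat \<Rightarrow> complex) \<Rightarrow> bool" where
  "indep_of_signal M n k \<epsilon> \<Lambda> x \<longleftrightarrow>
     prob_space.indep_set M
       (sets (vimage_algebra (space M) (\<lambda>\<omega>. \<lambda>q\<in>{..<n}. \<epsilon> \<omega> q)
          (PiM {..<n} (\<lambda>_. borel :: complex measure))))
       (sets (vimage_algebra (space M) (\<lambda>\<omega>. (\<Lambda> \<omega>, \<lambda>i\<in>tf_grid n. x \<omega> i))
          (count_space (k_subsets n k) \<Otimes>\<^sub>M PiM (tf_grid n) (\<lambda>_. borel :: complex measure))))"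

end

theory Submission
  imports Defs
begin

text \<open>
  Let \<open>H\<close> be the Gram matrix of the dictionary minus the identity, restricted to a random support
  of size \<open>k\<close>.  If \<open>H\<close> has norm at most \<open>1/2\<close>, the usual dual certificate, a Hoeffding bound
  for the random phases and a union bound give recovery outside an event of probability
  \<open>O(n\<^sup>2) * exp (- 3 V / 16)\<close>, where \<open>V = 1 / (k \<mu>\<^sup>2)\<close> and \<open>\<mu>\<close> is the coherence.  Since
  \<open>V \<ge> 8 * ln (2 n\<^sup>2 / \<epsilon>)\<close>, this is a small fraction of \<open>\<epsilon>\<close>.

  The norm of \<open>H\<close> is controlled by \<open>E (trace (H ^ (2 m)))\<close> with \<open>m\<close> about \<open>V / 8\<close>.  Decomposing
  closed walks at an index \<open>i\<close> by their first returns expresses the diagonal entry at \<open>i\<close> through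
  quadratic forms \<open>\<langle>b, H' ^ j b\<rangle>\<close>, where \<open>H'\<close> is \<open>H\<close> without \<open>i\<close> and \<open>b\<close> is the deleted column.
  Their products are linearised by log-convexity, and then averaging over \<open>i\<close> uses that the
  dictionary is a tight frame, so that \<open>b\<close> has size about \<open>k / n\<close> on average even though it is only
  bounded by \<open>k \<mu>\<^sup>2\<close>.  Induction on \<open>k\<close> yields the probability bound \<open>k * exp (- V / 8)\<close>, again
  a small fraction of \<open>\<epsilon>\<close>.  Hence the failure probability is at most \<open>\<epsilon>\<close>; the hypothesis
  \<open>s \<ge> 1\<close> only serves to ensure that \<open>n / k\<close> is large.  In part (b) the exceptional set of windows
  costs another \<open>4 * n powr (- \<sigma>)\<close>.
\<close>

section \<open>Trace moments of Hermitian kernels\<close>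

text \<open>A closed walk at \<open>i\<close> is a product of several returns that depend on the
  same random support, so its mean does not factor. The return weights are therefore dominated by
  nonnegative \<open>G\<close> with \<open>G i * G j \<le> R * G (i + j)\<close>. Merging all
  factors into one costs the pessimistic factor \<open>R\<close> per merger, and only the last
  remaining factor is averaged, which brings the small ratio k / n. The total loss
  \<open>(1 + R / a\<^sup>2) ^ (2 * l)\<close> stays bounded as long as \<open>l\<close> is of order
  V, since \<open>R\<close> is 1 / V; this fixes the order of the moment.

  Deleting an index relates moments at size k + 1 to moments of the same order at size k. Hence the
  induction is on the size and carries all orders at once.

  A second obstacle is measurability: \<open>measure\<close> assigns 0 to a set that is not
  measurable, so a lower bound on the recovery probability requires the recovery event, defined by a
  quantifier over all competitors, to be measurable.\<close>

definition inner_on :: "'i set \<Rightarrow> ('i \<Rightarrow> complex) \<Rightarrow> ('i \<Rightarrow> complex) \<Rightarrow> complex" where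
  "inner_on S u v = (\<Sum>t\<in>S. cnj (u t) * v t)"

definition norm_on :: "'i set \<Rightarrow> ('i \<Rightarrow> complex) \<Rightarrow> real" where
  "norm_on S v = L2_set (\<lambda>t. cmod (v t)) S"

lemma norm_on_nonneg [simp]: "0 \<le> norm_on S v"
  by (simp add: norm_on_def L2_set_nonneg)

lemma norm_on_sq: "(norm_on S v)\<^sup>2 = (\<Sum>t\<in>S. (cmod (v t))\<^sup>2)"
  by (simp add: norm_on_def L2_set_def sum_nonneg)

lemma inner_on_self: "inner_on S v v = complex_of_real ((norm_on S v)\<^sup>2)"
proof -
  have "cnj (v t) * v t = complex_of_real ((cmod (v t))\<^sup>2)" for t
    by (metis complex_norm_square mult.commute)
  then show ?thesis by (simp add: inner_on_def norm_on_sq)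
qed

lemma inner_on_CS: "cmod (inner_on S u v) \<le> norm_on S u * norm_on S v"
proof -
  have "cmod (inner_on S u v) \<le> (\<Sum>t\<in>S. \<bar>cmod (u t)\<bar> * \<bar>cmod (v t)\<bar>)"
    unfolding inner_on_def by (rule order_trans[OF norm_sum]) (simp add: norm_mult)
  also have "\<dots> \<le> norm_on S u * norm_on S v"
    unfolding norm_on_def by (rule L2_set_mult_ineq)
  finally show ?thesis .
qed

lemma norm_on_triangle: "norm_on S (\<lambda>t. u t + v t) \<le> norm_on S u + norm_on S v"
proof -
  have "norm_on S (\<lambda>t. u t + v t) \<le> L2_set (\<lambda>t. cmod (u t) + cmod (v t)) S"
    unfolding norm_on_def by (rule L2_set_mono) (auto simp: norm_triangle_ineq)
  also have "\<dots> \<le> norm_on S u + norm_on S v"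
    unfolding norm_on_def by (rule L2_set_triangle_ineq)
  finally show ?thesis .
qed

lemma norm_on_cong: "(\<And>t. t \<in> S \<Longrightarrow> u t = v t) \<Longrightarrow> norm_on S u = norm_on S v"
  by (simp add: norm_on_def cong: L2_set_cong)

lemma inner_on_cong:
  "(\<And>t. t \<in> S \<Longrightarrow> u t = u' t) \<Longrightarrow> (\<And>t. t \<in> S \<Longrightarrow> v t = v' t) \<Longrightarrow> inner_on S u v = inner_on S u' v'"
  by (simp add: inner_on_def)

lemma inner_on_cnj: "cnj (inner_on S u v) = inner_on S v u"
  by (simp add: inner_on_def mult.commute)

lemma cmod_le_norm_on: "finite S \<Longrightarrow> t \<in> S \<Longrightarrow> cmod (v t) \<le> norm_on S v"
  unfolding norm_on_def by (rule member_le_L2_set)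

definition delta :: "'i \<Rightarrow> 'i \<Rightarrow> complex" where
  "delta i = (\<lambda>t. if t = i then 1 else 0)"

lemma inner_on_delta: "finite S \<Longrightarrow> i \<in> S \<Longrightarrow> inner_on S (delta i) v = v i"
  by (simp add: inner_on_def delta_def if_distrib[of cnj] if_distrib[of "\<lambda>x. x * _"] cong: if_cong)

text \<open>Log-convexity says that the ratios \<open>c (Suc j) / c j\<close> increase with j. The
  cross-multiplied form remains valid when \<open>c\<close> has zeros.\<close>

lemma log_convex_swap:
  fixes c :: "nat \<Rightarrow> real"
  assumes nn: "\<And>j. 0 \<le> c j" and lc: "\<And>j. (c (Suc j))\<^sup>2 \<le> c j * c (Suc (Suc j))"
  shows "m \<le> l \<Longrightarrow> c (Suc m) * c l \<le> c m * c (Suc l)"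
proof (induction l rule: dec_induct)
  case base
  then show ?case by (simp add: mult.commute)
next
  case (step l)
  show ?case
  proof (cases "c (Suc l) = 0")
    case True
    then show ?thesis by (simp add: nn)
  next
    case False
    then have pos: "c (Suc l) > 0" using nn[of "Suc l"] by linarith
    have "(c (Suc m) * c (Suc l)) * c (Suc l) = c (Suc m) * (c (Suc l))\<^sup>2"
      by (simp add: power2_eq_square)
    also have "\<dots> \<le> c (Suc m) * (c l * c (Suc (Suc l)))"
      by (intro mult_left_mono lc nn)
    also have "\<dots> = (c (Suc m) * c l) * c (Suc (Suc l))" by simp
    also have "\<dots> \<le> (c m * c (Suc l)) * c (Suc (Suc l))"
      by (intro mult_right_mono step.IH nn)
    also have "\<dots> = (c m * c (Suc (Suc l))) * c (Suc l)" by simp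
    finally show ?thesis using pos by (metis mult_right_le_imp_le)
  qed
qed

text \<open>Moving one unit at a time from the smaller index to the larger drives the pair (m, l) to
  (0, m + l). This is the merging inequality, used both for operator norms and for return
  weights.\<close>

lemma log_convex_prod:
  fixes c :: "nat \<Rightarrow> real"
  assumes nn: "\<And>j. 0 \<le> c j" and lc: "\<And>j. (c (Suc j))\<^sup>2 \<le> c j * c (Suc (Suc j))"
  shows "c m * c l \<le> c 0 * c (m + l)"
proof -
  have *: "m \<le> l \<Longrightarrow> c m * c l \<le> c 0 * c (m + l)" for m l
  proof (induction m arbitrary: l)
    case 0
    then show ?case by simp
  next
    case (Suc m)
    have "c (Suc m) * c l \<le> c m * c (Suc l)"
      using Suc.prems by (intro log_convex_swap nn lc) simp
    also have "\<dots> \<le> c 0 * c (m + Suc l)" using Suc.prems by (intro Suc.IH) simp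
    finally show ?case by simp
  qed
  show ?thesis
    using *[of m l] *[of l m] by (cases "m \<le> l") (auto simp: mult.commute add.commute)
qed

section \<open>Compressions of a Hermitian kernel and their trace moments\<close>

locale hermitian_kernel =
  fixes H :: "'i \<Rightarrow> 'i \<Rightarrow> complex"
  assumes herm: "\<And>i j. cnj (H i j) = H j i"
begin

text \<open>The compression of \<open>H\<close> to S. Values outside S are produced as well, but
  iterates, inner products and norms over S never read them.\<close>

definition app :: "'i set \<Rightarrow> ('i \<Rightarrow> complex) \<Rightarrow> 'i \<Rightarrow> complex" where
  "app S v = (\<lambda>s. \<Sum>t\<in>S. H s t * v t)"

lemma app_adjoint: "inner_on S (app S u) v = inner_on S u (app S v)"
proof -
  have "inner_on S (app S u) v = (\<Sum>s\<in>S. \<Sum>t\<in>S. H t s * cnj (u t) * v s)"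
    by (simp add: inner_on_def app_def sum_distrib_right herm)
  also have "\<dots> = (\<Sum>t\<in>S. \<Sum>s\<in>S. H t s * cnj (u t) * v s)" by (rule sum.swap)
  also have "\<dots> = inner_on S u (app S v)"
    by (simp add: inner_on_def app_def sum_distrib_left algebra_simps)
  finally show ?thesis .
qed

lemma app_pow_adjoint: "inner_on S ((app S ^^ m) u) v = inner_on S u ((app S ^^ m) v)"
proof (induction m arbitrary: v)
  case (Suc m)
  have "inner_on S ((app S ^^ Suc m) u) v = inner_on S ((app S ^^ m) u) (app S v)"
    by (simp add: app_adjoint)
  also have "\<dots> = inner_on S u ((app S ^^ m) (app S v))" by (rule Suc.IH)
  finally show ?case by (simp add: funpow_swap1)
qed simp

lemma inner_app_pow: "inner_on S ((app S ^^ m) u) ((app S ^^ l) u) = inner_on S u ((app S ^^ (m + l)) u)"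
  by (simp add: app_pow_adjoint funpow_add)

text \<open>By self-adjointness the squared norm of the power Suc m is the inner product of the
  powers m and m + 2; Cauchy-Schwarz does the rest.\<close>

lemma norm_app_pow_log_convex:
  "(norm_on S ((app S ^^ Suc m) v))\<^sup>2
     \<le> norm_on S ((app S ^^ m) v) * norm_on S ((app S ^^ Suc (Suc m)) v)"
proof -
  have "inner_on S ((app S ^^ Suc m) v) ((app S ^^ Suc m) v)
      = inner_on S ((app S ^^ m) v) ((app S ^^ Suc (Suc m)) v)"
    unfolding inner_app_pow by simp
  then have "complex_of_real ((norm_on S ((app S ^^ Suc m) v))\<^sup>2)
      = inner_on S ((app S ^^ m) v) ((app S ^^ Suc (Suc m)) v)"
    by (simp only: inner_on_self)
  then have "(norm_on S ((app S ^^ Suc m) v))\<^sup>2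
      = cmod (inner_on S ((app S ^^ m) v) ((app S ^^ Suc (Suc m)) v))"
    by (metis abs_of_nonneg norm_of_real zero_le_power2)
  then show ?thesis by (metis inner_on_CS)
qed

text \<open>This is the trace of the power \<open>2 * m\<close> of the compression to S, written as
  a sum of squared column norms so that nonnegativity is visible.\<close>

definition trace_pow :: "'i set \<Rightarrow> nat \<Rightarrow> real" where
  "trace_pow S m = (\<Sum>i\<in>S. (norm_on S ((app S ^^ m) (delta i)))\<^sup>2)"

lemma trace_pow_nonneg: "0 \<le> trace_pow S m"
  by (simp add: trace_pow_def sum_nonneg)

text \<open>The operator norm is at most the Hilbert-Schmidt norm, applied to the m-th power; each
  row of that power is read off as a column by self-adjointness.\<close>

lemma norm_app_pow_le:
  assumes "finite S"
  shows "(norm_on S ((app S ^^ m) v))\<^sup>2 \<le> trace_pow S m * (norm_on S v)\<^sup>2"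
proof -
  have "(cmod ((app S ^^ m) v s))\<^sup>2 \<le> (norm_on S ((app S ^^ m) (delta s)))\<^sup>2 * (norm_on S v)\<^sup>2"
    if "s \<in> S" for s
  proof -
    have "(app S ^^ m) v s = inner_on S (delta s) ((app S ^^ m) v)"
      using inner_on_delta[OF assms that] by simp
    also have "\<dots> = inner_on S ((app S ^^ m) (delta s)) v" by (simp add: app_pow_adjoint)
    finally have "cmod ((app S ^^ m) v s) \<le> norm_on S ((app S ^^ m) (delta s)) * norm_on S v"
      using inner_on_CS by metis
    then show ?thesis by (metis norm_ge_zero power_mono power_mult_distrib)
  qed
  then have "(\<Sum>s\<in>S. (cmod ((app S ^^ m) v s))\<^sup>2)
      \<le> (\<Sum>s\<in>S. (norm_on S ((app S ^^ m) (delta s)))\<^sup>2 * (norm_on S v)\<^sup>2)"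
    by (rule sum_mono)
  then show ?thesis by (simp add: norm_on_sq[of S "(app S ^^ m) v"] trace_pow_def sum_distrib_right)
qed

text \<open>Log-convexity stands in for the spectral theorem: it interpolates \<open>c 1 ^ m\<close>
  between \<open>c 0\<close> and \<open>c m\<close>, so the m-th root of a norm bound for the m-th
  power bounds \<open>H\<close> itself.\<close>

lemma norm_app_le_of_trace_pow:
  assumes "finite S" "m > 0" "trace_pow S m \<le> d ^ (2 * m)" "d \<ge> 0"
  shows "norm_on S (app S v) \<le> d * norm_on S v"
proof -
  define c where "c j = norm_on S ((app S ^^ j) v)" for j
  have prod: "c i * c j \<le> c 0 * c (i + j)" for i j
    by (rule log_convex_prod) (simp_all add: c_def norm_app_pow_log_convex[simplified])
  have nn: "0 \<le> c j" for j by (simp add: c_def)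
  have pw: "c 1 ^ Suc j \<le> c 0 ^ j * c (Suc j)" for j
  proof (induction j)
    case (Suc j)
    have "c 1 ^ Suc (Suc j) \<le> c 1 * (c 0 ^ j * c (Suc j))"
      using mult_left_mono[OF Suc.IH nn[of 1]] by simp
    also have "\<dots> = c 0 ^ j * (c (Suc j) * c 1)" by simp
    also have "\<dots> \<le> c 0 ^ j * (c 0 * c (Suc j + 1))"
      by (intro mult_left_mono prod zero_le_power nn)
    finally show ?case by (simp add: mult_ac)
  qed simp
  obtain l where l: "m = Suc l" using assms(2) by (cases m) auto
  have "(c m)\<^sup>2 \<le> d ^ (2 * m) * (c 0)\<^sup>2"
    using norm_app_pow_le[OF assms(1), of m v] assms(3)
    by (smt (verit) c_def funpow_0 mult_right_mono zero_le_power2)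
  then have "(c m)\<^sup>2 \<le> (d ^ m * c 0)\<^sup>2"
    by (simp add: power_mult_distrib power_mult[symmetric] mult.commute)
  then have "c m \<le> d ^ m * c 0"
    by (rule power2_le_imp_le) (simp add: assms(4) nn)
  then have "c 1 ^ m \<le> c 0 ^ l * (d ^ m * c 0)"
    using pw[of l] l by (smt (verit) mult_left_mono nn zero_le_power)
  also have "\<dots> = (d * c 0) ^ m" by (simp add: l power_mult_distrib)
  finally have "c 1 ^ Suc l \<le> (d * c 0) ^ Suc l" by (simp only: l)
  moreover have "0 \<le> d * c 0" by (simp add: assms(4) nn)
  ultimately have "c 1 \<le> d * c 0" by (rule power_le_imp_le_base)
  then show ?thesis by (simp add: c_def)
qed

end

text \<open>In the application \<open>F p w\<close> is the weight of the closed walks of length \<open>p\<close> at an index and \<open>g j w\<close>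
  the weight of its first returns.  The growth rate \<open>y = a + R / a\<close> satisfies \<open>R = a * (y - a)\<close>, which
  makes the recursion telescope.\<close>

lemma finite_weighted_returns:
  fixes F :: "nat \<Rightarrow> 'w \<Rightarrow> complex" and G :: "nat \<Rightarrow> 'w \<Rightarrow> real" and g :: "nat \<Rightarrow> 'w \<Rightarrow> complex"
  assumes F0: "\<And>w. w \<in> A \<Longrightarrow> F 0 w = 1" and F1: "\<And>w. w \<in> A \<Longrightarrow> F 1 w = 0"
    and rec: "\<And>w p. w \<in> A \<Longrightarrow> F (Suc (Suc p)) w = (\<Sum>j\<le>p. g j w * F (p - j) w)"
    and gG: "\<And>w j. w \<in> A \<Longrightarrow> cmod (g j w) \<le> G j w"
    and GG: "\<And>w i j. w \<in> A \<Longrightarrow> G i w * G j w \<le> R * G (i + j) w"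
    and sumG: "\<And>q. q \<le> Q \<Longrightarrow> (\<Sum>w\<in>A. G q w) \<le> Y * a ^ q"
    and a: "a > 0" and R: "R \<ge> 0" and Y: "Y \<ge> 0"
  shows "p \<le> Q \<Longrightarrow> (\<Sum>w\<in>A. cmod (F (Suc (Suc p)) w)) \<le> Y * (a + R / a) ^ p"
proof -
  define y where "y = a + R / a"
  have y: "a \<le> y" "R = a * (y - a)" using a R by (simp_all add: y_def field_simps)
  have Gnn: "0 \<le> G j w" if "w \<in> A" for j w using gG[OF that, of j] norm_ge_zero order_trans by blast
  \<comment> \<open>By \<open>R = a * (y - a)\<close> the sum is a telescoping difference of powers
    of y and a.\<close>
  have key: "a ^ p + R * (\<Sum>j<p-1. a ^ j * y ^ (p - 2 - j)) \<le> y ^ p" for p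
  proof (cases p)
    case 0 then show ?thesis by simp
  next
    case (Suc q)
    have "(y - a) * (\<Sum>j<q. a ^ j * y ^ (q - 1 - j)) = y ^ q - a ^ q"
      using power_diff_sumr2[of a q y] by (simp add: algebra_simps)
    then have "a ^ p + R * (\<Sum>j<p-1. a ^ j * y ^ (p - 2 - j)) = a ^ p + a * (y ^ q - a ^ q)"
      unfolding y(2) by (simp add: Suc numeral_2_eq_2)
    also have "\<dots> = a * y ^ q" by (simp add: Suc algebra_simps)
    also have "\<dots> \<le> y ^ p" using y(1) a by (simp add: Suc mult_right_mono)
    finally show ?thesis .
  qed
  \<comment> \<open>The summand j = p carries \<open>F 0 = 1\<close> and j = p - 1 carries
    \<open>F 1 = 0\<close>. What remains is the range j < p - 1, empty for p = 0 and p = 1.\<close>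
  have bnd: "cmod (F (Suc (Suc p)) w) \<le> G p w + (\<Sum>j<p-1. G j w * cmod (F (Suc (Suc (p - 2 - j))) w))"
    if w: "w \<in> A" for p w
  proof -
    have term_le: "cmod (g j w * F (p - j) w) \<le> G j w * cmod (F (p - j) w)" for j
      by (simp add: norm_mult mult_right_mono gG w)
    have "cmod (F (Suc (Suc p)) w) \<le> (\<Sum>j\<le>p. G j w * cmod (F (p - j) w))"
      unfolding rec[OF w] by (intro order_trans[OF norm_sum] sum_mono term_le)
    also have "\<dots> = G p w + (\<Sum>j<p-1. G j w * cmod (F (Suc (Suc (p - 2 - j))) w))"
    proof (cases p)
      case 0 then show ?thesis by (simp add: F0 w)
    next
      case (Suc q)
      have "(\<Sum>j\<le>p. G j w * cmod (F (p - j) w))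
          = (\<Sum>j<q. G j w * cmod (F (p - j) w)) + G q w * cmod (F 1 w) + G p w * cmod (F 0 w)"
        by (simp add: Suc lessThan_Suc_atMost[symmetric])
      moreover have "(\<Sum>j<q. G j w * cmod (F (p - j) w))
          = (\<Sum>j<q. G j w * cmod (F (Suc (Suc (p - 2 - j))) w))"
        by (intro sum.cong refl) (auto simp: Suc Suc_diff_le Suc_diff_Suc numeral_2_eq_2)
      ultimately show ?thesis using F0[OF w] F1[OF w] by (simp add: Suc)
    qed
    finally show ?thesis .
  qed
  \<comment> \<open>The bound for F alone is not inductive, because one expansion leaves products of
    some \<open>G j\<close> with a shorter F. With a weight \<open>G r\<close> in front,
    \<open>G r * G j\<close> merges into \<open>R * G (r + j)\<close> and the induction
    closes.\<close>
  have weighted: "r + p \<le> Q \<Longrightarrow> (\<Sum>w\<in>A. G r w * cmod (F (Suc (Suc p)) w)) \<le> R * (Y * a ^ r * y ^ p)" for p r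
  proof (induction p arbitrary: r rule: less_induct)
    case (less p)
    have "(\<Sum>w\<in>A. G r w * cmod (F (Suc (Suc p)) w))
       \<le> (\<Sum>w\<in>A. R * G (r + p) w + (\<Sum>j<p-1. R * (G (r + j) w * cmod (F (Suc (Suc (p - 2 - j))) w))))"
    proof (rule sum_mono)
      fix w assume w: "w \<in> A"
      have "G r w * cmod (F (Suc (Suc p)) w)
        \<le> G r w * (G p w + (\<Sum>j<p-1. G j w * cmod (F (Suc (Suc (p - 2 - j))) w)))"
        by (intro mult_left_mono bnd Gnn w)
      also have "\<dots> = G r w * G p w + (\<Sum>j<p-1. (G r w * G j w) * cmod (F (Suc (Suc (p - 2 - j))) w))"
        by (simp add: distrib_left sum_distrib_left mult.assoc)
      also have "\<dots> \<le> R * G (r + p) w + (\<Sum>j<p-1. (R * G (r + j) w) * cmod (F (Suc (Suc (p - 2 - j))) w))"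
        by (intro add_mono sum_mono mult_right_mono GG w) auto
      finally show "G r w * cmod (F (Suc (Suc p)) w) \<le> R * G (r + p) w
          + (\<Sum>j<p-1. R * (G (r + j) w * cmod (F (Suc (Suc (p - 2 - j))) w)))"
        by (simp add: mult.assoc)
    qed
    also have "\<dots> = R * ((\<Sum>w\<in>A. G (r + p) w)
        + (\<Sum>j<p-1. \<Sum>w\<in>A. G (r + j) w * cmod (F (Suc (Suc (p - 2 - j))) w)))"
      by (simp add: sum.distrib sum_distrib_left distrib_left sum.swap[of _ _ A])
    also have "\<dots> \<le> R * (Y * a ^ (r + p) + (\<Sum>j<p-1. R * (Y * a ^ (r + j) * y ^ (p - 2 - j))))"
      using less.prems by (intro mult_left_mono add_mono sum_mono sumG less.IH R) auto
    also have "\<dots> = R * (Y * a ^ r * (a ^ p + R * (\<Sum>j<p-1. a ^ j * y ^ (p - 2 - j))))"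
      by (simp add: power_add sum_distrib_left algebra_simps)
    also have "\<dots> \<le> R * (Y * a ^ r * y ^ p)"
      using a Y by (intro mult_left_mono key R) auto
    finally show ?case .
  qed
  assume p: "p \<le> Q"
  have "(\<Sum>w\<in>A. cmod (F (Suc (Suc p)) w))
      \<le> (\<Sum>w\<in>A. G p w + (\<Sum>j<p-1. G j w * cmod (F (Suc (Suc (p - 2 - j))) w)))"
    by (intro sum_mono bnd)
  also have "\<dots> = (\<Sum>w\<in>A. G p w) + (\<Sum>j<p-1. \<Sum>w\<in>A. G j w * cmod (F (Suc (Suc (p - 2 - j))) w))"
    by (simp add: sum.distrib sum.swap[of _ _ A])
  also have "\<dots> \<le> Y * a ^ p + (\<Sum>j<p-1. R * (Y * a ^ j * y ^ (p - 2 - j)))"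
    using p by (intro add_mono sum_mono sumG weighted) auto
  also have "\<dots> = Y * (a ^ p + R * (\<Sum>j<p-1. a ^ j * y ^ (p - 2 - j)))"
    by (simp add: sum_distrib_left algebra_simps)
  also have "\<dots> \<le> Y * y ^ p" by (intro mult_left_mono key Y)
  finally show "(\<Sum>w\<in>A. cmod (F (Suc (Suc p)) w)) \<le> Y * (a + R / a) ^ p" by (simp add: y_def)
qed

section \<open>First-return decomposition and dominating return weights\<close>

context hermitian_kernel
begin

text \<open>Split a walk from i to s at its last visit to i, at time \<open>m - Suc j\<close>: the
  next step enters S with the weights \<open>H t i\<close>, and the remaining j steps stay in
  S.\<close>

lemma walk_off_new_index:
  assumes S: "finite S" "i \<notin> S" and s: "s \<in> S"
  shows "(app (insert i S) ^^ m) (delta i) s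
    = (\<Sum>j<m. (app (insert i S) ^^ (m - Suc j)) (delta i) i * (app S ^^ j) (\<lambda>t. H t i) s)"
  using s
proof (induction m arbitrary: s)
  case 0
  then show ?case using S by (auto simp: delta_def)
next
  case (Suc m)
  define u where "u j = (app (insert i S) ^^ j) (delta i)" for j
  define v where "v j = (app S ^^ j) (\<lambda>t. H t i)" for j
  have "u (Suc m) s = H s i * u m i + (\<Sum>t\<in>S. H s t * u m t)"
    using S by (simp add: u_def app_def)
  also have "(\<Sum>t\<in>S. H s t * u m t) = (\<Sum>t\<in>S. \<Sum>j<m. u (m - Suc j) i * (H s t * v j t))"
    using Suc.IH by (simp add: u_def v_def sum_distrib_left algebra_simps)
  also have "\<dots> = (\<Sum>j<m. u (m - Suc j) i * v (Suc j) s)"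
    by (subst sum.swap) (simp add: v_def app_def sum_distrib_left)
  also have "H s i * u m i + \<dots> = (\<Sum>j<Suc m. u (Suc m - Suc j) i * v j s)"
    by (subst sum.lessThan_Suc_shift) (simp add: v_def)
  finally show ?case by (simp add: u_def v_def)
qed

text \<open>Split a closed walk at the last visit to i before its end; the final excursion has
  length j + 2. Since \<open>H i i = 0\<close>, an excursion has at least two steps, and its weight
  is a quadratic form in the deleted column.\<close>

lemma first_return:
  assumes S: "finite S" "i \<notin> S" and H0: "H i i = 0"
  shows "(app (insert i S) ^^ Suc (Suc p)) (delta i) i
    = (\<Sum>j\<le>p. inner_on S (\<lambda>t. H t i) ((app S ^^ j) (\<lambda>t. H t i))
                * (app (insert i S) ^^ (p - j)) (delta i) i)"
proof -
  define u where "u j = (app (insert i S) ^^ j) (delta i)" for j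
  define v where "v j = (app S ^^ j) (\<lambda>t. H t i)" for j
  have "u (Suc (Suc p)) i = (\<Sum>t\<in>S. H i t * u (Suc p) t)"
    using S H0 by (simp add: u_def app_def)
  also have "\<dots> = (\<Sum>t\<in>S. \<Sum>j<Suc p. cnj (H t i) * v j t * u (p - j) i)"
  proof (intro sum.cong refl)
    fix t assume "t \<in> S"
    then have "u (Suc p) t = (\<Sum>j<Suc p. u (p - j) i * v j t)"
      using walk_off_new_index[OF S, of t "Suc p"] by (simp only: u_def v_def diff_Suc_Suc)
    then show "H i t * u (Suc p) t = (\<Sum>j<Suc p. cnj (H t i) * v j t * u (p - j) i)"
      by (simp only: sum_distrib_left herm mult_ac)
  qed
  also have "\<dots> = (\<Sum>j<Suc p. inner_on S (\<lambda>t. H t i) (v j) * u (p - j) i)"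
    by (subst sum.swap) (simp add: inner_on_def sum_distrib_right)
  finally show ?thesis by (simp only: u_def v_def lessThan_Suc_atMost)
qed

lemma return_even:
  assumes "finite S" "i \<in> S"
  shows "(app S ^^ (2 * m)) (delta i) i = complex_of_real ((norm_on S ((app S ^^ m) (delta i)))\<^sup>2)"
proof -
  have "(app S ^^ (2 * m)) (delta i) i = inner_on S (delta i) ((app S ^^ (m + m)) (delta i))"
    using inner_on_delta[OF assms] by (simp add: mult_2)
  then show ?thesis unfolding inner_app_pow[symmetric] inner_on_self .
qed

text \<open>For even q this is the quadratic form of the q-th power at b, for odd q the geometric
  mean of its two even neighbours. Odd quadratic forms need not be nonnegative; this majorant is,
  and it can be merged.\<close>

definition half_prod :: "'i set \<Rightarrow> ('i \<Rightarrow> complex) \<Rightarrow> nat \<Rightarrow> real" where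
  "half_prod S b q = norm_on S ((app S ^^ (q div 2)) b) * norm_on S ((app S ^^ ((q + 1) div 2)) b)"

lemma inner_le_half_prod: "cmod (inner_on S b ((app S ^^ q) b)) \<le> half_prod S b q"
proof -
  have "q = q div 2 + (q + 1) div 2" by arith
  then have "inner_on S b ((app S ^^ q) b)
      = inner_on S ((app S ^^ (q div 2)) b) ((app S ^^ ((q + 1) div 2)) b)"
    using inner_app_pow[of S "q div 2" b "(q + 1) div 2"] by simp
  then show ?thesis unfolding half_prod_def using inner_on_CS by metis
qed

text \<open>The four norms are regrouped into two pairs whose indices add up to the two halves of i
  + j, and each pair is merged by log-convexity at the cost of one factor
  \<open>norm_on S b\<close>.\<close>

lemma half_prod_submult: "half_prod S b i * half_prod S b j \<le> (norm_on S b)\<^sup>2 * half_prod S b (i + j)"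
proof -
  define c where "c m = norm_on S ((app S ^^ m) b)" for m
  have prod: "c i * c j \<le> c 0 * c (i + j)" for i j
    by (rule log_convex_prod) (simp_all add: c_def norm_app_pow_log_convex[simplified])
  have nn: "0 \<le> c m" for m by (simp add: c_def)
  obtain p q r t where pq: "half_prod S b i * half_prod S b j = (c p * c q) * (c r * c t)"
    and "p + q = (i + j) div 2" "r + t = (i + j + 1) div 2"
  proof (cases "even i \<or> even j")
    case True
    then have "i div 2 + j div 2 = (i + j) div 2" "(i + 1) div 2 + (j + 1) div 2 = (i + j + 1) div 2"
      by (auto elim!: evenE)
    then show ?thesis
      by (intro that[of "i div 2" "j div 2" "(i + 1) div 2" "(j + 1) div 2"]) (simp_all add: half_prod_def c_def)
  next
    case False
    \<comment> \<open>Two odd indices: adding the two rounded-down halves would lose a unit, so a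
      rounded-down half is paired with a rounded-up one.\<close>
    then have "i div 2 + (j + 1) div 2 = (i + j) div 2" "(i + 1) div 2 + j div 2 = (i + j + 1) div 2"
      by (auto elim!: oddE)
    then show ?thesis
      by (intro that[of "i div 2" "(j + 1) div 2" "(i + 1) div 2" "j div 2"]) (simp_all add: half_prod_def c_def)
  qed
  then have "(c p * c q) * (c r * c t) \<le> (c 0 * c ((i + j) div 2)) * (c 0 * c ((i + j + 1) div 2))"
    by (metis mult_mono prod nn mult_nonneg_nonneg)
  also have "\<dots> = (norm_on S b)\<^sup>2 * half_prod S b (i + j)"
    by (simp add: half_prod_def c_def power2_eq_square)
  finally show ?thesis by (simp add: pq)
qed

end

text \<open>Double counting of pairs of a set and one of its elements. Deleting the element leaves a
  smaller set together with an outside index, which is the induction step in the support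
  size.\<close>

lemma sum_k_subsets_remove:
  fixes f :: "'i set \<Rightarrow> 'i \<Rightarrow> 'b :: comm_monoid_add"
  assumes "finite I"
  shows "(\<Sum>S | S \<subseteq> I \<and> card S = Suc k. \<Sum>i\<in>S. f S i)
       = (\<Sum>S | S \<subseteq> I \<and> card S = k. \<Sum>i\<in>I - S. f (insert i S) i)"
proof -
  have fin: "finite {S. S \<subseteq> I \<and> card S = m}" for m using assms by simp
  have finS: "finite S" if "S \<subseteq> I" for S using assms finite_subset that by blast
  have "(\<Sum>S | S \<subseteq> I \<and> card S = Suc k. \<Sum>i\<in>S. f S i)
      = (\<Sum>(S, i)\<in>(SIGMA S:{S. S \<subseteq> I \<and> card S = Suc k}. S). f S i)"
    by (rule sum.Sigma) (use fin finS in auto)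
  also have "\<dots> = (\<Sum>(S, i)\<in>(SIGMA S:{S. S \<subseteq> I \<and> card S = k}. I - S). f (insert i S) i)"
    by (rule sum.reindex_bij_witness[where i = "\<lambda>(S, i). (insert i S, i)" and j = "\<lambda>(S, i). (S - {i}, i)"])
       (auto simp: finS insert_absorb card_insert_disjoint)
  also have "\<dots> = (\<Sum>S | S \<subseteq> I \<and> card S = k. \<Sum>i\<in>I - S. f (insert i S) i)"
    by (rule sum.Sigma[symmetric]) (use fin assms in auto)
  finally show ?thesis .
qed

section \<open>Averaging over supports of a tight frame\<close>

lemma am_gm_scaled:
  fixes x y a :: real
  assumes "a > 0"
  shows "x * y \<le> (a * x\<^sup>2 + y\<^sup>2 / a) / 2"
proof -
  have "0 \<le> (a * x - y)\<^sup>2 / a" using assms by simp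
  also have "\<dots> = a * x\<^sup>2 - 2 * (x * y) + y\<^sup>2 / a"
    using assms by (simp add: power2_eq_square field_simps)
  finally show ?thesis by simp
qed

text \<open>Only the Gram matrix of the dictionary is kept. Tightness reads Gr^2 = T Gr, that is,
  for nonzero T, Gr / T is an orthogonal projection; frame vectors do not occur in this
  form.\<close>

locale tight_gram =
  fixes I :: "'i set" and Gr :: "'i \<Rightarrow> 'i \<Rightarrow> complex" and T \<mu> :: real
  assumes finite_I: "finite I"
    and Gr_herm: "\<And>i j. cnj (Gr i j) = Gr j i"
    and Gr_diag: "\<And>i. i \<in> I \<Longrightarrow> Gr i i = 1"
    and Gr_tight: "\<And>i j. i \<in> I \<Longrightarrow> j \<in> I \<Longrightarrow> (\<Sum>t\<in>I. Gr i t * Gr t j) = T * Gr i j"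
    and Gr_coherence: "\<And>i j. i \<in> I \<Longrightarrow> j \<in> I \<Longrightarrow> i \<noteq> j \<Longrightarrow> cmod (Gr i j) \<le> \<mu>"
    and T_nonneg: "T \<ge> 0" and \<mu>_nonneg: "\<mu> \<ge> 0"
begin

definition H :: "'i \<Rightarrow> 'i \<Rightarrow> complex" where
  "H i j = (if i = j then 0 else Gr i j)"

sublocale hermitian_kernel H
  by unfold_locales (simp add: H_def Gr_herm)

lemma H_diag [simp]: "H i i = 0"
  by (simp add: H_def)

lemma gram_apply:
  assumes "finite S" "S \<subseteq> I" "s \<in> S"
  shows "(\<Sum>t\<in>S. Gr s t * v t) = v s + app S v s"
proof -
  have "(\<Sum>t\<in>S. Gr s t * v t) = (\<Sum>t\<in>S. (if s = t then v t else 0) + H s t * v t)"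
    using assms by (intro sum.cong refl) (auto simp: H_def Gr_diag)
  also have "\<dots> = v s + app S v s" using assms by (simp add: sum.distrib app_def)
  finally show ?thesis .
qed

lemma norm_gram_column:
  assumes "finite S" "S \<subseteq> I" "i \<in> I - S"
  shows "(norm_on S (\<lambda>t. Gr t i))\<^sup>2 \<le> real (card S) * \<mu>\<^sup>2"
proof -
  have "(norm_on S (\<lambda>t. Gr t i))\<^sup>2 = (\<Sum>t\<in>S. (cmod (Gr t i))\<^sup>2)" by (rule norm_on_sq)
  also have "\<dots> \<le> (\<Sum>t\<in>S. \<mu>\<^sup>2)"
    using assms Gr_coherence by (intro sum_mono power_mono) auto
  finally show ?thesis by simp
qed

text \<open>Here tightness enters: the outer products of all columns, restricted to S, add up to
  \<open>T\<close> times the restricted Gram matrix, which is T (1 + H) on S. The total is thus T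
  times the trace of H^(2j) (1 + H). The sum runs over all of I and over columns of
  \<open>Gr\<close> with their diagonal entries, as this identity requires.\<close>

lemma sum_norm_app_pow_gram_columns:
  assumes S: "S \<subseteq> I"
  shows "(\<Sum>i\<in>I. (norm_on S ((app S ^^ j) (\<lambda>t. Gr t i)))\<^sup>2)
    = T * (\<Sum>s\<in>S. (norm_on S ((app S ^^ j) (delta s)))\<^sup>2
        + Re (inner_on S ((app S ^^ j) (delta s)) ((app S ^^ Suc j) (delta s))))"
proof -
  have finS: "finite S" using S finite_I finite_subset by blast
  have row: "complex_of_real (\<Sum>i\<in>I. (cmod ((app S ^^ j) (\<lambda>t. Gr t i) s))\<^sup>2)
      = T * (inner_on S ((app S ^^ j) (delta s)) ((app S ^^ j) (delta s))
        + inner_on S ((app S ^^ j) (delta s)) ((app S ^^ Suc j) (delta s)))"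
    if s: "s \<in> S" for s
  proof -
    define u where "u = (app S ^^ j) (delta s)"
    have val: "(app S ^^ j) (\<lambda>t. Gr t i) s = (\<Sum>t\<in>S. cnj (u t) * Gr t i)" for i
      using inner_on_delta[OF finS s, of "(app S ^^ j) (\<lambda>t. Gr t i)"]
      unfolding app_pow_adjoint[symmetric] by (simp add: u_def inner_on_def)
    have "complex_of_real (\<Sum>i\<in>I. (cmod ((app S ^^ j) (\<lambda>t. Gr t i) s))\<^sup>2)
       = (\<Sum>i\<in>I. (\<Sum>t\<in>S. cnj (u t) * Gr t i) * (\<Sum>t'\<in>S. u t' * Gr i t'))"
      by (simp only: val of_real_sum complex_norm_square) (simp add: Gr_herm)
    also have "\<dots> = (\<Sum>i\<in>I. \<Sum>t\<in>S. \<Sum>t'\<in>S. cnj (u t) * u t' * (Gr t i * Gr i t'))"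
      unfolding sum_product by (simp add: mult_ac)
    also have "\<dots> = (\<Sum>t\<in>S. \<Sum>t'\<in>S. \<Sum>i\<in>I. cnj (u t) * u t' * (Gr t i * Gr i t'))"
      by (subst sum.swap, rule sum.cong[OF refl], rule sum.swap)
    also have "\<dots> = (\<Sum>t\<in>S. \<Sum>t'\<in>S. cnj (u t) * u t' * (T * Gr t t'))"
      using S Gr_tight by (intro sum.cong refl) (auto simp: sum_distrib_left[symmetric] subset_iff)
    also have "\<dots> = T * (\<Sum>t\<in>S. cnj (u t) * (\<Sum>t'\<in>S. Gr t t' * u t'))"
      by (simp add: sum_distrib_left mult_ac)
    also have "(\<Sum>t\<in>S. cnj (u t) * (\<Sum>t'\<in>S. Gr t t' * u t')) = (\<Sum>t\<in>S. cnj (u t) * (u t + app S u t))"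
      using gram_apply[OF finS S] by simp
    also have "\<dots> = inner_on S u u + inner_on S u (app S u)"
      by (simp add: inner_on_def distrib_left sum.distrib)
    finally show ?thesis by (simp add: u_def)
  qed
  have rowRe: "(\<Sum>i\<in>I. (cmod ((app S ^^ j) (\<lambda>t. Gr t i) s))\<^sup>2)
      = T * ((norm_on S ((app S ^^ j) (delta s)))\<^sup>2
        + Re (inner_on S ((app S ^^ j) (delta s)) ((app S ^^ Suc j) (delta s))))"
    if s: "s \<in> S" for s
    using arg_cong[OF row[OF s], of Re] by (simp add: inner_on_self)
  have "(\<Sum>i\<in>I. (norm_on S ((app S ^^ j) (\<lambda>t. Gr t i)))\<^sup>2)
      = (\<Sum>s\<in>S. \<Sum>i\<in>I. (cmod ((app S ^^ j) (\<lambda>t. Gr t i) s))\<^sup>2)"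
    unfolding norm_on_sq by (rule sum.swap)
  then show ?thesis by (simp only: rowRe sum_distrib_left cong: sum.cong)
qed

text \<open>The odd moment coming from the summand H in 1 + H is bounded by its two even neighbours.
  The weight \<open>a\<close> suits moments that scale by \<open>a\<^sup>2\<close> per order, for
  which both terms of the mean agree.\<close>

lemma sum_norm_app_pow_le:
  assumes S: "S \<subseteq> I" and a: "a > 0"
  shows "(\<Sum>i\<in>I. (norm_on S ((app S ^^ j) (\<lambda>t. Gr t i)))\<^sup>2)
    \<le> T * (trace_pow S j + (a * trace_pow S j + trace_pow S (Suc j) / a) / 2)"
proof -
  have "Re (inner_on S ((app S ^^ j) (delta s)) ((app S ^^ Suc j) (delta s)))
     \<le> (a * (norm_on S ((app S ^^ j) (delta s)))\<^sup>2 + (norm_on S ((app S ^^ Suc j) (delta s)))\<^sup>2 / a) / 2" for s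
    using am_gm_scaled[OF a] inner_on_CS complex_Re_le_cmod order_trans by meson
  then have "(\<Sum>s\<in>S. (norm_on S ((app S ^^ j) (delta s)))\<^sup>2
        + Re (inner_on S ((app S ^^ j) (delta s)) ((app S ^^ Suc j) (delta s))))
    \<le> (\<Sum>s\<in>S. (norm_on S ((app S ^^ j) (delta s)))\<^sup>2
        + (a * (norm_on S ((app S ^^ j) (delta s)))\<^sup>2 + (norm_on S ((app S ^^ Suc j) (delta s)))\<^sup>2 / a) / 2)"
    by (intro sum_mono add_left_mono)
  also have "\<dots> = trace_pow S j + (a * trace_pow S j + trace_pow S (Suc j) / a) / 2"
    by (simp add: trace_pow_def sum.distrib sum_distrib_left sum_divide_distrib add_divide_distrib)
  finally show ?thesis
    unfolding sum_norm_app_pow_gram_columns[OF S] by (intro mult_left_mono T_nonneg)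
qed

end

lemma Suc_times_binomial_Suc: "Suc k * (N choose Suc k) = (N - k) * (N choose k)"
  by (metis binomial_absorb_comp binomial_absorption)

context hermitian_kernel
begin

lemma app_pow_cong:
  assumes "\<And>t. t \<in> S \<Longrightarrow> u t = v t" "s \<in> S"
  shows "(app S ^^ j) u s = (app S ^^ j) v s"
  using assms(2)
proof (induction j arbitrary: s)
  case (Suc j)
  then show ?case by (auto simp: app_def intro!: sum.cong)
qed (simp add: assms(1))

end

context tight_gram
begin

text \<open>For an index outside S the columns of \<open>H\<close> and \<open>Gr\<close> agree on S,
  and adding the nonnegative terms for indices in S completes the sum to which tightness applies.
  Because the assumed moments scale by \<open>a\<^sup>2\<close>, the weighted means balance and one
  constant serves even and odd q.\<close>

lemma sum_half_prod_le:
  assumes trace: "\<And>m. m \<le> Suc l \<Longrightarrow> (\<Sum>S | S \<subseteq> I \<and> card S = k. trace_pow S m) \<le> C * a ^ (2 * m)"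
    and a: "a > 0" and q: "q \<le> 2 * l"
  shows "(\<Sum>S | S \<subseteq> I \<and> card S = k. \<Sum>i\<in>I - S. half_prod S (\<lambda>t. H t i) q) \<le> (C * T * (1 + a)) * a ^ q"
proof -
  define \<A> where "\<A> = {S. S \<subseteq> I \<and> card S = k}"
  define c where "c S i j = norm_on S ((app S ^^ j) (\<lambda>t. H t i))" for S i j
  have fin: "finite \<A>" using finite_I by (simp add: \<A>_def)
  have square: "(\<Sum>S\<in>\<A>. \<Sum>i\<in>I - S. (c S i j)\<^sup>2) \<le> (C * T * (1 + a)) * a ^ (2 * j)" if j: "j \<le> l" for j
  proof -
    have "(\<Sum>i\<in>I - S. (c S i j)\<^sup>2) \<le> T * (trace_pow S j + (a * trace_pow S j + trace_pow S (Suc j) / a) / 2)"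
      if S: "S \<in> \<A>" for S
    proof -
      have "c S i j = norm_on S ((app S ^^ j) (\<lambda>t. Gr t i))" if "i \<in> I - S" for i
        unfolding c_def using that by (intro norm_on_cong app_pow_cong) (auto simp: H_def)
      then have "(\<Sum>i\<in>I - S. (c S i j)\<^sup>2) = (\<Sum>i\<in>I - S. (norm_on S ((app S ^^ j) (\<lambda>t. Gr t i)))\<^sup>2)" by simp
      also have "\<dots> \<le> (\<Sum>i\<in>I. (norm_on S ((app S ^^ j) (\<lambda>t. Gr t i)))\<^sup>2)"
        by (intro sum_mono2 finite_I) auto
      also have "\<dots> \<le> T * (trace_pow S j + (a * trace_pow S j + trace_pow S (Suc j) / a) / 2)"
        using S a by (intro sum_norm_app_pow_le) (auto simp: \<A>_def)
      finally show ?thesis .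
    qed
    then have "(\<Sum>S\<in>\<A>. \<Sum>i\<in>I - S. (c S i j)\<^sup>2)
        \<le> (\<Sum>S\<in>\<A>. T * (trace_pow S j + (a * trace_pow S j + trace_pow S (Suc j) / a) / 2))"
      by (rule sum_mono)
    also have "\<dots> = T * ((\<Sum>S\<in>\<A>. trace_pow S j)
        + (a * (\<Sum>S\<in>\<A>. trace_pow S j) + (\<Sum>S\<in>\<A>. trace_pow S (Suc j)) / a) / 2)"
      by (simp only: sum_distrib_left[symmetric] sum_divide_distrib[symmetric] sum.distrib)
    also have "\<dots> \<le> T * (C * a ^ (2 * j) + (a * (C * a ^ (2 * j)) + (C * a ^ (2 * Suc j)) / a) / 2)"
      using j a trace[of j] trace[of "Suc j"] unfolding \<A>_def
      by (intro mult_left_mono add_mono divide_right_mono T_nonneg) auto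
    also have "\<dots> = (C * T * (1 + a)) * a ^ (2 * j)"
      using a by (simp add: field_simps power2_eq_square)
    finally show ?thesis .
  qed
  show ?thesis
  proof (cases "even q")
    case True
    then obtain j where j: "q = 2 * j" by (elim evenE)
    then have "half_prod S (\<lambda>t. H t i) q = (c S i j)\<^sup>2" for S i
      by (simp add: half_prod_def c_def power2_eq_square)
    then show ?thesis using square[of j] q j by (simp add: \<A>_def)
  next
    case False
    then obtain j where j: "q = 2 * j + 1" by (elim oddE)
    have "half_prod S (\<lambda>t. H t i) q \<le> (a * (c S i j)\<^sup>2 + (c S i (Suc j))\<^sup>2 / a) / 2" for S i
      using am_gm_scaled[OF a, of "c S i j" "c S i (Suc j)"] j by (simp add: half_prod_def c_def)
    then have "(\<Sum>S\<in>\<A>. \<Sum>i\<in>I - S. half_prod S (\<lambda>t. H t i) q)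
        \<le> (\<Sum>S\<in>\<A>. \<Sum>i\<in>I - S. (a * (c S i j)\<^sup>2 + (c S i (Suc j))\<^sup>2 / a) / 2)"
      by (intro sum_mono)
    also have "\<dots> = (a * (\<Sum>S\<in>\<A>. \<Sum>i\<in>I - S. (c S i j)\<^sup>2) + (\<Sum>S\<in>\<A>. \<Sum>i\<in>I - S. (c S i (Suc j))\<^sup>2) / a) / 2"
      by (simp only: sum_distrib_left[symmetric] sum_divide_distrib[symmetric] sum.distrib)
    also have "\<dots> \<le> (a * ((C * T * (1 + a)) * a ^ (2 * j)) + ((C * T * (1 + a)) * a ^ (2 * Suc j)) / a) / 2"
      using j q a by (intro divide_right_mono add_mono mult_left_mono square) auto
    also have "\<dots> = (C * T * (1 + a)) * a ^ q"
      using a by (simp add: j field_simps power2_eq_square)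
    finally show ?thesis by (simp add: \<A>_def)
  qed
qed

text \<open>Deleting an index expresses the moment of order m at size \<open>Suc k\<close> through
  moments of order at most m at size k, so the induction is on the size with the order arbitrary.
  The condition \<open>small\<close> says that the gain from averaging, about T K / card I, pays for
  the loss \<open>(1 + R / a\<^sup>2) ^ (2 * l)\<close> caused by merging returns.\<close>

lemma sum_trace_pow_le:
  assumes a: "a > 0" and K: "real K * \<mu>\<^sup>2 \<le> R" "K \<le> card I"
    and small: "T * real K * (1 + a) * (1 + R / a\<^sup>2) ^ (2 * l) \<le> (real (card I) - real K) * a\<^sup>2"
  shows "k \<le> Suc K \<Longrightarrow> m \<le> Suc l \<Longrightarrow>
    (\<Sum>S | S \<subseteq> I \<and> card S = k. trace_pow S m) \<le> real (card I choose k) * real k * a ^ (2 * m)"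
proof (induction k arbitrary: m)
  case 0
  have "trace_pow S m = 0" if "S \<subseteq> I \<and> card S = 0" for S
    using that finite_subset[OF _ finite_I, of S] by (auto simp: trace_pow_def)
  then show ?case by simp
next
  case (Suc k)
  have R: "R \<ge> 0" using K(1) by (meson order_trans zero_le_mult_iff of_nat_0_le_iff zero_le_power2)
  have finS: "finite S" if "S \<subseteq> I" for S using that finite_I finite_subset by blast
  show ?case
  proof (cases m)
    case 0
    have "trace_pow S 0 = real (Suc k)" if "S \<subseteq> I \<and> card S = Suc k" for S
    proof -
      have "(norm_on S (delta i))\<^sup>2 = 1" if "i \<in> S" for i
        using that \<open>S \<subseteq> I \<and> card S = Suc k\<close> finS
        by (simp add: norm_on_sq delta_def if_distrib[of cmod] if_distrib[of "\<lambda>x. x\<^sup>2"] cong: if_cong)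
      then show ?thesis using that by (simp add: trace_pow_def)
    qed
    then show ?thesis using 0 finite_I by (simp add: n_subsets)
  next
    case (Suc r)
    then have r: "r \<le> l" using Suc.prems by simp
    define \<A> where "\<A> = (SIGMA S:{S. S \<subseteq> I \<and> card S = k}. I - S)"
    define F where "F p = (\<lambda>(S, i). (app (insert i S) ^^ p) (delta i) i)" for p
    define G where "G q = (\<lambda>(S, i). half_prod S (\<lambda>t. H t i) q)" for q
    define C where "C = real (card I choose k) * real k"
    have Sigma: "(\<Sum>w\<in>\<A>. f (fst w) (snd w)) = (\<Sum>S | S \<subseteq> I \<and> card S = k. \<Sum>i\<in>I - S. f S i)"
      for f :: "'i set \<Rightarrow> 'i \<Rightarrow> real"
      unfolding \<A>_def by (subst sum.Sigma) (use finite_I in \<open>auto simp: case_prod_unfold\<close>)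
    have "(\<Sum>S | S \<subseteq> I \<and> card S = Suc k. trace_pow S m)
        = (\<Sum>S | S \<subseteq> I \<and> card S = k. \<Sum>i\<in>I - S. (norm_on (insert i S) ((app (insert i S) ^^ m) (delta i)))\<^sup>2)"
      unfolding trace_pow_def by (rule sum_k_subsets_remove[OF finite_I])
    also have "\<dots> = (\<Sum>w\<in>\<A>. cmod (F (Suc (Suc (2 * r))) w))"
    proof -
      have "cmod (F (Suc (Suc (2 * r))) w)
          = (norm_on (insert (snd w) (fst w)) ((app (insert (snd w) (fst w)) ^^ m) (delta (snd w))))\<^sup>2"
        if "w \<in> \<A>" for w
        using return_even[of "insert (snd w) (fst w)" "snd w" m] that finS
        by (auto simp: \<A>_def F_def Suc norm_power simp del: funpow.simps)
      then show ?thesis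
        using Sigma[of "\<lambda>S i. (norm_on (insert i S) ((app (insert i S) ^^ m) (delta i)))\<^sup>2"] by simp
    qed
    \<comment> \<open>The family consists of the pairs of a support and an outside index. A closed
      walk of length 2 m = 2 r + 2 involves return weights up to order 2 r, which the induction
      hypothesis covers up to moment \<open>Suc r\<close>.\<close>
    also have "\<dots> \<le> (C * T * (1 + a)) * (a + R / a) ^ (2 * r)"
    proof (rule finite_weighted_returns[where Q = "2 * r" and G = G and R = R and a = a
          and g = "\<lambda>j (S, i). inner_on S (\<lambda>t. H t i) ((app S ^^ j) (\<lambda>t. H t i))"])
      fix w assume w: "w \<in> \<A>"
      obtain S i where Si: "w = (S, i)" by (cases w)
      then have S: "finite S" "S \<subseteq> I" "i \<in> I - S" "card S = k" using w finS by (auto simp: \<A>_def)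
      show "F 0 w = 1" by (simp add: F_def Si delta_def)
      show "F 1 w = 0" using S by (auto simp: F_def Si app_def delta_def intro!: sum.neutral)
      show "F (Suc (Suc p)) w = (\<Sum>j\<le>p. (case w of (S, i) \<Rightarrow>
          inner_on S (\<lambda>t. H t i) ((app S ^^ j) (\<lambda>t. H t i))) * F (p - j) w)" for p
        using first_return[of S i p] S by (simp add: F_def Si)
      show "cmod (case w of (S, i) \<Rightarrow> inner_on S (\<lambda>t. H t i) ((app S ^^ j) (\<lambda>t. H t i))) \<le> G j w" for j
        using inner_le_half_prod by (simp add: G_def Si)
      have "norm_on S (\<lambda>t. H t i) = norm_on S (\<lambda>t. Gr t i)"
        using S by (intro norm_on_cong) (auto simp: H_def)
      then have "(norm_on S (\<lambda>t. H t i))\<^sup>2 \<le> real k * \<mu>\<^sup>2"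
        using norm_gram_column[OF S(1-3)] S(4) by simp
      also have "\<dots> \<le> real K * \<mu>\<^sup>2" using Suc.prems by (intro mult_right_mono) auto
      also have "\<dots> \<le> R" by (rule K)
      finally have "(norm_on S (\<lambda>t. H t i))\<^sup>2 * half_prod S (\<lambda>t. H t i) q \<le> R * half_prod S (\<lambda>t. H t i) q" for q
        by (rule mult_right_mono) (simp add: half_prod_def)
      then show "G p w * G q w \<le> R * G (p + q) w" for p q
        using half_prod_submult by (simp add: G_def Si) (meson order_trans)
    next
      fix q assume "q \<le> 2 * r"
      then have "(\<Sum>S | S \<subseteq> I \<and> card S = k. \<Sum>i\<in>I - S. half_prod S (\<lambda>t. H t i) q) \<le> (C * T * (1 + a)) * a ^ q"
        using Suc.prems r a unfolding C_def by (intro sum_half_prod_le[where l = r] Suc.IH) auto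
      then show "(\<Sum>w\<in>\<A>. G q w) \<le> (C * T * (1 + a)) * a ^ q"
        using Sigma[of "\<lambda>S i. half_prod S (\<lambda>t. H t i) q"] by (simp add: G_def case_prod_unfold)
    qed (use a R T_nonneg in \<open>auto simp: C_def\<close>)
    also have "\<dots> \<le> real (card I choose Suc k) * real (Suc k) * a ^ (2 * m)"
    proof -
      \<comment> \<open>The growth rate exceeds \<open>a\<close> by the factor
        \<open>1 + R / a\<^sup>2\<close> per step, the price of merging.\<close>
      have y: "a + R / a = a * (1 + R / a\<^sup>2)" using a by (simp add: power2_eq_square field_simps)
      have "T * real k * (1 + a) * (1 + R / a\<^sup>2) ^ (2 * r) \<le> T * real K * (1 + a) * (1 + R / a\<^sup>2) ^ (2 * l)"
        using Suc.prems r a R T_nonneg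
        by (intro mult_mono mult_right_mono mult_left_mono power_increasing) auto
      also have "\<dots> \<le> (real (card I) - real K) * a\<^sup>2" by (rule small)
      also have "\<dots> \<le> (real (card I) - real k) * a\<^sup>2"
        using Suc.prems by (intro mult_right_mono) auto
      also have "real (card I) - real k = real (card I - k)"
        using Suc.prems K by simp
      finally have le: "T * real k * (1 + a) * (1 + R / a\<^sup>2) ^ (2 * r) \<le> real (card I - k) * a\<^sup>2" .
      have "(C * T * (1 + a)) * (a + R / a) ^ (2 * r)
          = real (card I choose k) * a ^ (2 * r) * (T * real k * (1 + a) * (1 + R / a\<^sup>2) ^ (2 * r))"
        unfolding y power_mult_distrib by (simp add: C_def mult_ac)
      also have "\<dots> \<le> real (card I choose k) * a ^ (2 * r) * (real (card I - k) * a\<^sup>2)"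
        using a by (intro mult_left_mono le) auto
      also have "\<dots> = real ((card I - k) * (card I choose k)) * a ^ (2 * m)"
        by (simp add: Suc power2_eq_square mult_ac)
      also have "\<dots> = real (card I choose Suc k) * real (Suc k) * a ^ (2 * m)"
        unfolding Suc_times_binomial_Suc[symmetric] by (simp only: of_nat_mult mult_ac)
      finally show ?thesis .
    qed
    finally show ?thesis .
  qed
qed

definition well_conditioned :: "real \<Rightarrow> 'i set \<Rightarrow> bool" where
  "well_conditioned d S \<longleftrightarrow> (\<forall>v. norm_on S (app S v) \<le> d * norm_on S v)"

text \<open>Markov's inequality in counting form: a support that is not well conditioned has trace
  moment at least \<open>d ^ (2 * Suc l)\<close>.\<close>

lemma card_ill_conditioned_le:
  assumes a: "a > 0" and d: "d > 0" and K: "real K * \<mu>\<^sup>2 \<le> R" "K \<le> card I"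
    and small: "T * real K * (1 + a) * (1 + R / a\<^sup>2) ^ (2 * l) \<le> (real (card I) - real K) * a\<^sup>2"
  shows "real (card {S. S \<subseteq> I \<and> card S = Suc K \<and> \<not> well_conditioned d S})
    \<le> real (card I choose Suc K) * real (Suc K) * (a / d) ^ (2 * Suc l)"
proof -
  define B where "B = {S. S \<subseteq> I \<and> card S = Suc K \<and> \<not> well_conditioned d S}"
  have fin: "finite {S. S \<subseteq> I \<and> card S = Suc K}" using finite_I by simp
  have "d ^ (2 * Suc l) \<le> trace_pow S (Suc l)" if "S \<in> B" for S
  proof (rule ccontr)
    assume "\<not> ?thesis"
    moreover have "finite S" using that finite_I finite_subset by (auto simp: B_def)
    ultimately have "well_conditioned d S"
      unfolding well_conditioned_def using d by (intro allI norm_app_le_of_trace_pow[where m = "Suc l"]) auto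
    then show False using that by (simp add: B_def)
  qed
  then have "real (card B) * d ^ (2 * Suc l) \<le> (\<Sum>S\<in>B. trace_pow S (Suc l))"
    using sum_mono[of B "\<lambda>_. d ^ (2 * Suc l)" "\<lambda>S. trace_pow S (Suc l)"] by simp
  also have "\<dots> \<le> (\<Sum>S | S \<subseteq> I \<and> card S = Suc K. trace_pow S (Suc l))"
    by (rule sum_mono2[OF fin]) (auto simp: B_def trace_pow_nonneg)
  also have "\<dots> \<le> real (card I choose Suc K) * real (Suc K) * a ^ (2 * Suc l)"
    by (rule sum_trace_pow_le[OF a K small]) auto
  finally show ?thesis
    using d by (simp add: B_def power_divide field_simps del: power_Suc mult_Suc_right)
qed

end

section \<open>Dual certificates for Basis Pursuit\<close>

text \<open>The alternating Neumann series for the inverse of 1 + H, summed coordinate by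
  coordinate; a geometric series dominates each coordinate.\<close>

lemma (in hermitian_kernel) neumann_solution:
  assumes S: "finite S" and d: "0 \<le> d" "d < 1" and bnd: "\<And>v. norm_on S (app S v) \<le> d * norm_on S v"
  obtains z where "\<And>s. s \<in> S \<Longrightarrow> z s + app S z s = w s"
proof
  define f where "f s j = (-1) ^ j * (app S ^^ j) w s" for s j
  define z where "z s = (\<Sum>j. f s j)" for s
  have nb: "norm_on S ((app S ^^ j) w) \<le> d ^ j * norm_on S w" for j
  proof (induction j)
    case (Suc j)
    have "norm_on S ((app S ^^ Suc j) w) \<le> d * norm_on S ((app S ^^ j) w)" using bnd by simp
    also have "\<dots> \<le> d * (d ^ j * norm_on S w)" by (intro mult_left_mono Suc.IH d)
    finally show ?case by simp
  qed simp
  have summable: "summable (f s)" if "s \<in> S" for s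
  proof (rule summable_comparison_test')
    show "summable (\<lambda>j. d ^ j * norm_on S w)"
      using d by (intro summable_mult2 summable_geometric) simp
    show "norm (f s j) \<le> d ^ j * norm_on S w" for j
      using order_trans[OF cmod_le_norm_on[OF S that] nb] by (simp add: f_def norm_mult norm_power)
  qed
  fix s assume s: "s \<in> S"
  have "app S z s = (\<Sum>t\<in>S. \<Sum>j. H s t * f t j)"
    using summable by (simp add: app_def z_def suminf_mult)
  also have "\<dots> = (\<Sum>j. \<Sum>t\<in>S. H s t * f t j)"
    using summable by (intro suminf_sum[symmetric] summable_mult) auto
  also have "\<dots> = (\<Sum>j. - f s (Suc j))"
    by (simp add: f_def app_def sum_distrib_left sum_negf[symmetric] mult_ac)
  also have "\<dots> = - (\<Sum>j. f s (Suc j))"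
    using summable[OF s] by (intro suminf_minus) (simp add: summable_Suc_iff)
  also have "(\<Sum>j. f s (Suc j)) = z s - w s"
  proof -
    have "f s 0 = w s" by (simp add: f_def)
    then show ?thesis using suminf_split_head[OF summable[OF s]] by (simp add: z_def)
  qed
  finally show "z s + app S z s = w s" by simp
qed

context tight_gram
begin

lemma gram_solution:
  assumes S: "S \<subseteq> I" and wc: "well_conditioned (1/2) S"
  obtains z where "\<And>s. s \<in> S \<Longrightarrow> z s + app S z s = w s" "norm_on S z \<le> 2 * norm_on S w"
proof -
  have finS: "finite S" using S finite_I finite_subset by blast
  have bnd: "norm_on S (app S v) \<le> 1/2 * norm_on S v" for v
    using wc by (simp add: well_conditioned_def)
  obtain z where z: "\<And>s. s \<in> S \<Longrightarrow> z s + app S z s = w s"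
    using neumann_solution[OF finS _ _ bnd] by auto
  have "norm_on S z = norm_on S (\<lambda>s. w s + - app S z s)"
    using z by (intro norm_on_cong) (auto simp: algebra_simps)
  also have "\<dots> \<le> norm_on S w + norm_on S (\<lambda>s. - app S z s)" by (rule norm_on_triangle)
  also have "norm_on S (\<lambda>s. - app S z s) = norm_on S (app S z)" by (simp add: norm_on_def)
  also have "\<dots> \<le> 1/2 * norm_on S z" by (rule bnd)
  finally have "norm_on S z \<le> 2 * norm_on S w" by simp
  then show thesis using z that by blast
qed

text \<open>\<open>w j\<close> is the inverse of the restricted Gram matrix applied to column j. It
  depends on the support but not on the phases, so the certificate at j becomes a fixed linear form
  in random phases, and the second claim bounds its variance.\<close>

lemma dual_coefficients:
  assumes S: "S \<subseteq> I" and wc: "well_conditioned (1/2) S"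
  obtains w where "\<And>j s. j \<in> I - S \<Longrightarrow> s \<in> S \<Longrightarrow> w j s + app S (w j) s = Gr s j"
    "\<And>j. j \<in> I - S \<Longrightarrow> (norm_on S (w j))\<^sup>2 \<le> 4 * real (card S) * \<mu>\<^sup>2"
proof -
  have finS: "finite S" using S finite_I finite_subset by blast
  have "\<exists>z. (\<forall>s\<in>S. z s + app S z s = Gr s j) \<and> (norm_on S z)\<^sup>2 \<le> 4 * real (card S) * \<mu>\<^sup>2"
    if j: "j \<in> I - S" for j
  proof -
    obtain z where z: "\<And>s. s \<in> S \<Longrightarrow> z s + app S z s = Gr s j" "norm_on S z \<le> 2 * norm_on S (\<lambda>s. Gr s j)"
      by (rule gram_solution[OF S wc, where w = "\<lambda>s. Gr s j"]) blast
    have "(norm_on S z)\<^sup>2 \<le> (2 * norm_on S (\<lambda>s. Gr s j))\<^sup>2"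
      by (rule power_mono[OF z(2) norm_on_nonneg])
    also have "\<dots> = 4 * (norm_on S (\<lambda>s. Gr s j))\<^sup>2" by (simp add: power_mult_distrib)
    also have "\<dots> \<le> 4 * (real (card S) * \<mu>\<^sup>2)"
      by (rule mult_left_mono[OF norm_gram_column[OF finS S j]]) simp
    finally have "(norm_on S z)\<^sup>2 \<le> 4 * real (card S) * \<mu>\<^sup>2" by (simp only: mult.assoc)
    then show ?thesis using z(1) by blast
  qed
  then show thesis using that by metis
qed

end

definition gram :: "nat \<Rightarrow> (nat \<Rightarrow> complex) \<Rightarrow> nat \<times> nat \<Rightarrow> nat \<times> nat \<Rightarrow> complex" where
  "gram n h i j = (\<Sum>q<n. cnj (gabor_matrix n h q i) * gabor_matrix n h q j)"

lemma Re_cnj_sgn: "Re (cnj (sgn z) * z) = cmod z"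
proof (cases "z = 0")
  case False
  have "cnj (sgn z) * z = (cnj z * z) / cmod z" by (simp add: sgn_eq)
  also have "\<dots> = complex_of_real (cmod z)"
    using False by (simp add: complex_norm_square[symmetric] mult.commute[of "cnj z"] power2_eq_square)
  finally show ?thesis by simp
qed simp

lemma finite_tf_grid [simp]: "finite (tf_grid n)"
  by (simp add: tf_grid_def)

lemma tf_operator_eq_sum_grid:
  assumes S: "S \<subseteq> tf_grid n" and x: "\<And>i. i \<in> tf_grid n \<Longrightarrow> i \<notin> S \<Longrightarrow> x i = 0"
  shows "tf_operator n S x h q = (\<Sum>i\<in>tf_grid n. gabor_matrix n h q i * x i)"
proof -
  have "tf_operator n S x h q = (\<Sum>i\<in>S. gabor_matrix n h q i * x i)"
    by (simp add: tf_operator_def gabor_matrix_def case_prod_unfold mult.commute)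
  also have "\<dots> = (\<Sum>i\<in>tf_grid n. gabor_matrix n h q i * x i)"
    using S x by (intro sum.mono_neutral_left) auto
  finally show ?thesis .
qed

text \<open>The exact dual certificate is built from the sign vector. Outside S its values are
  evaluated by moving the inverse Gram matrix, by self-adjointness, from the sign vector to column
  j; hence the form of \<open>cert\<close>.\<close>

lemma bp_recovers_dual_certificate:
  assumes gram: "tight_gram (tf_grid n) (gram n h) T \<mu>"
    and S: "S = {i \<in> tf_grid n. x i \<noteq> 0}"
    and wc: "tight_gram.well_conditioned (gram n h) (1/2) S"
    and w: "\<And>j s. j \<in> tf_grid n - S \<Longrightarrow> s \<in> S \<Longrightarrow>
      w j s + hermitian_kernel.app (tight_gram.H (gram n h)) S (w j) s = gram n h s j"
    and cert: "\<And>j. j \<in> tf_grid n - S \<Longrightarrow> cmod (\<Sum>i\<in>S. cnj (w j i) * sgn (x i)) < 1"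
  shows "bp_recovers n h (tf_operator n S x h) x"
proof -
  interpret tight_gram "tf_grid n" "gram n h" T \<mu> by (rule gram)
  define Gr where "Gr = gram n h"
  have Sg: "S \<subseteq> tf_grid n" and finS: "finite S" using S finite_I by auto
  have x0: "x i = 0" if "i \<in> tf_grid n" "i \<notin> S" for i using that S by auto
  obtain z where z: "\<And>s. s \<in> S \<Longrightarrow> z s + app S z s = sgn (x s)"
    using gram_solution[OF Sg wc, of "\<lambda>s. sgn (x s)"] by blast
  have feas_iff: "bp_feasible n h (tf_operator n S x h) x'
      \<longleftrightarrow> (\<forall>q<n. (\<Sum>i\<in>tf_grid n. gabor_matrix n h q i * (x' i - x i)) = 0)" for x'
    by (simp add: bp_feasible_def tf_operator_eq_sum_grid[OF Sg x0] right_diff_distrib sum_subtractf)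
  \<comment> \<open>Being a combination of rows of the Gram matrix, \<open>r\<close> annihilates the
    kernel of the dictionary. On S it equals the conjugate signs.\<close>
  define r where "r j = (\<Sum>s\<in>S. cnj (z s) * Gr s j)" for j
  have r_in: "r j = cnj (sgn (x j))" if j: "j \<in> S" for j
  proof -
    have "cnj (r j) = (\<Sum>s\<in>S. Gr j s * z s)"
      by (simp add: r_def Gr_def Gr_herm mult.commute)
    also have "\<dots> = sgn (x j)" using gram_apply[OF finS Sg j] z[OF j] by (simp add: Gr_def)
    finally show ?thesis by (metis complex_cnj_cnj)
  qed
  have r_out: "cmod (r j) < 1" if j: "j \<in> tf_grid n - S" for j
  proof -
    have "r j = inner_on S z (\<lambda>s. w j s + app S (w j) s)"
      using w[OF j] by (simp add: r_def Gr_def inner_on_def)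
    also have "\<dots> = inner_on S z (w j) + inner_on S (app S z) (w j)"
      by (simp add: app_adjoint) (simp add: inner_on_def distrib_left sum.distrib)
    also have "\<dots> = inner_on S (\<lambda>s. z s + app S z s) (w j)"
      by (simp add: inner_on_def distrib_right sum.distrib)
    also have "\<dots> = inner_on S (\<lambda>s. sgn (x s)) (w j)"
      by (intro inner_on_cong) (simp_all add: z)
    also have "cnj \<dots> = (\<Sum>i\<in>S. cnj (w j i) * sgn (x i))"
      by (simp add: inner_on_cnj) (simp add: inner_on_def)
    finally show ?thesis using cert[OF j] by (metis complex_mod_cnj)
  qed
  have unique: "\<forall>i\<in>tf_grid n. x' i = x i"
    if feas: "bp_feasible n h (tf_operator n S x h) x'" and le: "l1_norm n x' \<le> l1_norm n x" for x'
  proof -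
    define v where "v i = x' i - x i" for i
    \<comment> \<open>The slack of the subgradient inequality at i. Every slack is nonnegative while
      their sum is at most 0, so all of them vanish.\<close>
    define e where "e i = cmod (x' i) - cmod (x i) - Re (r i * v i)" for i
    have ker: "(\<Sum>i\<in>tf_grid n. gabor_matrix n h q i * v i) = 0" if "q < n" for q
      using feas that unfolding feas_iff by (simp add: v_def)
    have ker_gram: "(\<Sum>j\<in>tf_grid n. Gr s j * v j) = 0" for s
    proof -
      have "(\<Sum>j\<in>tf_grid n. Gr s j * v j)
          = (\<Sum>j\<in>tf_grid n. \<Sum>q<n. cnj (gabor_matrix n h q s) * (gabor_matrix n h q j * v j))"
        by (simp add: Gr_def gram_def sum_distrib_right mult.assoc)
      also have "\<dots> = (\<Sum>q<n. cnj (gabor_matrix n h q s) * (\<Sum>j\<in>tf_grid n. gabor_matrix n h q j * v j))"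
        by (subst sum.swap) (simp add: sum_distrib_left)
      finally show ?thesis using ker by simp
    qed
    have "(\<Sum>j\<in>tf_grid n. r j * v j) = (\<Sum>s\<in>S. cnj (z s) * (\<Sum>j\<in>tf_grid n. Gr s j * v j))"
      by (simp add: r_def sum_distrib_right sum_distrib_left mult.assoc) (rule sum.swap)
    then have "(\<Sum>j\<in>tf_grid n. r j * v j) = 0" using ker_gram by simp
    then have "(\<Sum>j\<in>tf_grid n. Re (r j * v j)) = 0" by (metis Re_sum zero_complex.sel(1))
    then have sum_e: "(\<Sum>i\<in>tf_grid n. e i) \<le> 0"
      using le by (simp add: e_def sum_subtractf l1_norm_def del: times_complex.sel)
    have e_out: "(1 - cmod (r i)) * cmod (v i) \<le> e i" if i: "i \<in> tf_grid n - S" for i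
    proof -
      have "Re (r i * v i) \<le> cmod (r i) * cmod (v i)" by (metis complex_Re_le_cmod norm_mult)
      then show ?thesis using x0[of i] i by (simp add: e_def v_def algebra_simps)
    qed
    have e_in: "0 \<le> e i" if i: "i \<in> S" for i
    proof -
      have "Re (cnj (sgn (x i)) * x' i) \<le> cmod (cnj (sgn (x i)) * x' i)" by (rule complex_Re_le_cmod)
      also have "\<dots> \<le> cmod (x' i)" by (simp add: norm_mult norm_sgn)
      finally show ?thesis
        using Re_cnj_sgn[of "x i"] unfolding e_def r_in[OF i] v_def right_diff_distrib minus_complex.simps by linarith
    qed
    have e_nonneg: "0 \<le> e i" if "i \<in> tf_grid n" for i
    proof (cases "i \<in> S")
      case False
      then have "0 \<le> (1 - cmod (r i)) * cmod (v i)" using r_out[of i] that by simp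
      then show ?thesis using e_out[of i] that False by simp
    qed (rule e_in)
    have e_zero: "e i = 0" if "i \<in> tf_grid n" for i
      using sum_e that e_nonneg finite_I by (smt (verit) sum_nonneg_0 sum_nonneg)
    have v_out: "v i = 0" if i: "i \<in> tf_grid n - S" for i
    proof -
      have "(1 - cmod (r i)) * cmod (v i) \<le> 0" using e_out[OF i] e_zero[of i] i by simp
      then show ?thesis using r_out[OF i] by (simp add: mult_le_0_iff)
    qed
    \<comment> \<open>Once v vanishes outside S, the kernel equation becomes (1 + H) v = 0 on S, and
      the norm bound 1/2 for H forces v = 0 there too.\<close>
    have "v s + app S v s = 0" if s: "s \<in> S" for s
    proof -
      have "(\<Sum>j\<in>S. Gr s j * v j) = (\<Sum>j\<in>tf_grid n. Gr s j * v j)"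
        using Sg v_out finite_I by (intro sum.mono_neutral_left) auto
      then show ?thesis using ker_gram[of s] gram_apply[OF finS Sg s, of v] by (simp add: Gr_def)
    qed
    then have "norm_on S v = norm_on S (\<lambda>s. - app S v s)"
      by (intro norm_on_cong) (simp add: eq_neg_iff_add_eq_0)
    also have "\<dots> = norm_on S (app S v)" by (simp add: norm_on_def)
    also have "\<dots> \<le> 1/2 * norm_on S v" using wc by (simp add: well_conditioned_def)
    finally have "norm_on S v = 0" using norm_on_nonneg[of S v] by linarith
    then have "v i = 0" if "i \<in> S" for i using cmod_le_norm_on[OF finS that, of v] by simp
    then show ?thesis using v_out by (auto simp: v_def)
  qed
  have l1_cong: "l1_norm n x' = l1_norm n x" if "\<forall>i\<in>tf_grid n. x' i = x i" for x'
    using that by (simp add: l1_norm_def)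
  have feas: "bp_feasible n h (tf_operator n S x h) x"
    unfolding feas_iff by simp
  then have "bp_solution n h (tf_operator n S x h) x"
    unfolding bp_solution_def
  proof (intro conjI allI impI)
    fix x' assume "bp_feasible n h (tf_operator n S x h) x'"
    then have "l1_norm n x' \<le> l1_norm n x \<Longrightarrow> l1_norm n x' = l1_norm n x"
      using unique l1_cong by blast
    then show "l1_norm n x \<le> l1_norm n x'" by linarith
  qed
  moreover have "\<forall>i\<in>tf_grid n. x' i = x i" if "bp_solution n h (tf_operator n S x h) x'" for x'
  proof (rule unique)
    show "bp_feasible n h (tf_operator n S x h) x'" "l1_norm n x' \<le> l1_norm n x"
      using that feas unfolding bp_solution_def by blast+
  qed
  ultimately show ?thesis unfolding bp_recovers_def by blast
qed

section \<open>Tails of Steinhaus sums\<close>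

text \<open>Hoeffding's lemma for a fair sign, used with the arguments \<open>2 * y\<close> and
  \<open>1/2\<close>.\<close>

lemma cosh_le_exp_sq: "cosh (x :: real) \<le> exp (x\<^sup>2 / 2)"
proof -
  have pos: "cosh y \<le> exp (y\<^sup>2 / 2)" if "0 \<le> y" for y :: real
  proof -
    have "1 + 1/2 * (exp (2 * y) - 1) = exp y * cosh y"
      by (simp add: cosh_field_def exp_minus field_simps exp_double power2_eq_square flip: exp_add)
    then have "- y + (y + ln (cosh y)) \<le> y\<^sup>2 / 2"
      using Hoeffdings_lemma_aux[of "2 * y" "1/2"] that
      by (simp add: ln_mult power2_eq_square)
    then have "ln (cosh y) \<le> y\<^sup>2 / 2" by simp
    then show ?thesis by (metis cosh_real_pos exp_le_cancel_iff exp_ln)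
  qed
  show ?thesis using pos[of x] pos[of "- x"] by (cases "0 \<le> x") auto
qed

text \<open>The average over the four turns is that of cosh x and cosh y. The addition formula makes
  it a product with arguments (x + y)/2 and (x - y)/2, whose squares add up to only half of x^2 +
  y^2. This gives the constant 1/4 in the exponent, where a termwise bound would give 1/2.\<close>

lemma exp_quarter_turns_le:
  "exp (Re w) + exp (Re (\<i> * w)) + exp (Re (- w)) + exp (Re (- \<i> * w)) \<le> 4 * exp ((cmod w)\<^sup>2 / 4)"
proof -
  define x y where "x = Re w" and "y = Im w"
  have "cosh x + cosh y = 2 * (cosh ((x + y) / 2) * cosh ((x - y) / 2))"
    using cosh_add[of "(x + y) / 2" "(x - y) / 2"] cosh_diff[of "(x + y) / 2" "(x - y) / 2"]
    by (simp add: field_simps)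
  also have "\<dots> \<le> 2 * (exp (((x + y) / 2)\<^sup>2 / 2) * exp (((x - y) / 2)\<^sup>2 / 2))"
    by (intro mult_left_mono mult_mono cosh_le_exp_sq) auto
  also have "\<dots> = 2 * exp ((x\<^sup>2 + y\<^sup>2) / 4)"
    by (simp add: exp_add[symmetric] power2_eq_square field_simps)
  finally have "2 * cosh x + 2 * cosh y \<le> 4 * exp ((cmod w)\<^sup>2 / 4)"
    by (simp add: cmod_power2 x_def y_def)
  then show ?thesis by (simp add: cosh_field_def x_def y_def add_divide_distrib)
qed

text \<open>The integral is the Bessel function I_0 at \<open>cmod c\<close>. Folding the circle
  onto a quarter arc reduces its bound to the pointwise inequality for four quarter turns.\<close>

lemma torus_uniform_mgf: "(\<integral>\<^sup>+z. ennreal (exp (Re (c * z))) \<partial>torus_uniform) \<le> ennreal (exp ((cmod c)\<^sup>2 / 4))"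
proof -
  define g where "g t = ennreal (exp (Re (c * cis t)))" for t
  have cis_meas [measurable]: "cis \<in> borel_measurable borel"
    by (intro borel_measurable_continuous_onI continuous_intros)
  have f_meas [measurable]: "(\<lambda>z. ennreal (exp (Re (c * z)))) \<in> borel_measurable borel"
    by (intro measurable_compose[OF _ measurable_ennreal] borel_measurable_continuous_onI continuous_intros)
  have g_meas [measurable]: "g \<in> borel_measurable borel"
    unfolding g_def by (rule measurable_compose[OF cis_meas f_meas])
  have turns: "g t + g (pi / 2 + t) + g (pi + t) + g (3 * pi / 2 + t) \<le> ennreal (4 * exp ((cmod c)\<^sup>2 / 4))" for t
  proof -
    have cis_turn: "cis (pi / 2 + t) = \<i> * cis t" "cis (pi + t) = - cis t" "cis (3 * pi / 2 + t) = - \<i> * cis t"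
    proof -
      show "cis (pi / 2 + t) = \<i> * cis t" by (simp add: cis_mult[symmetric])
      show "cis (pi + t) = - cis t" by (simp add: cis_mult[symmetric])
      have "cis (3 * pi / 2 + t) = cis (pi + pi / 2 + t)" by (simp add: field_simps)
      also have "\<dots> = cis pi * cis (pi / 2) * cis t" by (simp only: cis_mult)
      finally show "cis (3 * pi / 2 + t) = - \<i> * cis t" by simp
    qed
    have "g t + g (pi / 2 + t) + g (pi + t) + g (3 * pi / 2 + t)
      = ennreal (exp (Re (c * cis t)) + exp (Re (\<i> * (c * cis t))) + exp (Re (- (c * cis t))) + exp (Re (- \<i> * (c * cis t))))"
      unfolding g_def cis_turn by (simp add: ennreal_plus algebra_simps del: times_complex.sel)
    also have "\<dots> \<le> ennreal (4 * exp ((cmod (c * cis t))\<^sup>2 / 4))"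
      by (intro ennreal_leI exp_quarter_turns_le)
    finally show ?thesis by (simp add: norm_mult)
  qed
  have shift: "(\<integral>\<^sup>+t. g t * indicator {a..<b} t \<partial>lborel) = (\<integral>\<^sup>+t. g (a + t) * indicator {0..<pi / 2} t \<partial>lborel)"
    if "b = a + pi / 2" for a b
    by (subst nn_integral_real_affine[where c = 1 and t = a])
       (use that in \<open>auto intro!: nn_integral_cong simp: indicator_def\<close>)
  have "(\<integral>\<^sup>+t. g t * indicator {0..<2 * pi} t \<partial>lborel)
      \<le> (\<integral>\<^sup>+t. g t * indicator {0..<pi / 2} t + g t * indicator {pi / 2..<pi} t
            + g t * indicator {pi..<3 * pi / 2} t + g t * indicator {3 * pi / 2..<2 * pi} t \<partial>lborel)"
    by (intro nn_integral_mono) (auto simp: indicator_def)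
  also have "\<dots> = (\<integral>\<^sup>+t. (g t + g (pi / 2 + t) + g (pi + t) + g (3 * pi / 2 + t)) * indicator {0..<pi / 2} t \<partial>lborel)"
    using shift[of pi "pi / 2"] shift[of "3 * pi / 2" pi] shift[of "2 * pi" "3 * pi / 2"]
    by (simp add: nn_integral_add distrib_right)
  also have "\<dots> \<le> (\<integral>\<^sup>+t. ennreal (4 * exp ((cmod c)\<^sup>2 / 4)) * indicator {0..<pi / 2} t \<partial>lborel)"
    using turns by (intro nn_integral_mono mult_right_mono) auto
  also have "\<dots> = ennreal (4 * exp ((cmod c)\<^sup>2 / 4)) * ennreal (pi / 2)"
    by (simp add: nn_integral_cmult)
  also have "\<dots> = ennreal (exp ((cmod c)\<^sup>2 / 4)) * ennreal (2 * pi)"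
    by (simp add: ennreal_mult[symmetric] mult_ac)
  finally have "(\<integral>\<^sup>+t. g t * indicator {0..<2 * pi} t \<partial>lborel) \<le> ennreal (exp ((cmod c)\<^sup>2 / 4)) * ennreal (2 * pi)" .
  then have "(\<integral>\<^sup>+t. g t * indicator {0..<2 * pi} t \<partial>lborel) / ennreal (2 * pi)
      \<le> ennreal (exp ((cmod c)\<^sup>2 / 4)) * ennreal (2 * pi) / ennreal (2 * pi)"
    by (rule divide_right_mono_ennreal)
  also have "\<dots> = ennreal (exp ((cmod c)\<^sup>2 / 4))"
    by (simp add: ennreal_mult[symmetric] divide_ennreal)
  also have "(\<integral>\<^sup>+t. g t * indicator {0..<2 * pi} t \<partial>lborel) / ennreal (2 * pi)
     = (\<integral>\<^sup>+t. g t \<partial>uniform_measure lborel {0..<2 * pi})"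
    by (subst nn_integral_uniform_measure) auto
  also have "\<dots> = (\<integral>\<^sup>+z. ennreal (exp (Re (c * z))) \<partial>torus_uniform)"
    unfolding torus_uniform_def g_def by (subst nn_integral_distr) auto
  finally show ?thesis .
qed

text \<open>Six directions sixty degrees apart leave every z within thirty degrees of one of them
  (up to conjugation), and cos 30 degrees is sqrt 3 / 2. Its square 3/4 is the loss in the tail
  exponents, and six is their prefactor.\<close>

lemma hexagon_direction:
  fixes z :: complex
  obtains \<zeta> where "\<zeta> \<in> {1, - 1, Complex (1/2) (sqrt 3 / 2), Complex (1/2) (- sqrt 3 / 2),
      Complex (- 1/2) (sqrt 3 / 2), Complex (- 1/2) (- sqrt 3 / 2)}"
    "sqrt 3 / 2 * cmod z \<le> Re (\<zeta> * z)"
proof (cases "sqrt 3 / 2 * cmod z \<le> \<bar>Re z\<bar>")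
  case True
  then show thesis
    using that[of 1] that[of "- 1"] by (cases "Re z \<ge> 0") auto
next
  case False
  define x y r where "x = \<bar>Re z\<bar>" and "y = \<bar>Im z\<bar>" and "r = cmod z"
  have r2: "r\<^sup>2 = x\<^sup>2 + y\<^sup>2" and nn: "0 \<le> x" "0 \<le> y" "0 \<le> r"
    by (auto simp: r_def x_def y_def cmod_power2)
  have lt: "x < sqrt 3 / 2 * r" using False by (simp add: x_def r_def)
  have "(sqrt 3 * r - x)\<^sup>2 = 3 * r\<^sup>2 - 2 * x * (sqrt 3 * r) + x\<^sup>2"
    by (simp add: power2_diff power_mult_distrib)
  also have "\<dots> \<le> 3 * r\<^sup>2 - 2 * x * (2 * x) + x\<^sup>2"
    using lt nn by (intro add_right_mono diff_left_mono mult_left_mono) auto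
  also have "\<dots> = (sqrt 3 * y)\<^sup>2"
    by (simp add: r2 power_mult_distrib) (simp add: power2_eq_square)
  finally have "sqrt 3 * r - x \<le> sqrt 3 * y"
    by (rule power2_le_imp_le) (simp add: nn)
  then have key: "sqrt 3 / 2 * r \<le> x / 2 + sqrt 3 / 2 * y" by simp
  define \<zeta> where "\<zeta> = Complex (if Re z \<ge> 0 then 1/2 else - 1/2) (if Im z \<ge> 0 then - sqrt 3 / 2 else sqrt 3 / 2)"
  have "Re (\<zeta> * z) = x / 2 + sqrt 3 / 2 * y"
    by (auto simp: \<zeta>_def x_def y_def)
  then have "sqrt 3 / 2 * cmod z \<le> Re (\<zeta> * z)" using key by (simp only: r_def)
  moreover have "\<zeta> \<in> {1, - 1, Complex (1/2) (sqrt 3 / 2), Complex (1/2) (- sqrt 3 / 2),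
      Complex (- 1/2) (sqrt 3 / 2), Complex (- 1/2) (- sqrt 3 / 2)}"
    unfolding \<zeta>_def by (cases "Re z \<ge> 0"; cases "Im z \<ge> 0") simp_all
  ultimately show thesis by (intro that)
qed

text \<open>Chernoff's bound in each of the six directions. Only the moment generating function is
  assumed, so the bound serves both sums of independent phases and the products of window
  entries.\<close>

lemma (in prob_space) steinhaus_tail:
  assumes X: "X \<in> borel_measurable M"
    and mgf: "\<And>d. (\<integral>\<^sup>+\<omega>. ennreal (exp (Re (d * X \<omega>))) \<partial>M) \<le> ennreal (exp ((cmod d)\<^sup>2 * B / 4))"
    and B: "B > 0" and u: "u \<ge> 0"
  shows "measure M {\<omega> \<in> space M. u \<le> cmod (X \<omega>)} \<le> 6 * exp (- (3/4) * u\<^sup>2 / B)"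
proof -
  define Z where "Z = {1, - 1, Complex (1/2) (sqrt 3 / 2), Complex (1/2) (- sqrt 3 / 2),
      Complex (- 1/2) (sqrt 3 / 2), Complex (- 1/2) (- sqrt 3 / 2)}"
  have [simp]: "finite Z" by (simp add: Z_def)
  have cardZ: "card Z \<le> 6" unfolding Z_def by (intro order_trans[OF card_insert_le_m1]) auto
  have normZ: "cmod \<zeta> = 1" if "\<zeta> \<in> Z" for \<zeta>
    using that by (auto simp: Z_def cmod_def power_divide)
  define v where "v = sqrt 3 / 2 * u"
  define A where "A \<zeta> = {\<omega> \<in> space M. v \<le> Re (\<zeta> * X \<omega>)}" for \<zeta>
  have ReX: "(\<lambda>\<omega>. Re (\<zeta> * X \<omega>)) \<in> borel_measurable M" for \<zeta>
    using X by (intro measurable_compose[OF X] borel_measurable_continuous_onI continuous_intros)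
  have A_sets: "A \<zeta> \<in> events" for \<zeta>
    unfolding A_def using ReX by measurable
  have one: "prob (A \<zeta>) \<le> exp (- (3/4) * u\<^sup>2 / B)" if "\<zeta> \<in> Z" for \<zeta>
  proof -
    \<comment> \<open>This minimises \<open>- \<theta> * v + \<theta>\<^sup>2 * B / 4\<close>, with
      minimum \<open>- v\<^sup>2 / B\<close>.\<close>
    define \<theta> where "\<theta> = 2 * v / B"
    have \<theta>: "\<theta> \<ge> 0" using B u by (simp add: \<theta>_def v_def)
    have "emeasure M (A \<zeta>) = (\<integral>\<^sup>+\<omega>. indicator (A \<zeta>) \<omega> \<partial>M)" using A_sets by simp
    also have "\<dots> \<le> (\<integral>\<^sup>+\<omega>. ennreal (exp (- \<theta> * v)) * ennreal (exp (Re ((of_real \<theta> * \<zeta>) * X \<omega>))) \<partial>M)"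
    proof (intro nn_integral_mono)
      fix \<omega>
      have "Re ((of_real \<theta> * \<zeta>) * X \<omega>) = \<theta> * Re (\<zeta> * X \<omega>)" by (simp add: algebra_simps)
      then show "indicator (A \<zeta>) \<omega> \<le> ennreal (exp (- \<theta> * v)) * ennreal (exp (Re ((of_real \<theta> * \<zeta>) * X \<omega>)))"
        using \<theta> mult_left_mono[of v "Re (\<zeta> * X \<omega>)" \<theta>]
        by (auto simp: indicator_def A_def ennreal_mult[symmetric] exp_add[symmetric] simp del: times_complex.sel)
    qed
    also have "\<dots> = ennreal (exp (- \<theta> * v)) * (\<integral>\<^sup>+\<omega>. ennreal (exp (Re ((of_real \<theta> * \<zeta>) * X \<omega>))) \<partial>M)"
      by (intro nn_integral_cmult measurable_compose[OF ReX measurable_compose[OF _ measurable_ennreal]]) measurable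
    also have "\<dots> \<le> ennreal (exp (- \<theta> * v)) * ennreal (exp ((cmod (of_real \<theta> * \<zeta>))\<^sup>2 * B / 4))"
      by (intro mult_left_mono mgf) auto
    also have "\<dots> = ennreal (exp (- \<theta> * v + \<theta>\<^sup>2 * B / 4))"
      by (simp add: ennreal_mult[symmetric] exp_add[symmetric] norm_mult normZ[OF that])
    also have "- \<theta> * v + \<theta>\<^sup>2 * B / 4 = - (3/4) * u\<^sup>2 / B"
      using B by (simp add: \<theta>_def v_def power_mult_distrib power_divide field_simps power2_eq_square)
    finally show ?thesis by (simp add: emeasure_eq_measure)
  qed
  have "{\<omega> \<in> space M. u \<le> cmod (X \<omega>)} \<subseteq> (\<Union>\<zeta>\<in>Z. A \<zeta>)"
  proof
    fix \<omega> assume "\<omega> \<in> {\<omega> \<in> space M. u \<le> cmod (X \<omega>)}"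
    moreover obtain \<zeta> where "\<zeta> \<in> Z" "sqrt 3 / 2 * cmod (X \<omega>) \<le> Re (\<zeta> * X \<omega>)"
      unfolding Z_def by (rule hexagon_direction)
    moreover have "v \<le> sqrt 3 / 2 * cmod (X \<omega>)" if "u \<le> cmod (X \<omega>)"
      using that by (simp add: v_def)
    ultimately show "\<omega> \<in> (\<Union>\<zeta>\<in>Z. A \<zeta>)" by (fastforce simp: A_def)
  qed
  then have "prob {\<omega> \<in> space M. u \<le> cmod (X \<omega>)} \<le> prob (\<Union>\<zeta>\<in>Z. A \<zeta>)"
    using A_sets by (intro finite_measure_mono) auto
  also have "\<dots> \<le> (\<Sum>\<zeta>\<in>Z. prob (A \<zeta>))"
    using A_sets by (intro finite_measure_subadditive_finite) auto
  also have "\<dots> \<le> (\<Sum>\<zeta>\<in>Z. exp (- (3/4) * u\<^sup>2 / B))" by (intro sum_mono one)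
  also have "\<dots> \<le> 6 * exp (- (3/4) * u\<^sup>2 / B)" using cardZ by (simp add: mult_right_mono)
  finally show ?thesis .
qed

lemma (in prob_space) steinhaus_sum_mgf:
  assumes S: "finite S" and indep: "indep_vars (\<lambda>_. borel) Y S"
    and law: "\<And>i. i \<in> S \<Longrightarrow> distr M borel (Y i) = torus_uniform"
  shows "(\<integral>\<^sup>+\<omega>. ennreal (exp (Re (d * (\<Sum>i\<in>S. c i * Y i \<omega>)))) \<partial>M)
    \<le> ennreal (exp ((cmod d)\<^sup>2 * (\<Sum>i\<in>S. (cmod (c i))\<^sup>2) / 4))"
proof -
  have f_meas: "(\<lambda>z. ennreal (exp (Re (a * z)))) \<in> borel_measurable borel" for a
    by (intro measurable_compose[OF _ measurable_ennreal] borel_measurable_continuous_onI continuous_intros)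
  have Y: "Y i \<in> borel_measurable M" if "i \<in> S" for i
    using indep that by (auto simp: indep_vars_def)
  have "ennreal (exp (Re (d * (\<Sum>i\<in>S. c i * Y i \<omega>)))) = (\<Prod>i\<in>S. ennreal (exp (Re (d * c i * Y i \<omega>))))" for \<omega>
    by (simp add: sum_distrib_left exp_sum[OF S, symmetric] prod_ennreal mult.assoc del: times_complex.sel)
  then have "(\<integral>\<^sup>+\<omega>. ennreal (exp (Re (d * (\<Sum>i\<in>S. c i * Y i \<omega>)))) \<partial>M)
      = (\<Prod>i\<in>S. \<integral>\<^sup>+\<omega>. ennreal (exp (Re (d * c i * Y i \<omega>))) \<partial>M)"
    using S by (simp del: times_complex.sel) (intro indep_vars_nn_integral indep_vars_compose2[OF indep] f_meas, auto)
  also have "\<dots> \<le> (\<Prod>i\<in>S. ennreal (exp ((cmod (d * c i))\<^sup>2 / 4)))"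
  proof (intro prod_mono_ennreal)
    fix i assume i: "i \<in> S"
    have "(\<integral>\<^sup>+\<omega>. ennreal (exp (Re (d * c i * Y i \<omega>))) \<partial>M) = (\<integral>\<^sup>+z. ennreal (exp (Re (d * c i * z))) \<partial>torus_uniform)"
      unfolding law[OF i, symmetric] by (rule nn_integral_distr[symmetric]) (use Y[OF i] f_meas in auto)
    then show "(\<integral>\<^sup>+\<omega>. ennreal (exp (Re (d * c i * Y i \<omega>))) \<partial>M) \<le> ennreal (exp ((cmod (d * c i))\<^sup>2 / 4))"
      using torus_uniform_mgf by metis
  qed
  also have "\<dots> = ennreal (exp ((cmod d)\<^sup>2 * (\<Sum>i\<in>S. (cmod (c i))\<^sup>2) / 4))"
    using S by (simp add: prod_ennreal exp_sum[symmetric] sum_distrib_left sum_divide_distrib norm_mult power_mult_distrib)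
  finally show ?thesis .
qed

lemma (in prob_space) steinhaus_sum_tail:
  assumes S: "finite S" and indep: "indep_vars (\<lambda>_. borel) Y S"
    and law: "\<And>i. i \<in> S \<Longrightarrow> distr M borel (Y i) = torus_uniform"
    and B: "(\<Sum>i\<in>S. (cmod (c i))\<^sup>2) \<le> B" "B > 0" and u: "u \<ge> 0"
  shows "measure M {\<omega> \<in> space M. u \<le> cmod (\<Sum>i\<in>S. c i * Y i \<omega>)} \<le> 6 * exp (- (3/4) * u\<^sup>2 / B)"
proof (rule steinhaus_tail[OF _ _ B(2) u])
  have Y: "Y i \<in> borel_measurable M" if "i \<in> S" for i
    using indep that by (auto simp: indep_vars_def)
  then show "(\<lambda>\<omega>. \<Sum>i\<in>S. c i * Y i \<omega>) \<in> borel_measurable M" by measurable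
  fix d
  have "(cmod d)\<^sup>2 * (\<Sum>i\<in>S. (cmod (c i))\<^sup>2) / 4 \<le> (cmod d)\<^sup>2 * B / 4"
    using B by (intro divide_right_mono mult_left_mono) auto
  then show "(\<integral>\<^sup>+\<omega>. ennreal (exp (Re (d * (\<Sum>i\<in>S. c i * Y i \<omega>)))) \<partial>M) \<le> ennreal (exp ((cmod d)\<^sup>2 * B / 4))"
    using steinhaus_sum_mgf[OF S indep law, of d c] by (meson order_trans ennreal_leI exp_le_cancel_iff)
qed

section \<open>Measurability of the recovery event\<close>

definition bp_competitor ::
  "nat \<Rightarrow> (nat \<Rightarrow> complex) \<Rightarrow> (nat \<times> nat \<Rightarrow> complex) \<Rightarrow> (nat \<times> nat \<Rightarrow> complex) \<Rightarrow> bool" where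
  "bp_competitor n h x v \<longleftrightarrow>
     (\<forall>q<n. (\<Sum>i\<in>tf_grid n. gabor_matrix n h q i * v i) = 0) \<and>
     l1_norm n (\<lambda>i. x i + v i) \<le> l1_norm n x"

text \<open>Failure is phrased by the deviation v from x, in terms of h and x alone. All conditions
  on (h, x, v) are closed except the strict inequality, so the quantifier over v can be treated by
  compactness to obtain a Borel set.\<close>

definition bp_fails :: "nat \<Rightarrow> (nat \<Rightarrow> complex) \<Rightarrow> (nat \<times> nat \<Rightarrow> complex) \<Rightarrow> bool" where
  "bp_fails n h x \<longleftrightarrow> (\<exists>v. bp_competitor n h x v \<and> l1_norm n v > 0)"

lemma bp_recovers_iff_not_fails:
  assumes S: "S = {i \<in> tf_grid n. x i \<noteq> 0}"
  shows "bp_recovers n h (tf_operator n S x h) x \<longleftrightarrow> \<not> bp_fails n h x"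
proof -
  let ?y = "tf_operator n S x h"
  have y: "?y q = (\<Sum>i\<in>tf_grid n. gabor_matrix n h q i * x i)" for q
    using S by (intro tf_operator_eq_sum_grid) auto
  have feas: "bp_feasible n h ?y (\<lambda>i. x i + v i)
      \<longleftrightarrow> (\<forall>q<n. (\<Sum>i\<in>tf_grid n. gabor_matrix n h q i * v i) = 0)" for v
    by (simp add: bp_feasible_def y distrib_left sum.distrib)
  have l1_pos: "l1_norm n v > 0 \<longleftrightarrow> \<not> (\<forall>i\<in>tf_grid n. v i = 0)" for v
  proof -
    have "l1_norm n v = 0 \<longleftrightarrow> (\<forall>i\<in>tf_grid n. v i = 0)"
      by (simp add: l1_norm_def sum_nonneg_eq_0_iff)
    moreover have "l1_norm n v \<ge> 0" by (simp add: l1_norm_def sum_nonneg)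
    ultimately show ?thesis by linarith
  qed
  have fails: "bp_fails n h x \<longleftrightarrow> (\<exists>x'. bp_feasible n h ?y x' \<and> l1_norm n x' \<le> l1_norm n x
      \<and> \<not> (\<forall>i\<in>tf_grid n. x' i = x i))"
  proof
    assume "bp_fails n h x"
    then obtain v where "bp_competitor n h x v" "l1_norm n v > 0" by (auto simp: bp_fails_def)
    then show "\<exists>x'. bp_feasible n h ?y x' \<and> l1_norm n x' \<le> l1_norm n x \<and> \<not> (\<forall>i\<in>tf_grid n. x' i = x i)"
      using feas[of v] l1_pos[of v] by (intro exI[of _ "\<lambda>i. x i + v i"]) (auto simp: bp_competitor_def)
  next
    assume "\<exists>x'. bp_feasible n h ?y x' \<and> l1_norm n x' \<le> l1_norm n x \<and> \<not> (\<forall>i\<in>tf_grid n. x' i = x i)"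
    then obtain x' where x': "bp_feasible n h ?y x'" "l1_norm n x' \<le> l1_norm n x" "\<not> (\<forall>i\<in>tf_grid n. x' i = x i)"
      by blast
    then show "bp_fails n h x"
      using feas[of "\<lambda>i. x' i - x i"] l1_pos[of "\<lambda>i. x' i - x i"]
      by (auto simp: bp_fails_def bp_competitor_def intro!: exI[of _ "\<lambda>i. x' i - x i"])
  qed
  have feas_x: "bp_feasible n h ?y x" by (simp add: bp_feasible_def y)
  show ?thesis
  proof
    assume rec: "bp_recovers n h ?y x"
    show "\<not> bp_fails n h x"
    proof
      assume "bp_fails n h x"
      then obtain x' where x': "bp_feasible n h ?y x'" "l1_norm n x' \<le> l1_norm n x" "\<not> (\<forall>i\<in>tf_grid n. x' i = x i)"
        unfolding fails by blast
      then have "bp_solution n h ?y x'"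
        using rec unfolding bp_recovers_def bp_solution_def by (meson order_trans)
      then show False using rec x'(3) unfolding bp_recovers_def by blast
    qed
  next
    assume nf: "\<not> bp_fails n h x"
    have "l1_norm n x \<le> l1_norm n x'" if "bp_feasible n h ?y x'" for x'
    proof (rule ccontr)
      assume gt: "\<not> l1_norm n x \<le> l1_norm n x'"
      have "l1_norm n x' = l1_norm n x" if "\<forall>i\<in>tf_grid n. x' i = x i" using that by (simp add: l1_norm_def)
      then have "\<not> (\<forall>i\<in>tf_grid n. x' i = x i)" using gt by auto
      then show False using nf that gt unfolding fails by force
    qed
    then have "bp_solution n h ?y x" using feas_x by (simp add: bp_solution_def)
    moreover have "\<forall>i\<in>tf_grid n. x' i = x i" if "bp_solution n h ?y x'" for x'
      using nf that feas_x unfolding fails bp_solution_def by blast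
    ultimately show "bp_recovers n h ?y x" unfolding bp_recovers_def by blast
  qed
qed

lemma bp_fails_cong:
  assumes "\<And>q. q < n \<Longrightarrow> h q = h' q" "\<And>i. i \<in> tf_grid n \<Longrightarrow> x i = x' i"
  shows "bp_fails n h x \<longleftrightarrow> bp_fails n h' x'"
proof -
  have "gabor_matrix n h q i = gabor_matrix n h' q i" if "q < n" for q i
    using assms(1)[of "(snd i + q) mod n"] that
    by (simp add: gabor_matrix_def modulation_def translation_def case_prod_unfold)
  moreover have "l1_norm n (\<lambda>i. x i + v i) = l1_norm n (\<lambda>i. x' i + v i)" "l1_norm n x = l1_norm n x'" for v
    using assms(2) by (simp_all add: l1_norm_def)
  ultimately show ?thesis by (simp add: bp_fails_def bp_competitor_def)
qed

text \<open>Tube lemma: projection along a compact factor maps closed sets to closed sets.\<close>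

lemma closed_image_fst_compact:
  fixes D :: "('a::topological_space \<times> 'b::topological_space) set"
  assumes "compact K" "closed D"
  shows "closed {a. \<exists>b\<in>K. (a, b) \<in> D}"
proof -
  have "open {a. \<forall>b\<in>K. (a, b) \<in> - D}"
  proof (subst open_subopen, intro ballI)
    fix a assume a: "a \<in> {a. \<forall>b\<in>K. (a, b) \<in> - D}"
    have "open (- D)" using assms(2) by (simp add: open_Compl)
    moreover have "{a} \<times> K \<subseteq> - D" using a by auto
    ultimately obtain U where "open U" "a \<in> U" "U \<times> K \<subseteq> - D"
      using Elementary_Topology.tube_lemma[OF assms(1)] by metis
    then show "\<exists>T. open T \<and> a \<in> T \<and> T \<subseteq> {a. \<forall>b\<in>K. (a, b) \<in> - D}" by (intro exI[of _ U]) auto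
  qed
  then show ?thesis by (simp add: closed_def Collect_neg_eq[symmetric])
qed


lemma continuous_on_gabor_matrix:
  assumes "continuous_on S h"
  shows "continuous_on S (\<lambda>p. gabor_matrix n (h p) q i)"
  unfolding gabor_matrix_def modulation_def translation_def case_prod_unfold
  by (intro continuous_intros continuous_on_product_then_coordinatewise[OF assms])

text \<open>The uncountable quantifier over v is exhausted by countably many compact ones: r bounds
  the entries, and m keeps the norm away from 0. Each piece is the projection of a closed set along
  a compact factor, so failure is a countable union of closed sets.\<close>

lemma borel_bp_fails: "{(h, x). bp_fails n h x} \<in> sets borel"
proof -
  \<comment> \<open>Entries off the grid are pinned to 0, which makes \<open>K r\<close> a product
    of compact sets, compact by Tychonoff.\<close>
  define K :: "nat \<Rightarrow> (nat \<times> nat \<Rightarrow> complex) set"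
    where "K r = PiE UNIV (\<lambda>i. if i \<in> tf_grid n then cball 0 (real r) else {0})" for r
  define D where "D m = {p. bp_competitor n (fst (fst p)) (snd (fst p)) (snd p) \<and>
      1 / real (Suc m) \<le> l1_norm n (snd p)}" for m
  have "compactin (product_topology (\<lambda>_. euclidean) UNIV) (K r)" for r
    unfolding K_def compactin_PiE by auto
  then have compact_K: "compact (K r)" for r
    by (simp add: euclidean_product_topology)
  have cont_h: "continuous_on UNIV (\<lambda>p :: ((nat \<Rightarrow> complex) \<times> (nat \<times> nat \<Rightarrow> complex)) \<times> (nat \<times> nat \<Rightarrow> complex).
      gabor_matrix n (fst (fst p)) q i)" for q i
    by (intro continuous_on_gabor_matrix continuous_on_fst continuous_on_id)
  have cont_x: "continuous_on UNIV (\<lambda>p :: ((nat \<Rightarrow> complex) \<times> (nat \<times> nat \<Rightarrow> complex)) \<times> (nat \<times> nat \<Rightarrow> complex).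
      snd (fst p) i)" for i
    by (rule continuous_on_product_then_coordinatewise) (intro continuous_on_snd continuous_on_fst continuous_on_id)
  have cont_v: "continuous_on UNIV (\<lambda>p :: ((nat \<Rightarrow> complex) \<times> (nat \<times> nat \<Rightarrow> complex)) \<times> (nat \<times> nat \<Rightarrow> complex).
      snd p i)" for i
    by (rule continuous_on_product_then_coordinatewise) (intro continuous_on_snd continuous_on_id)
  have D_eq: "D m = (\<Inter>q\<in>{..<n}. {p. (\<Sum>i\<in>tf_grid n. gabor_matrix n (fst (fst p)) q i * snd p i) = 0})
      \<inter> {p. (\<Sum>i\<in>tf_grid n. cmod (snd (fst p) i + snd p i)) \<le> (\<Sum>i\<in>tf_grid n. cmod (snd (fst p) i))}
      \<inter> {p. 1 / real (Suc m) \<le> (\<Sum>i\<in>tf_grid n. cmod (snd p i))}" for m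
    by (auto simp: D_def bp_competitor_def l1_norm_def)
  have closed_D: "closed (D m)" for m
    unfolding D_eq
    by (intro closed_Int closed_INT ballI closed_Collect_eq closed_Collect_le continuous_on_sum
        continuous_on_mult continuous_on_norm continuous_on_add continuous_on_const cont_h cont_x cont_v)
  have "{(h, x). bp_fails n h x} = (\<Union>m. \<Union>r. {p. \<exists>v\<in>K r. (p, v) \<in> D m})"
  proof (intro equalityI subsetI)
    fix p assume "p \<in> {(h, x). bp_fails n h x}"
    then obtain h x v where p: "p = (h, x)" and v: "bp_competitor n h x v" "l1_norm n v > 0"
      by (auto simp: bp_fails_def)
    define v' where "v' i = (if i \<in> tf_grid n then v i else 0)" for i
    have v': "bp_competitor n h x v'" "l1_norm n v' = l1_norm n v"
      using v by (simp_all add: bp_competitor_def v'_def l1_norm_def cong: sum.cong)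
    obtain m where m: "1 / real (Suc m) < l1_norm n v"
      using v(2) reals_Archimedean by (metis inverse_eq_divide)
    obtain r where r: "l1_norm n v \<le> real r" using real_arch_simple by blast
    have "cmod (v i) \<le> real r" if "i \<in> tf_grid n" for i
      using r member_le_sum[OF that, of "\<lambda>i. cmod (v i)"] by (simp add: l1_norm_def)
    then have "v' \<in> K r" by (auto simp: K_def v'_def)
    moreover have "(p, v') \<in> D m" using v' m by (simp add: D_def p)
    ultimately show "p \<in> (\<Union>m. \<Union>r. {p. \<exists>v\<in>K r. (p, v) \<in> D m})" by blast
  next
    fix p assume "p \<in> (\<Union>m. \<Union>r. {p. \<exists>v\<in>K r. (p, v) \<in> D m})"
    then obtain m r v where "(p, v) \<in> D m" by blast
    then have "bp_competitor n (fst p) (snd p) v" "1 / real (Suc m) \<le> l1_norm n v"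
      by (simp_all add: D_def)
    moreover have "0 < 1 / real (Suc m)" by simp
    ultimately show "p \<in> {(h, x). bp_fails n h x}"
      unfolding bp_fails_def case_prod_unfold mem_Collect_eq by (meson less_le_trans)
  qed
  moreover have "{p. \<exists>v\<in>K r. (p, v) \<in> D m} \<in> sets borel" for m r
    by (intro borel_closed closed_image_fst_compact compact_K closed_D)
  ultimately show ?thesis by (simp only:) (intro sets.countable_UN UNIV_I subsetI; auto)
qed

text \<open>Points of the product space are \<open>undefined\<close> off I, so the extra coordinates
  are constant. Countability of the index type lets coordinatewise measurability suffice.\<close>

lemma PiM_to_borel:
  fixes I :: "'i::countable set"
  shows "(\<lambda>f. f) \<in> PiM I (\<lambda>_. borel :: complex measure) \<rightarrow>\<^sub>M (borel :: ('i \<Rightarrow> complex) measure)"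
proof (rule measurable_coordinatewise_then_product)
  fix i
  show "(\<lambda>f. f i) \<in> borel_measurable (PiM I (\<lambda>_. borel :: complex measure))"
  proof (cases "i \<in> I")
    case False
    then have "f i = undefined" if "f \<in> space (PiM I (\<lambda>_. borel :: complex measure))" for f
      using that by (auto simp: space_PiM PiE_def extensional_def)
    then show ?thesis by (subst measurable_cong[where g = "\<lambda>_. undefined"]) auto
  qed simp
qed

lemma measurable_bp_fails:
  assumes "H \<in> M \<rightarrow>\<^sub>M borel" "X \<in> M \<rightarrow>\<^sub>M borel"
  shows "{\<omega> \<in> space M. bp_fails n (H \<omega>) (X \<omega>)} \<in> sets M"
proof -
  have "(\<lambda>\<omega>. (H \<omega>, X \<omega>)) \<in> M \<rightarrow>\<^sub>M borel"
    using measurable_Pair[OF assms] by (simp add: borel_prod)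
  from measurable_sets[OF this borel_bp_fails[of n]] show ?thesis
    by (simp add: vimage_def Int_def conj_commute)
qed

section \<open>Gabor systems and the Alltop window\<close>

text \<open>An integer argument, so that exponents can be negated and reduced modulo n.\<close>

definition unit_root :: "nat \<Rightarrow> int \<Rightarrow> complex" where
  "unit_root n z = cis (2 * pi * real_of_int z / real n)"

lemma unit_root_add: "unit_root n (a + b) = unit_root n a * unit_root n b"
  by (simp add: unit_root_def cis_mult add_divide_distrib distrib_left)

lemma unit_root_0 [simp]: "unit_root n 0 = 1"
  by (simp add: unit_root_def)

lemma unit_root_cnj: "cnj (unit_root n a) = unit_root n (- a)"
  by (simp add: unit_root_def cis_cnj)

lemma norm_unit_root [simp]: "cmod (unit_root n a) = 1"
  by (simp add: unit_root_def)

lemma unit_root_power: "unit_root n a ^ m = unit_root n (a * int m)"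
  by (induction m) (simp_all add: unit_root_add[symmetric] algebra_simps)

lemma unit_root_eq_1_iff: "n > 0 \<Longrightarrow> unit_root n a = 1 \<longleftrightarrow> int n dvd a"
proof
  assume n: "n > 0" and "unit_root n a = 1"
  then have "cos (2 * pi * real_of_int a / real n) = 1"
    by (metis unit_root_def cis.sel(1) one_complex.sel(1))
  then obtain x :: int where "2 * pi * real_of_int a / real n = real_of_int x * 2 * pi"
    by (auto simp: cos_one_2pi_int)
  then have "real_of_int a = real_of_int (x * int n)" using n by (simp add: field_simps)
  then have "a = x * int n" by (rule of_int_eq_iff[THEN iffD1])
  then show "int n dvd a" by simp
next
  assume n: "n > 0" and "int n dvd a"
  then obtain x where "a = int n * x" by (elim dvdE)
  then have "2 * pi * real_of_int a / real n = 2 * pi * real_of_int x" using n by simp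
  then show "unit_root n a = 1" by (simp add: unit_root_def cis_multiple_2pi)
qed

lemma unit_root_periodic: "n > 0 \<Longrightarrow> int n dvd b \<Longrightarrow> unit_root n (a + b) = unit_root n a"
  using unit_root_eq_1_iff[of n b] by (simp add: unit_root_add)

lemma unit_root_cong: "n > 0 \<Longrightarrow> a mod int n = b mod int n \<Longrightarrow> unit_root n a = unit_root n b"
  using unit_root_periodic[of n "a - b" b] by (simp add: mod_eq_dvd_iff)

lemma sum_unit_root: "n > 0 \<Longrightarrow> (\<Sum>q<n. unit_root n (a * int q)) = (if int n dvd a then of_nat n else 0)"
proof -
  assume n: "n > 0"
  define z where "z = unit_root n a"
  have sum: "(\<Sum>q<n. unit_root n (a * int q)) = (\<Sum>q<n. z ^ q)"
    by (simp add: z_def unit_root_power)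
  have "z ^ n = 1" using unit_root_eq_1_iff[OF n, of "a * int n"] by (simp add: z_def unit_root_power)
  then have "(z - 1) * (\<Sum>q<n. z ^ q) = 0" using power_diff_1_eq[of z n] by simp
  then show ?thesis using sum unit_root_eq_1_iff[OF n, of a] by (auto simp: z_def)
qed

lemma sum_periodic_shift:
  fixes f :: "int \<Rightarrow> complex"
  assumes "\<And>z. f (z + int n) = f z"
  shows "(\<Sum>q<n. f (int q + int r)) = (\<Sum>q<n. f (int q))"
proof (induction r)
  case (Suc r)
  have "(\<Sum>q<n. f (int q + int (Suc r))) + f (int r) = (\<Sum>q<Suc n. f (int q + int r))"
    by (subst sum.lessThan_Suc_shift) (simp add: algebra_simps)
  also have "\<dots> = (\<Sum>q<n. f (int q + int r)) + f (int r)"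
    using assms[of "int r"] by (simp add: algebra_simps)
  finally show ?case using Suc.IH by simp
qed simp

text \<open>The window as an n-periodic function on the integers; index differences are then free of
  truncated subtraction.\<close>

definition periodic_ext :: "nat \<Rightarrow> (nat \<Rightarrow> complex) \<Rightarrow> int \<Rightarrow> complex" where
  "periodic_ext n h z = h (nat (z mod int n))"

lemma periodic_ext_cong: "a mod int n = b mod int n \<Longrightarrow> periodic_ext n h a = periodic_ext n h b"
  by (simp add: periodic_ext_def)

lemma gabor_matrix_eq: "gabor_matrix n h q (l, p) = unit_root n (int l * int q) * periodic_ext n h (int p + int q)"
proof -
  have "nat ((int p + int q) mod int n) = (p + q) mod n"
    by (metis nat_int of_nat_add of_nat_mod)
  then show ?thesis
    by (simp add: gabor_matrix_def modulation_def translation_def unit_root_def periodic_ext_def mult.assoc)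
qed

lemma gram_eq:
  "gram n h (l, p) (l', p') = (\<Sum>q<n. unit_root n ((int l' - int l) * int q)
      * (periodic_ext n h (int p' + int q) * cnj (periodic_ext n h (int p + int q))))"
proof -
  have "unit_root n ((int l' - int l) * int q) = unit_root n (- (int l * int q)) * unit_root n (int l' * int q)" for q
    by (simp add: unit_root_add[symmetric] left_diff_distrib)
  then show ?thesis by (simp add: gram_def gabor_matrix_eq unit_root_cnj mult_ac)
qed

text \<open>The rows are orthogonal because the sum over modulations kills q different from r. On
  the diagonal the n^2 terms have squared modulus 1 / n each, which gives the frame constant
  n.\<close>

lemma gabor_frame:
  assumes n: "n > 0" and h: "\<And>q. q < n \<Longrightarrow> (cmod (h q))\<^sup>2 = 1 / real n"
    and qr: "q < n" "r < n"
  shows "(\<Sum>t\<in>tf_grid n. gabor_matrix n h q t * cnj (gabor_matrix n h r t)) = (if q = r then of_nat n else 0)"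
proof -
  have dvd: "int n dvd int q - int r \<longleftrightarrow> q = r"
  proof
    assume "int n dvd int q - int r"
    then have "int q mod int n = int r mod int n" by (simp add: mod_eq_dvd_iff)
    then show "q = r" using qr by simp
  qed simp
  define P where "P p = periodic_ext n h (int p + int q) * cnj (periodic_ext n h (int p + int r))" for p
  have "(\<Sum>t\<in>tf_grid n. gabor_matrix n h q t * cnj (gabor_matrix n h r t))
     = (\<Sum>l<n. \<Sum>p<n. unit_root n ((int q - int r) * int l) * P p)"
  proof -
    have "gabor_matrix n h q (l, p) * cnj (gabor_matrix n h r (l, p)) = unit_root n ((int q - int r) * int l) * P p" for l p
    proof -
      have "unit_root n ((int q - int r) * int l) = unit_root n (int l * int q) * unit_root n (- (int l * int r))"
        by (simp add: unit_root_add[symmetric] algebra_simps)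
      then show ?thesis by (simp add: gabor_matrix_eq P_def unit_root_cnj mult_ac)
    qed
    then show ?thesis
      unfolding tf_grid_def sum.cartesian_product by (intro sum.cong refl) auto
  qed
  also have "\<dots> = (\<Sum>l<n. unit_root n ((int q - int r) * int l)) * (\<Sum>p<n. P p)"
    by (simp add: sum_product)
  also have "\<dots> = (if q = r then of_nat n else 0)"
  proof (cases "q = r")
    case True
    have "P p = complex_of_real (1 / real n)" for p
    proof -
      have "nat ((int p + int q) mod int n) < n" using n by (simp add: nat_less_iff)
      then have "(cmod (periodic_ext n h (int p + int q)))\<^sup>2 = 1 / real n"
        unfolding periodic_ext_def by (rule h)
      then show ?thesis using True by (simp only: P_def complex_norm_square[symmetric])
    qed
    then show ?thesis using True n by (simp add: sum_unit_root[OF n])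
  qed (simp add: sum_unit_root[OF n] dvd)
  finally show ?thesis .
qed

text \<open>With A the dictionary matrix and G = A^H A, the frame identity A A^H = n yields G^2 =
  A^H (A A^H) A = n G.\<close>

lemma gabor_tight_gram:
  assumes n: "n > 0" and h: "\<And>q. q < n \<Longrightarrow> (cmod (h q))\<^sup>2 = 1 / real n" and \<mu>: "\<mu> \<ge> 0"
    and coh: "\<And>i j. i \<in> tf_grid n \<Longrightarrow> j \<in> tf_grid n \<Longrightarrow> i \<noteq> j \<Longrightarrow> cmod (gram n h i j) \<le> \<mu>"
  shows "tight_gram (tf_grid n) (gram n h) (real n) \<mu>"
proof
  show "finite (tf_grid n)" by (simp add: tf_grid_def)
  show "cnj (gram n h i j) = gram n h j i" for i j by (simp add: gram_def mult.commute)
  show "gram n h i i = 1" for i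
  proof (cases i)
    case (Pair l p)
    have "periodic_ext n h (int p + int q) * cnj (periodic_ext n h (int p + int q)) = complex_of_real (1 / real n)" for q
    proof -
      have "nat ((int p + int q) mod int n) < n" using n by (simp add: nat_less_iff)
      then have "(cmod (periodic_ext n h (int p + int q)))\<^sup>2 = 1 / real n"
        unfolding periodic_ext_def by (rule h)
      then show ?thesis by (simp only: complex_norm_square[symmetric])
    qed
    then show ?thesis using n by (simp add: Pair gram_eq)
  qed
  show "(\<Sum>t\<in>tf_grid n. gram n h i t * gram n h t j) = complex_of_real (real n) * gram n h i j" for i j
  proof -
    let ?a = "gabor_matrix n h"
    have "(\<Sum>t\<in>tf_grid n. gram n h i t * gram n h t j)
        = (\<Sum>t\<in>tf_grid n. \<Sum>q<n. \<Sum>r<n. (cnj (?a q i) * ?a r j) * (?a q t * cnj (?a r t)))"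
      unfolding gram_def sum_product by (simp add: mult_ac)
    also have "\<dots> = (\<Sum>q<n. \<Sum>r<n. \<Sum>t\<in>tf_grid n. (cnj (?a q i) * ?a r j) * (?a q t * cnj (?a r t)))"
      by (subst sum.swap, rule sum.cong[OF refl], rule sum.swap)
    also have "\<dots> = (\<Sum>q<n. \<Sum>r<n. (cnj (?a q i) * ?a r j) * (if q = r then of_nat n else 0))"
      by (intro sum.cong refl) (simp only: sum_distrib_left[symmetric] gabor_frame[OF n h] lessThan_iff)
    also have "\<dots> = (\<Sum>q<n. \<Sum>r<n. if q = r then cnj (?a q i) * ?a r j * of_nat n else 0)"
      by (intro sum.cong refl) auto
    also have "\<dots> = complex_of_real (real n) * gram n h i j"
      by (simp add: gram_def sum_distrib_left mult_ac)
    finally show ?thesis .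
  qed
qed (use coh \<mu> in auto)

text \<open>Squaring and substituting q = d + r leaves, for each d, a linear character sum in r with
  frequency 2 A d. The assumption on A makes it vanish unless d = 0.\<close>

lemma norm_quadratic_gauss_sum:
  assumes n: "n > 0" and A: "\<And>d. d < n \<Longrightarrow> int n dvd 2 * A * int d \<Longrightarrow> d = 0"
  shows "(cmod (\<Sum>q<n. unit_root n (A * (int q)\<^sup>2 + B * int q + C)))\<^sup>2 = real n"
proof -
  let ?f = "\<lambda>z. unit_root n (A * z\<^sup>2 + B * z + C)"
  have per: "?f (z + int n) = ?f z" for z
  proof -
    have "A * (z + int n)\<^sup>2 + B * (z + int n) + C = (A * z\<^sup>2 + B * z + C) + int n * (2 * A * z + A * int n + B)"
      by (simp add: power2_eq_square algebra_simps)
    then show ?thesis by (simp only:) (rule unit_root_periodic[OF n], simp)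
  qed
  have "(\<Sum>q<n. ?f (int q)) * cnj (\<Sum>q<n. ?f (int q)) = (\<Sum>r<n. (\<Sum>q<n. ?f (int q)) * cnj (?f (int r)))"
    by (simp add: sum_distrib_left)
  also have "\<dots> = (\<Sum>r<n. (\<Sum>d<n. ?f (int d + int r)) * cnj (?f (int r)))"
    by (simp only: sum_periodic_shift[where f = ?f, OF per])
  also have "\<dots> = (\<Sum>r<n. \<Sum>d<n. unit_root n (A * (int d)\<^sup>2 + B * int d) * unit_root n ((2 * A * int d) * int r))"
    unfolding sum_distrib_right unit_root_cnj unit_root_add[symmetric]
    by (intro sum.cong refl arg_cong[where f = "unit_root n"]) (simp add: power2_eq_square algebra_simps)
  also have "\<dots> = (\<Sum>d<n. unit_root n (A * (int d)\<^sup>2 + B * int d) * (\<Sum>r<n. unit_root n ((2 * A * int d) * int r)))"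
    by (subst sum.swap) (simp add: sum_distrib_left)
  also have "\<dots> = (\<Sum>d<n. if d = 0 then of_nat n else 0)"
    by (intro sum.cong refl) (use A in \<open>auto simp: sum_unit_root[OF n]\<close>)
  also have "\<dots> = complex_of_real (real n)" using n by simp
  finally show ?thesis
    unfolding complex_norm_square[symmetric] by (simp only: of_real_eq_iff)
qed

text \<open>In a product of two shifted Alltop phases the cubes cancel, leaving a quadratic phase
  with leading coefficient 3 (p' - p). Twice this coefficient is invertible modulo a prime n of at
  least 5 when p and p' differ. If they agree, a nontrivial linear character sum remains, which is
  0.\<close>

lemma alltop_coherence:
  assumes "prime n" "n \<ge> 5" and ij: "i \<in> tf_grid n" "j \<in> tf_grid n" "i \<noteq> j"
  shows "cmod (gram n (alltop_window n) i j) \<le> 1 / sqrt (real n)"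
proof -
  have n: "n > 0" using assms by simp
  obtain l p l' p' where ij_eq: "i = (l, p)" "j = (l', p')" by (cases i, cases j)
  have lt: "l < n" "p < n" "l' < n" "p' < n" using ij by (auto simp: ij_eq tf_grid_def)
  have ext: "periodic_ext n (alltop_window n) z = unit_root n (z ^ 3) / sqrt (real n)" for z
  proof -
    have "real (nat (z mod int n)) ^ 3 = real_of_int ((z mod int n) ^ 3)" using n by simp
    then have "periodic_ext n (alltop_window n) z = unit_root n ((z mod int n) ^ 3) / sqrt (real n)"
      by (simp only: periodic_ext_def alltop_window_def unit_root_def)
    also have "unit_root n ((z mod int n) ^ 3) = unit_root n (z ^ 3)"
      by (rule unit_root_cong[OF n]) (simp add: power_mod)
    finally show ?thesis .
  qed
  define A where "A = 3 * (int p' - int p)"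
  define B where "B = 3 * ((int p')\<^sup>2 - (int p)\<^sup>2) + (int l' - int l)"
  define C where "C = (int p') ^ 3 - (int p) ^ 3"
  have "gram n (alltop_window n) i j = (\<Sum>q<n. unit_root n (A * (int q)\<^sup>2 + B * int q + C) / real n)"
    unfolding ij_eq gram_eq ext
  proof (intro sum.cong refl)
    fix q
    have "unit_root n ((int l' - int l) * int q) *
        (unit_root n ((int p' + int q) ^ 3) / sqrt (real n) * cnj (unit_root n ((int p + int q) ^ 3) / sqrt (real n)))
      = unit_root n ((int l' - int l) * int q + ((int p' + int q) ^ 3 + - ((int p + int q) ^ 3)))
          / complex_of_real (sqrt (real n) * sqrt (real n))"
      by (simp only: unit_root_add unit_root_cnj complex_cnj_divide complex_cnj_complex_of_real of_real_mult
          times_divide_eq_left times_divide_eq_right divide_divide_eq_left mult_ac)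
    also have "(int l' - int l) * int q + ((int p' + int q) ^ 3 + - ((int p + int q) ^ 3)) = A * (int q)\<^sup>2 + B * int q + C"
      by (simp add: A_def B_def C_def power2_eq_square power3_eq_cube algebra_simps)
    finally show "unit_root n ((int l' - int l) * int q) *
        (unit_root n ((int p' + int q) ^ 3) / sqrt (real n) * cnj (unit_root n ((int p + int q) ^ 3) / sqrt (real n)))
      = unit_root n (A * (int q)\<^sup>2 + B * int q + C) / real n" by simp
  qed
  then have gram: "cmod (gram n (alltop_window n) i j) = cmod (\<Sum>q<n. unit_root n (A * (int q)\<^sup>2 + B * int q + C)) / real n"
    by (simp add: sum_divide_distrib[symmetric] norm_divide)
  show ?thesis
  proof (cases "p = p'")
    case True
    then have "l \<noteq> l'" using ij(3) ij_eq by auto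
    have "\<not> int n dvd int l' - int l"
    proof
      assume "int n dvd int l' - int l"
      then have "int l' mod int n = int l mod int n" by (simp add: mod_eq_dvd_iff)
      then show False using lt \<open>l \<noteq> l'\<close> by simp
    qed
    then have "(\<Sum>q<n. unit_root n (A * (int q)\<^sup>2 + B * int q + C)) = 0"
      using True sum_unit_root[OF n, of "int l' - int l"] by (simp add: A_def B_def C_def)
    then show ?thesis by (simp add: gram)
  next
    case False
    have "d = 0" if d: "d < n" "int n dvd 2 * A * int d" for d
    proof -
      have pr: "prime (int n)" using assms(1) by simp
      have small: "\<not> int n dvd z" if "0 < \<bar>z\<bar>" "\<bar>z\<bar> < int n" for z
        using that by (metis abs_of_nat dvd_imp_le_int linorder_not_less zero_less_abs_iff)
      have "\<not> int n dvd int p' - int p" by (rule small) (use False lt in auto)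
      moreover have "\<not> int n dvd 6" using assms(2)
      proof (cases "n = 5")
        case False
        then have "n \<noteq> 6" using assms(1) using prime_nat_iff[of 6] by (auto dest!: spec[of _ "2 :: nat"])
        then show ?thesis by (intro small) (use False assms(2) in auto)
      qed simp
      moreover have "int n dvd 6 * ((int p' - int p) * int d)" using d(2) by (simp add: A_def mult_ac)
      ultimately have "int n dvd int d" using pr by (simp add: prime_dvd_mult_iff)
      then have "n dvd d" by (simp only: of_nat_dvd_iff)
      then show ?thesis using d(1) by (metis dvd_imp_le not_le not_gr_zero)
    qed
    then have "(cmod (\<Sum>q<n. unit_root n (A * (int q)\<^sup>2 + B * int q + C)))\<^sup>2 = real n"
      by (intro norm_quadratic_gauss_sum n)
    from arg_cong[OF this, of sqrt]
    have "cmod (\<Sum>q<n. unit_root n (A * (int q)\<^sup>2 + B * int q + C)) = sqrt (real n)"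
      by (simp only: real_sqrt_abs abs_norm_cancel)
    then have "cmod (gram n (alltop_window n) i j) = sqrt (real n) / real n" by (simp only: gram)
    also have "\<dots> = 1 / sqrt (real n)" using n by (simp add: field_simps)
    finally show ?thesis by simp
  qed
qed

section \<open>Coherence of the random window\<close>

lemma prob_space_torus_uniform: "prob_space torus_uniform"
proof -
  have "prob_space (uniform_measure lborel {0..<2 * pi})"
    by (rule prob_space_uniform_measure) auto
  moreover have "cis \<in> borel_measurable borel"
    by (intro borel_measurable_continuous_onI continuous_intros)
  ultimately show ?thesis
    unfolding torus_uniform_def by (intro prob_space.prob_space_distr) auto
qed

lemma sets_torus_uniform [measurable_cong, simp]: "sets torus_uniform = sets borel"
  by (simp add: torus_uniform_def)

lemma AE_torus_uniform: "AE z in torus_uniform. cmod z = 1"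
proof -
  have "cis \<in> borel_measurable borel"
    by (intro borel_measurable_continuous_onI continuous_intros)
  then show ?thesis
    unfolding torus_uniform_def by (subst AE_distr_iff) auto
qed

lemma borel_measurable_sgn_complex [measurable]: "(sgn :: complex \<Rightarrow> complex) \<in> borel_measurable borel"
  unfolding sgn_div_norm[abs_def] by measurable

lemma borel_measurable_cnj [measurable]: "cnj \<in> borel_measurable borel"
  by (intro borel_measurable_continuous_onI continuous_intros)

lemma borel_measurable_torus_edges:
  assumes "F \<subseteq> I" "f ` F \<subseteq> I"
  shows "(\<lambda>\<epsilon>. \<Sum>r\<in>F. c r * \<epsilon> r * cnj (sgn (\<epsilon> (f r)))) \<in> borel_measurable (PiM I (\<lambda>_. torus_uniform))"
proof (rule borel_measurable_sum)
  have comp: "(\<lambda>\<epsilon>. \<epsilon> r) \<in> borel_measurable (PiM I (\<lambda>_. torus_uniform))" if "r \<in> I" for r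
    using measurable_component_singleton[OF that, of "\<lambda>_. torus_uniform"]
    by (simp add: measurable_cong_sets[OF refl sets_torus_uniform])
  fix r assume "r \<in> F"
  then have [measurable]: "(\<lambda>\<epsilon>. \<epsilon> r) \<in> borel_measurable (PiM I (\<lambda>_. torus_uniform))"
    "(\<lambda>\<epsilon>. \<epsilon> (f r)) \<in> borel_measurable (PiM I (\<lambda>_. torus_uniform))"
    using assms by (auto intro!: comp)
  show "(\<lambda>\<epsilon>. c r * \<epsilon> r * cnj (sgn (\<epsilon> (f r)))) \<in> borel_measurable (PiM I (\<lambda>_. torus_uniform))"
    by measurable
qed

text \<open>The products \<open>\<epsilon> q * cnj (\<epsilon> (f q))\<close> behave like independent uniform phases when the
  directed edges \<open>q \<rightarrow> f q\<close> contain no cycle: some \<open>\<epsilon> q\<close> then occurs in a single product.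
  Writing \<open>sgn\<close> makes the bound valid off the null set where the entries leave the torus.\<close>

lemma torus_edges_mgf:
  fixes f :: "'i \<Rightarrow> 'i"
  assumes "finite I" "F \<subseteq> I" "f ` F \<subseteq> I"
    and "\<And>G. G \<subseteq> F \<Longrightarrow> G \<noteq> {} \<Longrightarrow> \<exists>q\<in>G. q \<notin> f ` G"
  shows "(\<integral>\<^sup>+\<epsilon>. ennreal (exp (Re (\<Sum>q\<in>F. c q * \<epsilon> q * cnj (sgn (\<epsilon> (f q)))))) \<partial>PiM I (\<lambda>_. torus_uniform))
    \<le> ennreal (exp ((\<Sum>q\<in>F. (cmod (c q))\<^sup>2) / 4))"
proof -
  interpret torus_product: product_sigma_finite "\<lambda>_ :: 'i. torus_uniform"
    by (intro product_sigma_finite.intro prob_space_imp_sigma_finite prob_space_torus_uniform)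
  have "finite F" using assms finite_subset by blast
  then show ?thesis using assms
  proof (induction "card F" arbitrary: F I)
    case 0
    interpret P: prob_space "PiM I (\<lambda>_. torus_uniform)" by (intro prob_space_PiM prob_space_torus_uniform)
    show ?case using 0 by (simp add: P.emeasure_space_1)
  next
    case (Suc m)
    \<comment> \<open>No edge ends in q, so \<open>\<epsilon> q\<close> occurs only in its own
      summand; integrating it out first removes that summand at the cost of one exponential
      factor.\<close>
    obtain q where q: "q \<in> F" "q \<notin> f ` F" using Suc.prems(5)[of F] Suc.hyps(2) by (metis card.empty nat.distinct(1) order_refl)
    define J where "J = I - {q}"
    define F' where "F' = F - {q}"
    have I: "I = insert q J" "q \<notin> J" "finite J" using q Suc.prems by (auto simp: J_def)
    have F: "F = insert q F'" "q \<notin> F'" "finite F'" using q Suc.prems by (auto simp: F'_def)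
    have fq: "f q \<noteq> q" using q by (metis imageI)
    then have fF': "f ` F' \<subseteq> J" "f q \<in> J" "F' \<subseteq> J" "f q \<in> I" using q Suc.prems by (auto simp: F'_def J_def)
    define E where "E G \<epsilon> = ennreal (exp (Re (\<Sum>r\<in>G. c r * \<epsilon> r * cnj (sgn (\<epsilon> (f r))))))" for G \<epsilon>
    have E_meas: "E G \<in> borel_measurable (PiM L (\<lambda>_. torus_uniform))" if "G \<subseteq> L" "f ` G \<subseteq> L" for G L
      using borel_measurable_torus_edges[OF that, of c] unfolding E_def by measurable
    have "(\<integral>\<^sup>+\<epsilon>. E F \<epsilon> \<partial>PiM I (\<lambda>_. torus_uniform))
       = (\<integral>\<^sup>+\<epsilon>. \<integral>\<^sup>+y. E F (\<epsilon>(q := y)) \<partial>torus_uniform \<partial>PiM J (\<lambda>_. torus_uniform))"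
      unfolding I(1) using E_meas[of F I] Suc.prems I
      by (intro torus_product.product_nn_integral_insert) auto
    also have "\<dots> \<le> (\<integral>\<^sup>+\<epsilon>. E F' \<epsilon> * ennreal (exp ((cmod (c q))\<^sup>2 / 4)) \<partial>PiM J (\<lambda>_. torus_uniform))"
    proof (rule nn_integral_mono)
      fix \<epsilon> :: "'i \<Rightarrow> complex"
      define a where "a = c q * cnj (sgn (\<epsilon> (f q)))"
      have "E F (\<epsilon>(q := y)) = E F' \<epsilon> * ennreal (exp (Re (a * y)))" for y
      proof -
        have "(\<Sum>r\<in>F'. c r * (\<epsilon>(q := y)) r * cnj (sgn ((\<epsilon>(q := y)) (f r)))) = (\<Sum>r\<in>F'. c r * \<epsilon> r * cnj (sgn (\<epsilon> (f r))))"
        proof (rule sum.cong[OF refl])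
          fix r assume "r \<in> F'"
          then have "r \<noteq> q" "f r \<noteq> q" using F q by auto
          then show "c r * (\<epsilon>(q := y)) r * cnj (sgn ((\<epsilon>(q := y)) (f r))) = c r * \<epsilon> r * cnj (sgn (\<epsilon> (f r)))" by simp
        qed
        moreover have "c q * (\<epsilon>(q := y)) q * cnj (sgn ((\<epsilon>(q := y)) (f q))) = a * y"
          using fq by (simp add: a_def)
        ultimately have "(\<Sum>r\<in>F. c r * (\<epsilon>(q := y)) r * cnj (sgn ((\<epsilon>(q := y)) (f r))))
            = a * y + (\<Sum>r\<in>F'. c r * \<epsilon> r * cnj (sgn (\<epsilon> (f r))))"
          unfolding F(1) by (simp only: sum.insert[OF F(3,2)])
        then show ?thesis
          by (simp add: E_def exp_add ennreal_mult mult.commute del: times_complex.sel fun_upd_apply)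
      qed
      then have "(\<integral>\<^sup>+y. E F (\<epsilon>(q := y)) \<partial>torus_uniform) = (\<integral>\<^sup>+y. E F' \<epsilon> * ennreal (exp (Re (a * y))) \<partial>torus_uniform)"
        by simp
      also have "\<dots> = E F' \<epsilon> * (\<integral>\<^sup>+y. ennreal (exp (Re (a * y))) \<partial>torus_uniform)"
        by (intro nn_integral_cmult measurable_compose[OF _ measurable_ennreal])
           (simp add: measurable_cong_sets[OF sets_torus_uniform refl] borel_measurable_continuous_onI continuous_intros del: times_complex.sel)
      also have "\<dots> \<le> E F' \<epsilon> * ennreal (exp ((cmod a)\<^sup>2 / 4))"
        by (intro mult_left_mono torus_uniform_mgf) auto
      also have "\<dots> \<le> E F' \<epsilon> * ennreal (exp ((cmod (c q))\<^sup>2 / 4))"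
      proof -
        have "cmod a \<le> cmod (c q)" by (simp add: a_def norm_mult norm_sgn mult_left_le)
        then have "(cmod a)\<^sup>2 \<le> (cmod (c q))\<^sup>2" by (intro power_mono) auto
        then show ?thesis by (intro mult_left_mono ennreal_leI) auto
      qed
      finally show "(\<integral>\<^sup>+y. E F (\<epsilon>(q := y)) \<partial>torus_uniform) \<le> E F' \<epsilon> * ennreal (exp ((cmod (c q))\<^sup>2 / 4))" .
    qed
    also have "\<dots> = (\<integral>\<^sup>+\<epsilon>. E F' \<epsilon> \<partial>PiM J (\<lambda>_. torus_uniform)) * ennreal (exp ((cmod (c q))\<^sup>2 / 4))"
      using E_meas[OF fF'(3,1)] by (rule nn_integral_multc)
    also have "\<dots> \<le> ennreal (exp ((\<Sum>q\<in>F'. (cmod (c q))\<^sup>2) / 4)) * ennreal (exp ((cmod (c q))\<^sup>2 / 4))"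
    proof (intro mult_right_mono)
      have "m = card F'" using Suc.hyps(2) F by simp
      moreover have "\<exists>q\<in>G. q \<notin> f ` G" if "G \<subseteq> F'" "G \<noteq> {}" for G
        using that Suc.prems(5) by (auto simp: F'_def)
      ultimately show "(\<integral>\<^sup>+\<epsilon>. E F' \<epsilon> \<partial>PiM J (\<lambda>_. torus_uniform)) \<le> ennreal (exp ((\<Sum>q\<in>F'. (cmod (c q))\<^sup>2) / 4))"
        unfolding E_def by (intro Suc.hyps(1) F fF' I)
    qed auto
    also have "\<dots> = ennreal (exp ((\<Sum>q\<in>F. (cmod (c q))\<^sup>2) / 4))"
      unfolding F(1) using F(2,3) by (simp add: ennreal_mult[symmetric] exp_add[symmetric] add_divide_distrib add.commute)
    finally show ?case by (simp only: E_def)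
  qed
qed

lemma torus_edges_tail:
  fixes f :: "'i \<Rightarrow> 'i"
  assumes I: "finite I" "F \<subseteq> I" "f ` F \<subseteq> I"
    and acyclic: "\<And>G. G \<subseteq> F \<Longrightarrow> G \<noteq> {} \<Longrightarrow> \<exists>q\<in>G. q \<notin> f ` G"
    and c: "\<And>q. q \<in> F \<Longrightarrow> cmod (c q) = 1" and F: "F \<noteq> {}" and u: "u \<ge> 0"
  shows "measure (PiM I (\<lambda>_. torus_uniform)) {\<epsilon> \<in> space (PiM I (\<lambda>_. torus_uniform)).
      u \<le> cmod (\<Sum>q\<in>F. c q * \<epsilon> q * cnj (sgn (\<epsilon> (f q))))} \<le> 6 * exp (- (3/4) * u\<^sup>2 / real (card F))"
proof -
  interpret P: prob_space "PiM I (\<lambda>_. torus_uniform)" by (intro prob_space_PiM prob_space_torus_uniform)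
  have finF: "finite F" using I finite_subset by blast
  show ?thesis
  proof (rule P.steinhaus_tail[OF _ _ _ u])
    show "(\<lambda>\<epsilon>. \<Sum>q\<in>F. c q * \<epsilon> q * cnj (sgn (\<epsilon> (f q)))) \<in> borel_measurable (PiM I (\<lambda>_. torus_uniform))"
      using I(2,3) by (rule borel_measurable_torus_edges)
    show "0 < real (card F)" using F finF by (simp add: card_gt_0_iff)
    fix d
    have "(\<Sum>q\<in>F. (cmod (d * c q))\<^sup>2) = (cmod d)\<^sup>2 * real (card F)"
      using c by (simp add: norm_mult mult.commute)
    then show "(\<integral>\<^sup>+\<epsilon>. ennreal (exp (Re (d * (\<Sum>q\<in>F. c q * \<epsilon> q * cnj (sgn (\<epsilon> (f q))))))) \<partial>PiM I (\<lambda>_. torus_uniform))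
        \<le> ennreal (exp ((cmod d)\<^sup>2 * real (card F) / 4))"
      using torus_edges_mgf[OF I acyclic, of "\<lambda>q. d * c q"] by (simp add: sum_distrib_left mult.assoc del: times_complex.sel)
  qed
qed

text \<open>A nonempty G inside its own shifted image is invariant under the shift, hence by Bezout
  under the shift by d = gcd(s, n), a proper divisor of n and so at most n/2. Shift the largest
  element of G by d: without wrapping the maximum is exceeded; with wrapping the result is below
  n/2, outside the upper half. In the lower half no wrapping can occur.\<close>

lemma half_shift_acyclic:
  fixes n s :: nat
  assumes n: "even n" and s: "0 < s" "s < n" and F: "F \<subseteq> {..<n div 2} \<or> F \<subseteq> {n div 2..<n}"
    and G: "G \<subseteq> F" "G \<noteq> {}"
  shows "\<exists>q\<in>G. q \<notin> (\<lambda>q. (q + s) mod n) ` G"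
proof (rule ccontr)
  assume "\<not> ?thesis"
  then have sub: "G \<subseteq> (\<lambda>q. (q + s) mod n) ` G" by blast
  have Gn: "q < n" if "q \<in> G" for q
  proof -
    have "q < n div 2 \<or> q < n"
      using F G(1) that by (meson atLeastLessThan_iff lessThan_iff subsetD)
    moreover have "n div 2 \<le> n" by simp
    ultimately show ?thesis by linarith
  qed
  then have fin: "finite G" by (intro finite_subset[of G "{..<n}"]) auto
  have closed: "(\<lambda>q. (q + s) mod n) ` G = G"
    using card_seteq[OF finite_imageI[OF fin] sub card_image_le[OF fin]] by (rule sym)
  have iter: "(q + s * x) mod n \<in> G" if "q \<in> G" for q x
  proof (induction x)
    case 0
    show ?case using that Gn[OF that] by simp
  next
    case (Suc x)
    have "((q + s * x) mod n + s) mod n \<in> G" using closed Suc.IH by blast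
    then show ?case unfolding mod_add_left_eq by (simp add: algebra_simps)
  qed
  define d where "d = gcd s n"
  obtain x y where xy: "s * x = n * y + d" using bezout_nat[of s n] s by (auto simp: d_def)
  have d: "0 < d" "d \<le> n div 2"
  proof -
    show "0 < d" using s by (simp add: d_def)
    obtain e where e: "n = d * e" unfolding d_def by (meson dvdE gcd_dvd2)
    have "d \<le> s" using s by (simp add: d_def gcd_le1_nat)
    have "e \<noteq> 0" using e s by (cases e) auto
    moreover have "e \<noteq> 1" using e s \<open>d \<le> s\<close> by auto
    ultimately have "2 \<le> e" by simp
    then have "d * 2 \<le> n" unfolding e by (rule mult_le_mono2)
    then show "d \<le> n div 2" by simp
  qed
  define q where "q = Max G"
  have q: "q \<in> G" "\<And>r. r \<in> G \<Longrightarrow> r \<le> q" using fin G by (auto simp: q_def)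
  have "(q + d) mod n = (q + s * x) mod n" by (simp add: xy) (metis add.left_commute mod_mult_self4)
  then have mem: "(q + d) mod n \<in> G" using iter[OF q(1), of x] by simp
  have qn: "q < n" by (rule Gn[OF q(1)])
  show False
  proof (cases "q + d < n")
    case True
    then show False using q(2)[OF mem] d by simp
  next
    case False
    then have r: "(q + d) mod n = q + d - n" using qn d by (simp add: mod_if)
    have "q + d < n" if "q < n div 2" using that d by linarith
    then have "\<not> F \<subseteq> {..<n div 2}" using False q(1) G(1) by (meson lessThan_iff subsetD)
    then have "F \<subseteq> {n div 2..<n}" using F by blast
    then have "n div 2 \<le> q + d - n" using mem G(1) unfolding r by (meson atLeastLessThan_iff subsetD)
    then show False using qn d by linarith
  qed
qed

text \<open>The part over F of a Gram entry with modulation offset m and translation offset s, up to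
  phase and scaling. On the torus \<open>sgn\<close> changes nothing; it is there to match the edge
  products whose tails are controlled.\<close>

definition twisted_corr :: "nat \<Rightarrow> int \<Rightarrow> nat \<Rightarrow> (nat \<Rightarrow> complex) \<Rightarrow> nat set \<Rightarrow> complex" where
  "twisted_corr n m s \<epsilon> F = (\<Sum>q\<in>F. unit_root n (m * int q) * \<epsilon> q * cnj (sgn (\<epsilon> ((q + s) mod n))))"

text \<open>Shifting the summation index by p' shows that the modulus depends only on the two
  offsets modulo n, so the union bound runs over about n^2 events instead of n^4. The expression
  \<open>p + (n - p')\<close> is p - p' modulo n, free of truncation.\<close>

lemma gram_scaled_window:
  fixes l l' :: nat
  assumes n: "n > 0" and \<epsilon>: "\<And>q. q < n \<Longrightarrow> cmod (\<epsilon> q) = 1" and p: "p < n" and p': "p' < n"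
  defines "m \<equiv> (int l' - int l) mod int n" and "s \<equiv> (p + (n - p')) mod n"
  shows "cmod (gram n (scaled_window n \<epsilon>) (l, p) (l', p')) = cmod (twisted_corr n m s \<epsilon> {..<n}) / real n"
proof -
  define H where "H = periodic_ext n \<epsilon>"
  define f where "f z = unit_root n (m * z) * (H z * cnj (H (z + int s)))" for z
  have Hper: "H a = H b" if "a mod int n = b mod int n" for a b
    unfolding H_def by (rule periodic_ext_cong[OF that])
  have per: "f (z + int n) = f z" for z
  proof -
    have "unit_root n (m * (z + int n)) = unit_root n (m * z)"
      using unit_root_periodic[OF n, of "m * int n" "m * z"] by (simp add: distrib_left)
    moreover have "H (z + int n) = H z" by (rule Hper) simp
    moreover have "H (z + int n + int s) = H (z + int s)"
      by (rule Hper) (metis add.assoc add.commute mod_add_self2)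
    ultimately show ?thesis by (simp add: f_def)
  qed
  have ext: "periodic_ext n (scaled_window n \<epsilon>) z = H z / sqrt (real n)" for z
    by (simp add: periodic_ext_def scaled_window_def H_def)
  have "gram n (scaled_window n \<epsilon>) (l, p) (l', p')
      = (\<Sum>q<n. unit_root n (- (m * int p')) * f (int q + int p') / real n)"
    unfolding gram_eq ext
  proof (intro sum.cong refl)
    fix q
    have "unit_root n ((int l' - int l) * int q) = unit_root n (m * int q)"
      by (rule unit_root_cong[OF n]) (simp add: m_def mod_mult_left_eq)
    also have "\<dots> = unit_root n (- (m * int p')) * unit_root n (m * (int q + int p'))"
      by (simp add: unit_root_add[symmetric] algebra_simps)
    finally have e: "unit_root n ((int l' - int l) * int q) = unit_root n (- (m * int p')) * unit_root n (m * (int q + int p'))" .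
    have "(int q + int p' + int s) mod int n = (int q + int p' + (int p + (int n - int p'))) mod int n"
      using p' by (simp add: s_def of_nat_mod mod_add_right_eq)
    also have "\<dots> = (int p + int q) mod int n" by (simp add: algebra_simps)
    finally have "H (int q + int p' + int s) = H (int p + int q)" by (rule Hper)
    moreover have "complex_of_real (sqrt (real n)) * complex_of_real (sqrt (real n)) = of_nat n"
      by (simp flip: of_real_mult)
    ultimately show "unit_root n ((int l' - int l) * int q) *
          (H (int p' + int q) / sqrt (real n) * cnj (H (int p + int q) / sqrt (real n)))
        = unit_root n (- (m * int p')) * f (int q + int p') / real n"
      unfolding e f_def by (simp add: add.commute[of "int p'"])
  qed
  also have "\<dots> = unit_root n (- (m * int p')) * (\<Sum>q<n. f (int q + int p')) / real n"
    by (simp add: sum_distrib_left sum_divide_distrib)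
  also have "(\<Sum>q<n. f (int q + int p')) = (\<Sum>q<n. f (int q))" by (rule sum_periodic_shift[where f = f, OF per])
  also have "\<dots> = twisted_corr n m s \<epsilon> {..<n}"
    unfolding twisted_corr_def
  proof (intro sum.cong refl)
    fix q assume "q \<in> {..<n}"
    then have "H (int q) = \<epsilon> q" by (simp add: H_def periodic_ext_def)
    moreover have "H (int q + int s) = \<epsilon> ((q + s) mod n)"
      by (simp add: H_def periodic_ext_def flip: of_nat_add of_nat_mod)
    moreover have "sgn (\<epsilon> ((q + s) mod n)) = \<epsilon> ((q + s) mod n)"
      using \<epsilon>[of "(q + s) mod n"] n by (simp add: sgn_div_norm)
    ultimately show "f (int q) = unit_root n (m * int q) * \<epsilon> q * cnj (sgn (\<epsilon> ((q + s) mod n)))"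
      by (simp add: f_def mult.assoc)
  qed
  finally show ?thesis by (simp add: norm_mult norm_divide)
qed

lemma twisted_corr_0:
  assumes n: "n > 0" and \<epsilon>: "\<And>q. q < n \<Longrightarrow> cmod (\<epsilon> q) = 1" and m: "\<not> int n dvd m"
  shows "twisted_corr n m 0 \<epsilon> {..<n} = 0"
proof -
  have "unit_root n (m * int q) * \<epsilon> q * cnj (sgn (\<epsilon> ((q + 0) mod n))) = unit_root n (m * int q)" if "q < n" for q
    using \<epsilon>[OF that] that complex_norm_square[of "\<epsilon> q"] by (simp add: sgn_div_norm mult.assoc)
  then have "twisted_corr n m 0 \<epsilon> {..<n} = (\<Sum>q<n. unit_root n (m * int q))"
    unfolding twisted_corr_def by (intro sum.cong refl) auto
  then show ?thesis using sum_unit_root[OF n, of m] m by simp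
qed

lemma twisted_corr_half_tail:
  assumes n: "even n" and s: "0 < s" "s < n" and F: "F = {..<n div 2} \<or> F = {n div 2..<n}" and \<alpha>: "\<alpha> \<ge> 0"
  shows "measure (PiM {..<n} (\<lambda>_. torus_uniform)) {\<epsilon> \<in> space (PiM {..<n} (\<lambda>_. torus_uniform)).
      \<alpha> * real n / 2 \<le> cmod (twisted_corr n m s \<epsilon> F)} \<le> 6 * exp (- (3/8) * (real n * \<alpha>\<^sup>2))"
proof -
  have half: "real (n div 2) = real n / 2" using n by (simp add: real_of_nat_div)
  have card: "real (card F) = real n / 2"
    using F n half by (auto elim!: evenE)
  have n0: "n > 0" using s by simp
  have ne: "F \<noteq> {}" using card n0 by auto
  have sub: "F \<subseteq> {..<n}" using F by (auto intro: less_le_trans)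
  have "measure (PiM {..<n} (\<lambda>_. torus_uniform)) {\<epsilon> \<in> space (PiM {..<n} (\<lambda>_. torus_uniform)).
      \<alpha> * real n / 2 \<le> cmod (\<Sum>q\<in>F. unit_root n (m * int q) * \<epsilon> q * cnj (sgn (\<epsilon> ((q + s) mod n))))}
    \<le> 6 * exp (- (3/4) * (\<alpha> * real n / 2)\<^sup>2 / real (card F))"
  proof (rule torus_edges_tail)
    show "(\<lambda>q. (q + s) mod n) ` F \<subseteq> {..<n}" using n0 by auto
    show "\<exists>q\<in>G. q \<notin> (\<lambda>q. (q + s) mod n) ` G" if "G \<subseteq> F" "G \<noteq> {}" for G
      using half_shift_acyclic[OF n s _ that] F by blast
  qed (use sub ne \<alpha> in auto)
  also have "- (3/4) * (\<alpha> * real n / 2)\<^sup>2 / real (card F) = - (3/8) * (real n * \<alpha>\<^sup>2)"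
    unfolding card using n0 by (simp add: power2_eq_square field_simps)
  finally show ?thesis by (simp only: twisted_corr_def)
qed

definition coherent_window :: "nat \<Rightarrow> real \<Rightarrow> (nat \<Rightarrow> complex) \<Rightarrow> bool" where
  "coherent_window n \<mu> \<epsilon> \<longleftrightarrow> (\<forall>q<n. cmod (\<epsilon> q) = 1) \<and>
     (\<forall>i\<in>tf_grid n. \<forall>j\<in>tf_grid n. i \<noteq> j \<longrightarrow> cmod (gram n (scaled_window n \<epsilon>) i j) \<le> \<mu>)"

lemma AE_torus_product:
  fixes n :: nat
  shows "AE \<epsilon> in PiM {..<n} (\<lambda>_. torus_uniform). \<forall>q<n. cmod (\<epsilon> q) = 1"
proof -
  have "AE \<epsilon> in PiM {..<n} (\<lambda>_. torus_uniform). cmod (\<epsilon> q) = 1" if "q < n" for q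
    by (rule AE_PiM_component[where P = "\<lambda>z. cmod z = 1"])
       (use that prob_space_torus_uniform AE_torus_uniform in auto)
  then have "AE \<epsilon> in PiM {..<n} (\<lambda>_. torus_uniform). \<forall>q\<in>{..<n}. cmod (\<epsilon> q) = 1"
    by (intro AE_finite_allI) auto
  then show ?thesis by (rule eventually_mono) auto
qed

text \<open>A union bound over the offsets with s nonzero and over the two halves of the index
  range, each half being allowed half of the threshold. Halving removes the cycles of the shift and
  costs a factor 2 in the exponent: 3/8 in place of 3/4. The null set where the window is not
  unimodular is put into B.\<close>

lemma random_window_coherence:
  assumes n: "even n" "n > 0" and \<alpha>: "\<alpha> \<ge> 0"
  obtains B where "B \<in> sets (PiM {..<n} (\<lambda>_. torus_uniform))"
    "measure (PiM {..<n} (\<lambda>_. torus_uniform)) B \<le> 12 * (real n)\<^sup>2 * exp (- (3/8) * (real n * \<alpha>\<^sup>2))"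
    "\<And>\<epsilon>. \<epsilon> \<in> space (PiM {..<n} (\<lambda>_. torus_uniform)) \<Longrightarrow> \<epsilon> \<notin> B \<Longrightarrow> coherent_window n \<alpha> \<epsilon>"
proof -
  define P where "P = PiM {..<n} (\<lambda>_. torus_uniform)"
  interpret P: prob_space P unfolding P_def by (intro prob_space_PiM prob_space_torus_uniform)
  obtain N where N: "N \<in> null_sets P" "{\<epsilon> \<in> space P. \<not> (\<forall>q<n. cmod (\<epsilon> q) = 1)} \<subseteq> N"
    using AE_torus_product[of n] unfolding P_def[symmetric] by (auto elim!: AE_E simp: null_sets_def)
  define A where "A m s F = {\<epsilon> \<in> space P. \<alpha> * real n / 2 \<le> cmod (twisted_corr n (int m) s \<epsilon> F)}" for m s F
  define Fs where "Fs = {{..<n div 2}, {n div 2..<n}}"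
  define Z where "Z = {..<n} \<times> {1..<n} \<times> Fs"
  define B where "B = N \<union> (\<Union>(m, s, F)\<in>Z. A m s F)"
  have corr_meas: "(\<lambda>\<epsilon>. twisted_corr n m s \<epsilon> F) \<in> borel_measurable P" if "F \<subseteq> {..<n}" for m s F
    unfolding twisted_corr_def P_def using that n by (intro borel_measurable_torus_edges) auto
  have Fs_sub: "F \<subseteq> {..<n}" if "F \<in> Fs" for F using that by (auto simp: Fs_def intro: less_le_trans)
  have A_sets: "A m s F \<in> sets P" if "(m, s, F) \<in> Z" for m s F
  proof -
    have "F \<in> Fs" using that by (simp add: Z_def)
    then have [measurable]: "(\<lambda>\<epsilon>. twisted_corr n (int m) s \<epsilon> F) \<in> borel_measurable P"
      by (intro corr_meas Fs_sub)
    show ?thesis unfolding A_def by measurable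
  qed
  have B_sets: "B \<in> sets P" using N A_sets by (auto simp: B_def Z_def Fs_def null_sets_def intro!: sets.Un sets.finite_UN)
  have "measure P B \<le> measure P N + measure P (\<Union>(m, s, F)\<in>Z. A m s F)"
    unfolding B_def using N A_sets by (intro measure_Un_le) (auto simp: Z_def Fs_def intro!: sets.finite_UN)
  also have "measure P N = 0" using N by (simp add: null_sets_def measure_def)
  also have "measure P (\<Union>(m, s, F)\<in>Z. A m s F) \<le> (\<Sum>z\<in>Z. measure P (case z of (m, s, F) \<Rightarrow> A m s F))"
    using A_sets by (intro P.finite_measure_subadditive_finite) (auto simp: Z_def Fs_def)
  also have "\<dots> \<le> (\<Sum>z\<in>Z. 6 * exp (- (3/8) * (real n * \<alpha>\<^sup>2)))"
  proof (intro sum_mono)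
    fix z assume "z \<in> Z"
    then obtain m s F where "z = (m, s, F)" "0 < s" "s < n" "F = {..<n div 2} \<or> F = {n div 2..<n}"
      by (auto simp: Z_def Fs_def)
    then show "measure P (case z of (m, s, F) \<Rightarrow> A m s F) \<le> 6 * exp (- (3/8) * (real n * \<alpha>\<^sup>2))"
      using twisted_corr_half_tail[OF n(1) _ _ _ \<alpha>] by (simp add: A_def P_def)
  qed
  also have "\<dots> = real (card Z) * (6 * exp (- (3/8) * (real n * \<alpha>\<^sup>2)))" by simp
  also have "\<dots> \<le> (2 * (real n)\<^sup>2) * (6 * exp (- (3/8) * (real n * \<alpha>\<^sup>2)))"
  proof (intro mult_right_mono)
    have "card Fs \<le> 2" unfolding Fs_def by (intro order_trans[OF card_insert_le_m1]) auto
    then have "card Z \<le> n * (n * 2)"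
      by (auto simp: Z_def card_cartesian_product intro!: mult_le_mono)
    then have "real (card Z) \<le> real (n * (n * 2))" by (rule of_nat_mono)
    then show "real (card Z) \<le> 2 * (real n)\<^sup>2" by (simp add: power2_eq_square)
  qed simp
  finally have meas_B: "measure P B \<le> 12 * (real n)\<^sup>2 * exp (- (3/8) * (real n * \<alpha>\<^sup>2))" by simp
  have good: "coherent_window n \<alpha> \<epsilon>" if \<epsilon>: "\<epsilon> \<in> space P" "\<epsilon> \<notin> B" for \<epsilon>
  proof -
    have one: "cmod (\<epsilon> q) = 1" if "q < n" for q
      using \<epsilon> N(2) that by (auto simp: B_def)
    have "cmod (gram n (scaled_window n \<epsilon>) i j) \<le> \<alpha>" if ij: "i \<in> tf_grid n" "j \<in> tf_grid n" "i \<noteq> j" for i j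
    proof -
      obtain l p l' p' where eq: "i = (l, p)" "j = (l', p')" by (cases i, cases j)
      have lt: "l < n" "p < n" "l' < n" "p' < n" using ij by (auto simp: eq tf_grid_def)
      define m where "m = nat ((int l' - int l) mod int n)"
      define s where "s = (p + (n - p')) mod n"
      have m: "int m = (int l' - int l) mod int n" "m < n" using n by (simp_all add: m_def nat_less_iff)
      have gram: "cmod (gram n (scaled_window n \<epsilon>) i j) = cmod (twisted_corr n (int m) s \<epsilon> {..<n}) / real n"
        unfolding eq m(1) s_def by (rule gram_scaled_window[OF n(2) one lt(2,4)])
      show ?thesis
      proof (cases "s = 0")
        case True
        have "p = p'"
        proof (cases "p' \<le> p")
          case True
          then have "s = (p - p')" using lt by (simp add: s_def mod_if)
          then show ?thesis using \<open>s = 0\<close> True by simp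
        next
          case False
          then have "s = p + (n - p')" using lt by (simp add: s_def)
          then show ?thesis using \<open>s = 0\<close> lt by simp
        qed
        then have "l \<noteq> l'" using ij eq by auto
        have "\<not> int n dvd int m"
        proof
          assume "int n dvd int m"
          then have "int l' mod int n = int l mod int n"
            unfolding m(1) by (simp add: mod_eq_dvd_iff dvd_mod_iff)
          then show False using lt \<open>l \<noteq> l'\<close> by simp
        qed
        then have "twisted_corr n (int m) s \<epsilon> {..<n} = 0" unfolding True by (intro twisted_corr_0 n one)
        then show ?thesis using \<alpha> by (simp add: gram)
      next
        case False
        then have s: "s \<in> {1..<n}" using n by (simp add: s_def)
        have small: "cmod (twisted_corr n (int m) s \<epsilon> F) \<le> \<alpha> * real n / 2" if "F \<in> Fs" for F
        proof (rule ccontr)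
          assume "\<not> ?thesis"
          then have "\<epsilon> \<in> A m s F" using \<epsilon>(1) by (simp add: A_def)
          moreover have "(m, s, F) \<in> Z" using m s that by (simp add: Z_def)
          ultimately show False using \<epsilon>(2) by (auto simp: B_def)
        qed
        have split: "{..<n} = {..<n div 2} \<union> {n div 2..<n}" by auto
        have "twisted_corr n (int m) s \<epsilon> {..<n} = twisted_corr n (int m) s \<epsilon> {..<n div 2} + twisted_corr n (int m) s \<epsilon> {n div 2..<n}"
          unfolding twisted_corr_def by (subst split, rule sum.union_disjoint) auto
        also have "cmod \<dots> \<le> \<alpha> * real n / 2 + \<alpha> * real n / 2"
          by (intro order_trans[OF norm_triangle_ineq] add_mono small) (simp_all add: Fs_def)
        finally show ?thesis using n by (simp add: gram field_simps)
      qed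
    qed
    then show ?thesis using one by (auto simp: coherent_window_def)
  qed
  show thesis using that B_sets meas_B good by (simp add: P_def)
qed

section \<open>Probability of recovery\<close>

text \<open>The parameters are \<open>a = 3/10\<close>, \<open>d = 1/2\<close>,
  \<open>R = 1 / V\<close>, and l is V / 8 rounded down. The exponent of the merging loss is then at
  most 3, so the loss is at most 27, and 390 is 27 * (13/10) / (3/10)^2.\<close>

lemma (in tight_gram) ill_conditioned_proportion:
  assumes k: "k \<ge> 1" and card: "card I = n\<^sup>2" and T: "T = real n" and n: "390 * real k \<le> real n"
    and V: "V > 0" "real k * \<mu>\<^sup>2 * V \<le> 1"
  shows "real (card {S. S \<subseteq> I \<and> card S = k \<and> \<not> well_conditioned (1/2) S})
    \<le> real (card I choose k) * (real k * exp (- V / 8))"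
proof -
  define K where "K = k - 1"
  have kK: "k = Suc K" using k by (simp add: K_def)
  define l where "l = nat \<lfloor>V / 8\<rfloor>"
  have l: "real l \<le> V / 8" "V / 8 \<le> real (Suc l)"
  proof -
    have "real l = real_of_int \<lfloor>V / 8\<rfloor>" using V by (simp add: l_def)
    then show "real l \<le> V / 8" "V / 8 \<le> real (Suc l)" unfolding of_nat_Suc by linarith+
  qed
  define R where "R = 1 / V"
  have R: "real K * \<mu>\<^sup>2 \<le> R"
  proof -
    have "real K * \<mu>\<^sup>2 \<le> real k * \<mu>\<^sup>2" by (intro mult_right_mono) (auto simp: kK)
    also have "\<dots> \<le> R" using V by (simp add: R_def field_simps)
    finally show ?thesis .
  qed
  have n_pos: "real n \<ge> 390" using n of_nat_mono[OF k, where 'a = real] by simp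
  have Kn: "390 * real K + 390 \<le> real n" using n by (simp add: kK algebra_simps)
  have nn: "real n \<le> (real n)\<^sup>2" using n_pos by (simp add: power2_eq_square)
  have "R / (3/10)\<^sup>2 * real (2 * l) \<le> 3"
  proof -
    have "real l * R \<le> V / 8 * R" using l V by (intro mult_right_mono) (auto simp: R_def)
    then have "real l * R \<le> 1 / 8" using V by (simp add: R_def)
    then show ?thesis by (simp add: power2_eq_square mult.commute[of R])
  qed
  have "(1 + R / (3/10)\<^sup>2) ^ (2 * l) \<le> exp (R / (3/10)\<^sup>2) ^ (2 * l)"
    using V by (intro power_mono exp_ge_add_one_self) (auto simp: R_def)
  also have "\<dots> = exp (R / (3/10)\<^sup>2 * real (2 * l))" by (simp add: exp_of_nat_mult[symmetric] mult.commute)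
  also have "\<dots> \<le> exp 3" using \<open>R / (3/10)\<^sup>2 * real (2 * l) \<le> 3\<close> by simp
  also have "exp 3 = exp (1::real) ^ 3" by (simp add: exp_of_nat_mult[symmetric])
  also have "\<dots> \<le> 3 ^ 3" by (intro power_mono exp_le) auto
  finally have pow: "(1 + R / (3/10)\<^sup>2) ^ (2 * l) \<le> 27" by simp
  have "T * real K * (1 + 3/10) * (1 + R / (3/10)\<^sup>2) ^ (2 * l) \<le> T * real K * (1 + 3/10) * 27"
    using T_nonneg by (intro mult_left_mono pow) auto
  also have "\<dots> \<le> (real (card I) - real K) * (3/10)\<^sup>2"
  proof -
    have "real n * (390 * real K) \<le> real n * (real n - 390)" using Kn by (intro mult_left_mono) auto
    also have "\<dots> \<le> (real n)\<^sup>2 - real K" using Kn n_pos by (simp add: power2_eq_square algebra_simps)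
    finally show ?thesis by (simp add: card T power2_eq_square algebra_simps)
  qed
  finally have small: "T * real K * (1 + 3/10) * (1 + R / (3/10)\<^sup>2) ^ (2 * l) \<le> (real (card I) - real K) * (3/10)\<^sup>2" .
  have "real K \<le> real (card I)" using Kn nn n_pos by (simp add: card)
  then have "K \<le> card I" by simp
  from card_ill_conditioned_le[OF _ _ R this small, of "1/2"]
  have "real (card {S. S \<subseteq> I \<and> card S = k \<and> \<not> well_conditioned (1/2) S})
      \<le> real (card I choose k) * real k * (3/10 / (1/2)) ^ (2 * Suc l)"
    by (simp only: kK)
  also have "(3/10 / (1/2)) ^ (2 * Suc l) \<le> exp (- V / 8)"
  proof -
    \<comment> \<open>The squared ratio of a to d is 9/25, below 1 / e, so each order of the moment
      gains a factor e. The order is Suc l, at least V / 8 despite the rounding.\<close>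
    have "exp (1::real) \<le> 25 / 9" using e_less_272 by simp
    then have "9 / 25 \<le> exp (- 1 :: real)" by (simp add: exp_minus field_simps)
    then have "(9 / 25) ^ Suc l \<le> exp (- 1 :: real) ^ Suc l" by (intro power_mono) auto
    also have "\<dots> = exp (- real (Suc l))" by (simp only: exp_of_nat_mult[symmetric]) simp
    also have "\<dots> \<le> exp (- V / 8)" using l by simp
    finally have "(9 / 25) ^ Suc l \<le> exp (- V / 8)" .
    moreover have "(3/10 / (1/2))\<^sup>2 = (9 / 25 :: real)" by (simp add: power2_eq_square)
    ultimately show ?thesis by (simp only: power_mult)
  qed
  finally show ?thesis by (simp add: mult_left_mono mult.assoc)
qed

lemma card_tf_grid: "card (tf_grid n) = n\<^sup>2"
  by (simp add: tf_grid_def power2_eq_square)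

lemma finite_k_subsets [simp]: "finite (k_subsets n k)"
  by (simp add: k_subsets_def)

lemma card_k_subsets: "card (k_subsets n k) = n\<^sup>2 choose k"
  unfolding k_subsets_def using n_subsets[OF finite_tf_grid] by (simp add: card_tf_grid)

text \<open>The failure events are indexed by a support S and an index j, so the coefficients are
  fixed before the phases are drawn. Each event is intersected with the event that the support is S;
  its probability 1 / N cancels the number of supports in the union bound.\<close>

lemma recovery_failure_given_window:
  fixes M :: "'w measure"
  assumes M: "prob_space M" and k: "k \<ge> 1"
    and supp: "uniform_random_support M n k \<Lambda>"
    and arr: "random_array_with_support M n \<Lambda> x"
    and phases: "uniform_random_phases M n \<Lambda> x"
    and n: "390 * real k \<le> real n"
    and h: "\<And>q. q < n \<Longrightarrow> (cmod (h q))\<^sup>2 = 1 / real n" and \<mu>: "\<mu> \<ge> 0"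
    and coh: "\<And>i j. i \<in> tf_grid n \<Longrightarrow> j \<in> tf_grid n \<Longrightarrow> i \<noteq> j \<Longrightarrow> cmod (gram n h i j) \<le> \<mu>"
    and V: "V > 0" "real k * \<mu>\<^sup>2 * V \<le> 1" and \<epsilon>: "0 < \<epsilon>" "\<epsilon> \<le> 1" and VL: "8 * ln (2 * real n ^ 2 / \<epsilon>) \<le> V"
  shows "measure M {\<omega> \<in> space M. bp_fails n h (x \<omega>)} \<le> \<epsilon>"
proof -
  interpret prob_space M by (rule M)
  have n_ge: "real n \<ge> 390" using n of_nat_mono[OF k, where 'a = real] by simp
  then have n0: "n > 0" by (cases n) auto
  have tg: "tight_gram (tf_grid n) (gram n h) (real n) \<mu>"
    by (rule gabor_tight_gram[OF n0 h \<mu> coh])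
  interpret G: tight_gram "tf_grid n" "gram n h" "real n" \<mu> by (rule tg)
  define \<K> where "\<K> = k_subsets n k"
  define N where "N = card \<K>"
  define Bad where "Bad = {S. S \<subseteq> tf_grid n \<and> card S = k \<and> \<not> G.well_conditioned (1/2) S}"
  define Good where "Good = \<K> - Bad"
  have fin_\<K>: "finite \<K>" by (simp add: \<K>_def)
  have Bad_sub: "Bad \<subseteq> \<K>" by (auto simp: Bad_def \<K>_def k_subsets_def)
  have good: "S \<subseteq> tf_grid n" "card S = k" "finite S" "G.well_conditioned (1/2) S" if "S \<in> Good" for S
    using that finite_subset[OF _ finite_tf_grid] by (auto simp: Good_def \<K>_def k_subsets_def Bad_def)
  have \<Lambda>_meas [measurable]: "\<Lambda> \<in> M \<rightarrow>\<^sub>M count_space \<K>"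
    and \<Lambda>_law: "distr M (count_space \<K>) \<Lambda> = uniform_count_measure \<K>"
    using supp by (auto simp: uniform_random_support_def \<K>_def)
  have \<Lambda>_in: "\<Lambda> \<omega> \<in> \<K>" if "\<omega> \<in> space M" for \<omega> using measurable_space[OF \<Lambda>_meas that] by simp
  have \<Lambda>_sets: "{\<omega> \<in> space M. \<Lambda> \<omega> \<in> A} \<in> events" if "A \<subseteq> \<K>" for A
    using measurable_sets[OF \<Lambda>_meas, of A] that by (simp add: vimage_def Int_def conj_commute)
  have \<Lambda>_prob: "prob {\<omega> \<in> space M. \<Lambda> \<omega> \<in> A} = real (card A) / real N" if "A \<subseteq> \<K>" for A
  proof -
    have "prob {\<omega> \<in> space M. \<Lambda> \<omega> \<in> A} = measure (distr M (count_space \<K>) \<Lambda>) A"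
      using that by (subst measure_distr) (auto simp: vimage_def Int_def conj_commute)
    then show ?thesis using that fin_\<K> by (simp add: \<Lambda>_law measure_uniform_count_measure N_def)
  qed
  have N_pos: "real N > 0"
  proof -
    obtain \<omega> where "\<omega> \<in> space M" using not_empty by blast
    then show ?thesis using \<Lambda>_in[of \<omega>] fin_\<K> by (auto simp: N_def card_gt_0_iff)
  qed
  have x_meas: "(\<lambda>\<omega>. x \<omega> i) \<in> borel_measurable M" if "i \<in> tf_grid n" for i
    using arr that by (simp add: random_array_with_support_def)
  have x_supp: "\<Lambda> \<omega> = {i \<in> tf_grid n. x \<omega> i \<noteq> 0}" if "\<omega> \<in> space M" for \<omega>
    using arr that by (simp add: random_array_with_support_def)
  have "\<exists>w. (\<forall>j\<in>tf_grid n - S. \<forall>s\<in>S. w j s + G.app S (w j) s = gram n h s j) \<and>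
      (\<forall>j\<in>tf_grid n - S. (norm_on S (w j))\<^sup>2 \<le> 4 * real k * \<mu>\<^sup>2)" if "S \<in> Good" for S
    using G.dual_coefficients[OF good(1)[OF that] good(4)[OF that]] good(2)[OF that] by metis
  then obtain W where W: "\<And>S j s. S \<in> Good \<Longrightarrow> j \<in> tf_grid n - S \<Longrightarrow> s \<in> S \<Longrightarrow>
        W S j s + G.app S (W S j) s = gram n h s j"
    and W_norm: "\<And>S j. S \<in> Good \<Longrightarrow> j \<in> tf_grid n - S \<Longrightarrow> (norm_on S (W S j))\<^sup>2 \<le> 4 * real k * \<mu>\<^sup>2"
    by metis
  define C where "C S j = {\<omega> \<in> space M. 1 \<le> cmod (\<Sum>i\<in>S. cnj (W S j i) * sgn (x \<omega> i))}" for S j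
  define E where "E S = {\<omega> \<in> space M. \<Lambda> \<omega> = S}" for S
  have sgn_meas: "(\<lambda>\<omega>. sgn (x \<omega> i)) \<in> borel_measurable M" if "i \<in> tf_grid n" for i
    by (rule measurable_compose[OF x_meas[OF that] borel_measurable_sgn_complex])
  have C_sets: "C S j \<in> events" if "S \<in> Good" for S j
  proof -
    have "(\<lambda>\<omega>. \<Sum>i\<in>S. cnj (W S j i) * sgn (x \<omega> i)) \<in> borel_measurable M"
      using good(1)[OF that] sgn_meas by (intro borel_measurable_sum borel_measurable_times borel_measurable_const) auto
    then show ?thesis unfolding C_def by measurable
  qed
  have E_eq: "E S = {\<omega> \<in> space M. \<Lambda> \<omega> \<in> {S}}" for S by (simp add: E_def)
  have E_sets: "E S \<in> events" if "S \<in> \<K>" for S unfolding E_eq using that by (intro \<Lambda>_sets) auto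
  have E_prob: "prob (E S) = 1 / real N" if "S \<in> \<K>" for S unfolding E_eq using that by (subst \<Lambda>_prob) auto
  have cond: "prob (E S \<inter> C S j) \<le> 1 / real N * (6 * exp (- 3 * V / 16))"
    if S: "S \<in> Good" and j: "j \<in> tf_grid n - S" for S j
  proof -
    have SK: "S \<in> \<K>" using S by (simp add: Good_def)
    have posE: "prob (E S) > 0" using E_prob[OF SK] N_pos by simp
    define Q where "Q = uniform_measure M (E S)"
    have E_ne: "emeasure M (E S) \<noteq> 0" using posE by (simp add: emeasure_eq_measure)
    interpret Q: prob_space Q unfolding Q_def using E_ne by (intro prob_space_uniform_measure) auto
    \<comment> \<open>Taking the whole space as the magnitude event conditions on the support
      alone.\<close>
    have eq: "{\<omega> \<in> space M. \<Lambda> \<omega> = S \<and> (\<lambda>i\<in>tf_grid n. cmod (x \<omega> i)) \<in> space (PiM (tf_grid n) (\<lambda>_. borel :: real measure))} = E S"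
      by (auto simp: E_def space_PiM)
    have "Q.indep_vars (\<lambda>_. borel) (\<lambda>i \<omega>. sgn (x \<omega> i)) S \<and>
        (\<forall>i\<in>S. distr Q borel (\<lambda>\<omega>. sgn (x \<omega> i)) = torus_uniform)"
      unfolding Q_def
      by (rule phases[unfolded uniform_random_phases_def Let_def, rule_format, OF sets.top, of S, unfolded eq, OF posE])
    then have ph: "Q.indep_vars (\<lambda>_. borel) (\<lambda>i \<omega>. sgn (x \<omega> i)) S"
      "\<And>i. i \<in> S \<Longrightarrow> distr Q borel (\<lambda>\<omega>. sgn (x \<omega> i)) = torus_uniform"
      by blast+
    \<comment> \<open>The squared coefficient norm is at most 4 / V, which turns the exponent 3/4 of
      the tail into 3 V / 16.\<close>
    have "(\<Sum>i\<in>S. (cmod (cnj (W S j i)))\<^sup>2) = (norm_on S (W S j))\<^sup>2" by (simp add: norm_on_sq)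
    also have "\<dots> \<le> 4 * real k * \<mu>\<^sup>2" by (rule W_norm[OF S j])
    also have "\<dots> \<le> 4 / V" using V by (simp add: field_simps)
    finally have "(\<Sum>i\<in>S. (cmod (cnj (W S j i)))\<^sup>2) \<le> 4 / V" .
    then have "Q.prob {\<omega> \<in> space Q. 1 \<le> cmod (\<Sum>i\<in>S. cnj (W S j i) * sgn (x \<omega> i))} \<le> 6 * exp (- (3/4) * 1\<^sup>2 / (4 / V))"
      using V by (intro Q.steinhaus_sum_tail[OF good(3)[OF S] ph]) auto
    then have "measure Q (C S j) \<le> 6 * exp (- 3 * V / 16)"
      by (simp add: C_def Q_def)
    moreover have "measure Q (C S j) = prob (E S \<inter> C S j) / prob (E S)"
      unfolding Q_def using E_ne C_sets[OF S] by (intro measure_uniform_measure) auto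
    ultimately show ?thesis using posE E_prob[OF SK] by (simp add: field_simps)
  qed
  define BadEv where "BadEv = {\<omega> \<in> space M. \<Lambda> \<omega> \<in> Bad}"
  define Z where "Z = (SIGMA S:Good. tf_grid n - S)"
  have fin_Z: "finite Z" using fin_\<K> by (auto simp: Z_def Good_def)
  have "{\<omega> \<in> space M. bp_fails n h (x \<omega>)} \<subseteq> BadEv \<union> (\<Union>(S, j)\<in>Z. E S \<inter> C S j)"
  proof
    fix \<omega> assume "\<omega> \<in> {\<omega> \<in> space M. bp_fails n h (x \<omega>)}"
    then have \<omega>: "\<omega> \<in> space M" "bp_fails n h (x \<omega>)" by auto
    show "\<omega> \<in> BadEv \<union> (\<Union>(S, j)\<in>Z. E S \<inter> C S j)"
    proof (rule ccontr)
      assume not: "\<omega> \<notin> BadEv \<union> (\<Union>(S, j)\<in>Z. E S \<inter> C S j)"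
      define S where "S = \<Lambda> \<omega>"
      have S: "S \<in> Good" using not \<Lambda>_in[OF \<omega>(1)] \<omega>(1) by (simp add: BadEv_def Good_def S_def)
      have cert: "cmod (\<Sum>i\<in>S. cnj (W S j i) * sgn (x \<omega> i)) < 1" if j: "j \<in> tf_grid n - S" for j
      proof -
        have "(S, j) \<in> Z" using S j by (simp add: Z_def)
        then have "\<omega> \<notin> E S \<inter> C S j" using not by blast
        then show ?thesis using \<omega>(1) by (simp add: E_def C_def S_def not_le)
      qed
      have "bp_recovers n h (tf_operator n S (x \<omega>) h) (x \<omega>)"
        by (rule bp_recovers_dual_certificate[OF tg _ good(4)[OF S] W[OF S] cert]) (simp_all add: S_def x_supp[OF \<omega>(1)])
      then show False using \<omega>(2) bp_recovers_iff_not_fails[OF x_supp[OF \<omega>(1)]] by (simp add: S_def)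
    qed
  qed
  then have "prob {\<omega> \<in> space M. bp_fails n h (x \<omega>)} \<le> prob (BadEv \<union> (\<Union>(S, j)\<in>Z. E S \<inter> C S j))"
    using \<Lambda>_sets[OF Bad_sub] E_sets C_sets fin_Z
    by (intro finite_measure_mono) (auto simp: BadEv_def Z_def Good_def intro!: sets.Un sets.finite_UN)
  also have "\<dots> \<le> prob BadEv + prob (\<Union>(S, j)\<in>Z. E S \<inter> C S j)"
    using \<Lambda>_sets[OF Bad_sub] E_sets C_sets fin_Z
    by (intro measure_Un_le) (auto simp: BadEv_def Z_def Good_def intro!: sets.finite_UN)
  also have "prob BadEv \<le> real k * exp (- V / 8)"
  proof -
    have "real (card Bad) \<le> real N * (real k * exp (- V / 8))"
      unfolding Bad_def N_def \<K>_def card_k_subsets card_tf_grid[symmetric]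
      by (rule G.ill_conditioned_proportion[OF k card_tf_grid refl n V])
    then show ?thesis unfolding BadEv_def \<Lambda>_prob[OF Bad_sub] using N_pos by (simp add: field_simps)
  qed
  also have "prob (\<Union>(S, j)\<in>Z. E S \<inter> C S j) \<le> (\<Sum>z\<in>Z. prob (case z of (S, j) \<Rightarrow> E S \<inter> C S j))"
    using E_sets C_sets fin_Z by (intro finite_measure_subadditive_finite) (auto simp: Z_def Good_def)
  also have "\<dots> \<le> (\<Sum>z\<in>Z. 1 / real N * (6 * exp (- 3 * V / 16)))"
  proof (rule sum_mono)
    fix z assume "z \<in> Z"
    then obtain S j where "z = (S, j)" "S \<in> Good" "j \<in> tf_grid n - S" by (auto simp: Z_def)
    then show "prob (case z of (S, j) \<Rightarrow> E S \<inter> C S j) \<le> 1 / real N * (6 * exp (- 3 * V / 16))"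
      using cond[of S j] by simp
  qed
  also have "\<dots> = real (card Z) / real N * (6 * exp (- 3 * V / 16))" by simp
  also have "\<dots> \<le> (real n)\<^sup>2 * (6 * exp (- 3 * V / 16))"
  proof (intro mult_right_mono)
    have "card Z \<le> card (\<K> \<times> tf_grid n)"
      using fin_\<K> by (intro card_mono) (auto simp: Z_def Good_def)
    then have "card Z \<le> N * n\<^sup>2" by (simp add: card_cartesian_product card_tf_grid N_def)
    then have "real (card Z) \<le> real N * (real n)\<^sup>2" by (metis of_nat_mono of_nat_mult of_nat_power)
    then show "real (card Z) / real N \<le> (real n)\<^sup>2" using N_pos by (simp add: field_simps)
  qed simp
  finally have total: "prob {\<omega> \<in> space M. bp_fails n h (x \<omega>)} \<le> real k * exp (- V / 8) + (real n)\<^sup>2 * (6 * exp (- 3 * V / 16))"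
    by simp
  have n_pos: "real n > 0" using n0 by simp
  have e8: "exp (- V / 8) \<le> \<epsilon> / (2 * (real n)\<^sup>2)"
  proof -
    have "exp (- V / 8) \<le> exp (- ln (2 * (real n)\<^sup>2 / \<epsilon>))" using VL by simp
    also have "\<dots> = \<epsilon> / (2 * (real n)\<^sup>2)" using n_pos \<epsilon> by (simp add: exp_minus)
    finally show ?thesis .
  qed
  \<comment> \<open>The phase exponent 3 V / 16 exceeds V / 8 by V / 16, worth a further factor 1 /
    n. This absorbs the constant 6: the two contributions add up to 7 \<epsilon> / (2 n).\<close>
  have e16: "exp (- V / 16) \<le> 1 / real n"
  proof (rule power2_le_imp_le)
    have "(exp (- V / 16))\<^sup>2 = exp (- V / 8)" by (simp add: exp_double[symmetric])
    also have "\<dots> \<le> 1 / (2 * (real n)\<^sup>2)" using \<epsilon> n_pos by (intro order_trans[OF e8] divide_right_mono) auto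
    also have "\<dots> \<le> (1 / real n)\<^sup>2" using n_pos by (simp add: power_divide field_simps)
    finally show "(exp (- V / 16))\<^sup>2 \<le> (1 / real n)\<^sup>2" .
  qed (use n_pos in simp)
  have "exp (- 3 * V / 16) = exp (- V / 8) * exp (- V / 16)" by (simp add: exp_add[symmetric])
  also have "\<dots> \<le> \<epsilon> / (2 * (real n)\<^sup>2) * (1 / real n)" using \<epsilon> by (intro mult_mono e8 e16) auto
  finally have "(real n)\<^sup>2 * (6 * exp (- 3 * V / 16)) \<le> (real n)\<^sup>2 * (6 * (\<epsilon> / (2 * (real n)\<^sup>2) * (1 / real n)))"
    by (intro mult_left_mono) auto
  also have "\<dots> = 3 * \<epsilon> / real n" using n_pos by (simp add: field_simps power2_eq_square)
  finally have t2: "(real n)\<^sup>2 * (6 * exp (- 3 * V / 16)) \<le> 3 * \<epsilon> / real n" .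
  have "real k * exp (- V / 8) \<le> real n * (\<epsilon> / (2 * (real n)\<^sup>2))"
    using n \<epsilon> by (intro mult_mono e8) auto
  also have "\<dots> = \<epsilon> / (2 * real n)" using n_pos by (simp add: field_simps power2_eq_square)
  finally have "real k * exp (- V / 8) + (real n)\<^sup>2 * (6 * exp (- 3 * V / 16)) \<le> \<epsilon> / (2 * real n) + 3 * \<epsilon> / real n"
    using t2 by simp
  also have "\<dots> = \<epsilon> * (7 / (2 * real n))" using n_pos by (simp add: field_simps)
  also have "\<dots> \<le> \<epsilon> * 1" using n_ge \<epsilon> by (intro mult_left_mono) auto
  finally show ?thesis using total by simp
qed

section \<open>Measurable failure events, and independence of window and signal\<close>

lemma measurable_array:
  assumes "random_array_with_support M n \<Lambda> x"
  shows "(\<lambda>\<omega>. \<lambda>i\<in>tf_grid n. x \<omega> i) \<in> M \<rightarrow>\<^sub>M PiM (tf_grid n) (\<lambda>_. borel)"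
  using assms by (intro measurable_restrict) (auto simp: random_array_with_support_def)

lemma bp_fails_restrict: "bp_fails n h (\<lambda>i\<in>tf_grid n. x i) \<longleftrightarrow> bp_fails n h x"
  by (rule bp_fails_cong) auto

lemma prob_recovery_eq:
  assumes M: "prob_space M" and arr: "random_array_with_support M n \<Lambda> x"
    and F: "{\<omega> \<in> space M. bp_fails n (h \<omega>) (x \<omega>)} \<in> sets M"
  shows "measure M {\<omega> \<in> space M. bp_recovers n (h \<omega>) (tf_operator n (\<Lambda> \<omega>) (x \<omega>) (h \<omega>)) (x \<omega>)}
    = 1 - measure M {\<omega> \<in> space M. bp_fails n (h \<omega>) (x \<omega>)}"
proof -
  interpret prob_space M by (rule M)
  have "{\<omega> \<in> space M. bp_recovers n (h \<omega>) (tf_operator n (\<Lambda> \<omega>) (x \<omega>) (h \<omega>)) (x \<omega>)}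
      = space M - {\<omega> \<in> space M. bp_fails n (h \<omega>) (x \<omega>)}"
    using arr by (auto simp: random_array_with_support_def bp_recovers_iff_not_fails)
  then show ?thesis using prob_compl[OF F] by simp
qed

lemma bp_fails_event:
  assumes arr: "random_array_with_support M n \<Lambda> x"
  shows "{\<omega> \<in> space M. bp_fails n h (x \<omega>)} \<in> sets M"
proof -
  have "(\<lambda>\<omega>. \<lambda>i\<in>tf_grid n. x \<omega> i) \<in> M \<rightarrow>\<^sub>M borel"
    using measurable_compose[OF measurable_array[OF arr] PiM_to_borel] .
  then have "{\<omega> \<in> space M. bp_fails n h (\<lambda>i\<in>tf_grid n. x \<omega> i)} \<in> sets M"
    by (intro measurable_bp_fails measurable_const) simp_all
  then show ?thesis by (simp add: bp_fails_restrict)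
qed

lemma distr_pair_indep:
  assumes M: "prob_space M" and U: "U \<in> M \<rightarrow>\<^sub>M N1" and X: "X \<in> M \<rightarrow>\<^sub>M N2"
    and indep: "\<And>A B. A \<in> sets N1 \<Longrightarrow> B \<in> sets N2 \<Longrightarrow>
      measure M (U -` A \<inter> space M \<inter> (X -` B \<inter> space M)) = measure M (U -` A \<inter> space M) * measure M (X -` B \<inter> space M)"
  shows "distr M N1 U \<Otimes>\<^sub>M distr M N2 X = distr M (N1 \<Otimes>\<^sub>M N2) (\<lambda>\<omega>. (U \<omega>, X \<omega>))"
proof (rule pair_measure_eqI)
  interpret prob_space M by (rule M)
  show "sigma_finite_measure (distr M N1 U)" "sigma_finite_measure (distr M N2 X)"
    using U X by (auto intro!: prob_space_imp_sigma_finite prob_space_distr)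
  show "sets (distr M N1 U \<Otimes>\<^sub>M distr M N2 X) = sets (distr M (N1 \<Otimes>\<^sub>M N2) (\<lambda>\<omega>. (U \<omega>, X \<omega>)))"
    by (simp cong: sets_pair_measure_cong)
  fix A B assume "A \<in> sets (distr M N1 U)" "B \<in> sets (distr M N2 X)"
  then have AB: "A \<in> sets N1" "B \<in> sets N2" by auto
  have "(\<lambda>\<omega>. (U \<omega>, X \<omega>)) -` (A \<times> B) \<inter> space M = U -` A \<inter> space M \<inter> (X -` B \<inter> space M)" by auto
  then show "emeasure (distr M N1 U) A * emeasure (distr M N2 X) B
      = emeasure (distr M (N1 \<Otimes>\<^sub>M N2) (\<lambda>\<omega>. (U \<omega>, X \<omega>))) (A \<times> B)"
    using AB indep[OF AB] U X
    by (simp add: emeasure_distr emeasure_eq_measure ennreal_mult measurable_Pair)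
qed

lemma random_window_law:
  assumes M: "prob_space M" and n: "n > 0" and u: "uniform_random_torus_vector M n u"
  shows "distr M (PiM {..<n} (\<lambda>_. borel)) (\<lambda>\<omega>. \<lambda>q\<in>{..<n}. u \<omega> q) = PiM {..<n} (\<lambda>_. torus_uniform)"
    and "(\<lambda>\<omega>. \<lambda>q\<in>{..<n}. u \<omega> q) \<in> M \<rightarrow>\<^sub>M PiM {..<n} (\<lambda>_. borel)"
proof -
  interpret prob_space M by (rule M)
  have indep: "indep_vars (\<lambda>_. borel) (\<lambda>q \<omega>. u \<omega> q) {..<n}"
    and law: "\<And>q. q < n \<Longrightarrow> distr M borel (\<lambda>\<omega>. u \<omega> q) = torus_uniform"
    using u by (auto simp: uniform_random_torus_vector_def)
  have rv: "(\<lambda>\<omega>. u \<omega> q) \<in> borel_measurable M" if "q \<in> {..<n}" for q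
    using indep that by (auto simp: indep_vars_def)
  have "distr M (PiM {..<n} (\<lambda>_. borel)) (\<lambda>\<omega>. \<lambda>q\<in>{..<n}. u \<omega> q) = PiM {..<n} (\<lambda>q. distr M borel (\<lambda>\<omega>. u \<omega> q))"
    using indep_vars_iff_distr_eq_PiM'[where I = "{..<n}" and M' = "\<lambda>_. borel" and X = "\<lambda>q \<omega>. u \<omega> q"] rv n indep by auto
  also have "\<dots> = PiM {..<n} (\<lambda>_. torus_uniform)" by (intro PiM_cong refl) (simp add: law)
  finally show "distr M (PiM {..<n} (\<lambda>_. borel)) (\<lambda>\<omega>. \<lambda>q\<in>{..<n}. u \<omega> q) = PiM {..<n} (\<lambda>_. torus_uniform)" .
  show "(\<lambda>\<omega>. \<lambda>q\<in>{..<n}. u \<omega> q) \<in> M \<rightarrow>\<^sub>M PiM {..<n} (\<lambda>_. borel)"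
    using rv by (rule measurable_restrict)
qed

text \<open>Fubini over the law of the window: a slice has probability at most 1 for windows in the
  exceptional set B and at most \<epsilon> for all others, by the bound for a fixed window.\<close>

lemma random_window_failure:
  assumes M: "prob_space M" and n: "even n" "n > 0" and arr: "random_array_with_support M n \<Lambda> x"
    and supp: "uniform_random_support M n k \<Lambda>"
    and u: "uniform_random_torus_vector M n u" and indep: "indep_of_signal M n k u \<Lambda> x"
    and \<mu>: "\<mu> \<ge> 0" and \<epsilon>: "\<epsilon> \<ge> 0"
    and fixed: "\<And>h. coherent_window n \<mu> h \<Longrightarrow> measure M {\<omega> \<in> space M. bp_fails n (scaled_window n h) (x \<omega>)} \<le> \<epsilon>"
  shows "{\<omega> \<in> space M. bp_fails n (scaled_window n (u \<omega>)) (x \<omega>)} \<in> sets M"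
    and "measure M {\<omega> \<in> space M. bp_fails n (scaled_window n (u \<omega>)) (x \<omega>)}
      \<le> \<epsilon> + 12 * (real n)\<^sup>2 * exp (- (3/8) * (real n * \<mu>\<^sup>2))"
proof -
  interpret prob_space M by (rule M)
  define N1 where "N1 = PiM {..<n} (\<lambda>_. borel :: complex measure)"
  define N2 where "N2 = PiM (tf_grid n) (\<lambda>_. borel :: complex measure)"
  define U where "U \<omega> = (\<lambda>q\<in>{..<n}. u \<omega> q)" for \<omega>
  define X where "X \<omega> = (\<lambda>i\<in>tf_grid n. x \<omega> i)" for \<omega>
  have U: "U \<in> M \<rightarrow>\<^sub>M N1" unfolding U_def N1_def by (rule random_window_law(2)[OF M n(2) u])
  have X: "X \<in> M \<rightarrow>\<^sub>M N2" unfolding X_def N2_def by (rule measurable_array[OF arr])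
  have law: "distr M N1 U = PiM {..<n} (\<lambda>_. torus_uniform)"
    unfolding U_def N1_def by (rule random_window_law(1)[OF M n(2) u])
  have prod: "distr M N1 U \<Otimes>\<^sub>M distr M N2 X = distr M (N1 \<Otimes>\<^sub>M N2) (\<lambda>\<omega>. (U \<omega>, X \<omega>))"
  proof (rule distr_pair_indep[OF M U X])
    fix A B assume A: "A \<in> sets N1" and B: "B \<in> sets N2"
    let ?Y = "\<lambda>\<omega>. (\<Lambda> \<omega>, X \<omega>)" and ?C = "count_space (k_subsets n k)"
    \<comment> \<open>Rectangles with full first factor single out the events that depend on
      \<open>x\<close> only, within the sigma-algebra generated by support and coefficients.\<close>
    have "space ?C \<times> B \<in> sets (?C \<Otimes>\<^sub>M N2)" using B by (intro pair_measureI sets.top)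
    then have "?Y -` (space ?C \<times> B) \<inter> space M \<in> sets (vimage_algebra (space M) ?Y (?C \<Otimes>\<^sub>M N2))"
      by (rule in_vimage_algebra)
    moreover have "?Y -` (space ?C \<times> B) \<inter> space M = X -` B \<inter> space M"
      using supp measurable_space[of \<Lambda> M ?C] by (auto simp: uniform_random_support_def)
    ultimately have XB: "X -` B \<inter> space M \<in> sets (vimage_algebra (space M) ?Y (?C \<Otimes>\<^sub>M N2))" by simp
    have UA: "U -` A \<inter> space M \<in> sets (vimage_algebra (space M) U N1)"
      using A by (rule in_vimage_algebra)
    show "prob (U -` A \<inter> space M \<inter> (X -` B \<inter> space M)) = prob (U -` A \<inter> space M) * prob (X -` B \<inter> space M)"
      using indep unfolding indep_of_signal_def
      by (rule indep_setD) (use UA XB in \<open>simp_all add: U_def[abs_def] X_def[abs_def] N1_def N2_def\<close>)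
  qed
  define Fail where "Fail = {(h, y) \<in> space (N1 \<Otimes>\<^sub>M N2). bp_fails n (scaled_window n h) y}"
  have scaled: "(\<lambda>h. scaled_window n h) \<in> N1 \<rightarrow>\<^sub>M borel"
  proof (rule measurable_coordinatewise_then_product)
    fix q
    have "(\<lambda>h. h q) \<in> borel_measurable N1"
      unfolding N1_def
      by (rule measurable_compose[OF PiM_to_borel borel_measurable_continuous_onI[OF continuous_on_product_coordinates]])
    then show "(\<lambda>h. scaled_window n h q) \<in> borel_measurable N1"
      unfolding scaled_window_def by measurable
  qed
  have Fail_sets: "Fail \<in> sets (N1 \<Otimes>\<^sub>M N2)"
  proof -
    have "(\<lambda>p. scaled_window n (fst p)) \<in> N1 \<Otimes>\<^sub>M N2 \<rightarrow>\<^sub>M borel"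
      by (rule measurable_compose[OF measurable_fst scaled])
    moreover have "snd \<in> N1 \<Otimes>\<^sub>M N2 \<rightarrow>\<^sub>M borel"
      using measurable_compose[OF measurable_snd PiM_to_borel] by (simp add: N2_def)
    ultimately show ?thesis
      using measurable_bp_fails[of "\<lambda>p. scaled_window n (fst p)" "N1 \<Otimes>\<^sub>M N2" snd n]
      by (simp add: Fail_def case_prod_unfold)
  qed
  have UX: "(\<lambda>\<omega>. (U \<omega>, X \<omega>)) \<in> M \<rightarrow>\<^sub>M N1 \<Otimes>\<^sub>M N2" using U X by (rule measurable_Pair)
  have event: "{\<omega> \<in> space M. bp_fails n (scaled_window n (u \<omega>)) (x \<omega>)} = (\<lambda>\<omega>. (U \<omega>, X \<omega>)) -` Fail \<inter> space M"
  proof -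
    have "bp_fails n (scaled_window n (U \<omega>)) (X \<omega>) \<longleftrightarrow> bp_fails n (scaled_window n (u \<omega>)) (x \<omega>)" for \<omega>
      by (rule bp_fails_cong) (auto simp: U_def X_def scaled_window_def)
    then show ?thesis using measurable_space[OF UX] by (auto simp: Fail_def)
  qed
  show "{\<omega> \<in> space M. bp_fails n (scaled_window n (u \<omega>)) (x \<omega>)} \<in> sets M"
    unfolding event using UX Fail_sets by (rule measurable_sets)
  obtain B where B: "B \<in> sets (distr M N1 U)"
      "measure (distr M N1 U) B \<le> 12 * (real n)\<^sup>2 * exp (- (3/8) * (real n * \<mu>\<^sup>2))"
      "\<And>h. h \<in> space (distr M N1 U) \<Longrightarrow> h \<notin> B \<Longrightarrow> coherent_window n \<mu> h"
    unfolding law by (rule random_window_coherence[OF n \<mu>]) blast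
  interpret DX: prob_space "distr M N2 X" by (rule prob_space_distr[OF X])
  interpret DU: prob_space "distr M N1 U" by (rule prob_space_distr[OF U])
  have Fail_sets': "Fail \<in> sets (distr M N1 U \<Otimes>\<^sub>M distr M N2 X)"
    using Fail_sets unfolding prod by simp
  have slice: "emeasure (distr M N2 X) (Pair h -` Fail) \<le> indicator B h + ennreal \<epsilon>"
    if h: "h \<in> space (distr M N1 U)" for h
  proof (cases "h \<in> B")
    case True
    have "emeasure (distr M N2 X) (Pair h -` Fail) \<le> 1" by (rule DX.emeasure_le_1)
    then show ?thesis using True by (simp add: add_increasing2)
  next
    case False
    have "Pair h -` Fail \<in> sets N2" using sets_Pair1[OF Fail_sets] .
    then have "emeasure (distr M N2 X) (Pair h -` Fail) = emeasure M (X -` (Pair h -` Fail) \<inter> space M)"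
      using X by (intro emeasure_distr)
    also have "X -` (Pair h -` Fail) \<inter> space M = {\<omega> \<in> space M. bp_fails n (scaled_window n h) (x \<omega>)}"
    proof -
      have "bp_fails n (scaled_window n h) (X \<omega>) \<longleftrightarrow> bp_fails n (scaled_window n h) (x \<omega>)" for \<omega>
        by (simp add: X_def bp_fails_restrict)
      then show ?thesis using h measurable_space[OF X] by (auto simp: Fail_def space_pair_measure)
    qed
    also have "emeasure M \<dots> \<le> ennreal \<epsilon>"
      unfolding emeasure_eq_measure by (intro ennreal_leI fixed B(3) h False)
    finally show ?thesis using False by simp
  qed
  have "emeasure M {\<omega> \<in> space M. bp_fails n (scaled_window n (u \<omega>)) (x \<omega>)}
      = emeasure (distr M N1 U \<Otimes>\<^sub>M distr M N2 X) Fail"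
    unfolding event prod using UX Fail_sets by (simp add: emeasure_distr)
  also have "\<dots> = (\<integral>\<^sup>+h. emeasure (distr M N2 X) (Pair h -` Fail) \<partial>distr M N1 U)"
    by (rule DX.emeasure_pair_measure_alt[OF Fail_sets'])
  also have "\<dots> \<le> (\<integral>\<^sup>+h. indicator B h + ennreal \<epsilon> \<partial>distr M N1 U)"
    by (intro nn_integral_mono slice)
  also have "\<dots> = emeasure (distr M N1 U) B + ennreal \<epsilon>"
    using B(1) DU.emeasure_space_1 by (simp add: nn_integral_add del: sets_distr)
  also have "\<dots> = ennreal (measure (distr M N1 U) B + \<epsilon>)"
    using \<epsilon> by (simp add: DU.emeasure_eq_measure)
  finally have "measure M {\<omega> \<in> space M. bp_fails n (scaled_window n (u \<omega>)) (x \<omega>)} \<le> measure (distr M N1 U) B + \<epsilon>"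
    using \<epsilon> by (simp add: emeasure_eq_measure del: ennreal_plus)
  then show "measure M {\<omega> \<in> space M. bp_fails n (scaled_window n (u \<omega>)) (x \<omega>)}
      \<le> \<epsilon> + 12 * (real n)\<^sup>2 * exp (- (3/8) * (real n * \<mu>\<^sup>2))"
    using B(2) by linarith
qed

text \<open>The bracket has modulus at most 2/5 and the logarithm is at least 2/3, so the condition
  on the exponent gives 96 k \<le> (4/25) n, that is 600 k \<le> n.\<close>

lemma separation_from_exponent:
  fixes c :: real
  assumes k: "k \<ge> 3" and c: "c \<ge> 144"
    and ratio: "5 * real k \<le> real n"
    and s: "1 \<le> 1 / c * (exp (- (1 / 4)) / 2 - 2 * real k / real n) ^ 2 * (real n / (real k * ln (real k / 2 + 1)))"
  shows "390 * real k \<le> real n"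
proof -
  define y where "y = exp (- (1 / 4)) / 2 - 2 * real k / real n"
  define l where "l = ln (real k / 2 + 1)"
  have kn: "real k \<ge> 3" "real n > 0" using k ratio by auto
  have "2/3 \<le> ln (2::real)" by (rule ln2_ge_two_thirds)
  also have "\<dots> \<le> l" unfolding l_def using kn by (intro ln_mono) auto
  finally have l: "2/3 \<le> l" .
  have "1 + 1/4 \<le> exp (1/4 :: real)" by (rule exp_ge_add_one_self)
  then have "exp (- (1/4) :: real) \<le> 4/5" by (simp add: exp_minus field_simps)
  moreover have "0 \<le> 2 * real k / real n" "2 * real k / real n \<le> 2/5"
    using ratio kn by (simp_all add: field_simps)
  \<comment> \<open>The bracket may be negative, so its square has to be controlled from both sides;
    the lower side is what \<open>ratio\<close> provides.\<close>
  ultimately have "\<bar>y\<bar> \<le> 2/5" unfolding y_def using exp_ge_zero[of "- (1/4) :: real"] by linarith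
  then have y: "y\<^sup>2 \<le> (2/5)\<^sup>2" by (metis abs_ge_zero power2_abs power_mono)
  have "1 \<le> y\<^sup>2 * real n / (c * (real k * l))"
    using s by (simp add: y_def l_def)
  then have "c * (real k * l) \<le> y\<^sup>2 * real n"
    using c kn l by (subst (asm) le_divide_eq) (auto split: if_splits simp: zero_less_mult_iff)
  also have "\<dots> \<le> (2/5)\<^sup>2 * real n" using y kn by (intro mult_right_mono) auto
  finally have upper: "c * (real k * l) \<le> 4/25 * real n" by (simp add: power2_eq_square)
  have "144 * (real k * (2/3)) \<le> c * (real k * l)"
    using c kn l by (intro mult_mono) auto
  then show ?thesis using upper by simp
qed

lemma log_factor_bounds:
  fixes \<epsilon> :: real
  assumes "0 < \<epsilon>" "\<epsilon> \<le> 1" "n \<ge> 1"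
  shows "2/3 \<le> ln (2 * real n ^ 2 / \<epsilon>)"
proof -
  have "2 * 1 \<le> 2 * real n ^ 2" using assms(3) by simp
  then have "2 * \<epsilon> \<le> 2 * real n ^ 2" using assms by linarith
  then have "2 \<le> 2 * real n ^ 2 / \<epsilon>" using assms(1) by (simp add: pos_le_divide_eq)
  then have "ln 2 \<le> ln (2 * real n ^ 2 / \<epsilon>)" by (intro ln_mono) auto
  then show ?thesis using ln2_ge_two_thirds by linarith
qed

lemma alltop_recovery_failure:
  assumes M: "prob_space M" and k: "k \<ge> 3" and supp: "uniform_random_support M n k \<Lambda>"
    and arr: "random_array_with_support M n \<Lambda> x" and phases: "uniform_random_phases M n \<Lambda> x"
    and n: "prime n" and \<epsilon>: "0 < \<epsilon>" "\<epsilon> \<le> 1"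
    and size: "real k \<le> real n / (8 * ln (2 * real n ^ 2 / \<epsilon>))"
    and s: "1 \<le> 1 / 144 * (exp (- (1 / 4)) / 2 - 2 * real k / real n) ^ 2 * (real n / (real k * ln (real k / 2 + 1)))"
  shows "measure M {\<omega> \<in> space M. bp_fails n (alltop_window n) (x \<omega>)} \<le> \<epsilon>"
proof -
  define L where "L = ln (2 * real n ^ 2 / \<epsilon>)"
  have n1: "n \<ge> 1" using n prime_gt_0_nat[of n] by simp
  have L: "2/3 \<le> L" unfolding L_def by (rule log_factor_bounds[OF \<epsilon> n1])
  have size': "real k * (8 * L) \<le> real n"
    using size L by (simp add: L_def pos_le_divide_eq)
  \<comment> \<open>The size condition supplies a crude ratio of n to k, which the condition on the
    exponent then sharpens.\<close>
  have "real k * (16/3) \<le> real k * (8 * L)" using L by (intro mult_left_mono) auto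
  then have "5 * real k \<le> real n" using size' by linarith
  then have sep: "390 * real k \<le> real n" by (intro separation_from_exponent[OF k _ _ s]) simp_all
  have n_pos: "real n > 0" using n1 by simp
  have k_pos: "real k > 0" using k by simp
  show ?thesis
  \<comment> \<open>For the coherence 1 / sqrt n, the quantity V = 1 / (k \<mu>^2) is n / k, and the
    size condition is the required lower bound on V.\<close>
  proof (rule recovery_failure_given_window[OF M _ supp arr phases sep, where \<mu> = "1 / sqrt (real n)" and V = "real n / real k"])
    show "(cmod (alltop_window n q))\<^sup>2 = 1 / real n" for q
      by (simp add: alltop_window_def norm_divide power_divide)
    show "cmod (gram n (alltop_window n) i j) \<le> 1 / sqrt (real n)"
      if "i \<in> tf_grid n" "j \<in> tf_grid n" "i \<noteq> j" for i j
      using that sep k by (intro alltop_coherence n) auto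
    show "real k * (1 / sqrt (real n))\<^sup>2 * (real n / real k) \<le> 1"
      using n_pos k_pos by (simp add: power_divide)
    show "8 * ln (2 * real n ^ 2 / \<epsilon>) \<le> real n / real k"
      using size' k_pos by (simp add: L_def pos_le_divide_eq mult.commute)
  qed (use k k_pos n_pos \<epsilon> in auto)
qed

lemma random_window_recovery_failure:
  assumes M: "prob_space M" and k: "k \<ge> 3" and supp: "uniform_random_support M n k \<Lambda>"
    and arr: "random_array_with_support M n \<Lambda> x" and phases: "uniform_random_phases M n \<Lambda> x"
    and n: "even n" and u: "uniform_random_torus_vector M n u" and indep: "indep_of_signal M n k u \<Lambda> x"
    and \<epsilon>: "0 < \<epsilon>" "\<epsilon> \<le> 1" and \<sigma>: "\<sigma> > 0"
    and size: "real k \<le> real n / (32 * (\<sigma> + 2) * ln (real n) * ln (2 * real n ^ 2 / \<epsilon>))"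
    and s: "1 \<le> 1 / (576 * (\<sigma> + 2)) * (exp (- (1 / 4)) / 2 - 2 * real k / real n) ^ 2 * (real n / (real k * ln (real k / 2 + 1)))"
  shows "{\<omega> \<in> space M. bp_fails n (scaled_window n (u \<omega>)) (x \<omega>)} \<in> sets M"
    and "measure M {\<omega> \<in> space M. bp_fails n (scaled_window n (u \<omega>)) (x \<omega>)} \<le> \<epsilon> + 4 * real n powr (- \<sigma>)"
proof -
  define L where "L = ln (2 * real n ^ 2 / \<epsilon>)"
  have k_pos: "real k > 0" using k by simp
  \<comment> \<open>For n = 0 the right side of the size condition evaluates to 0, which contradicts
    k \<ge> 3.\<close>
  have "n \<noteq> 0" using size k by (intro notI) simp
  then have n2: "n \<ge> 2" using n by (auto elim!: evenE)
  have L: "2/3 \<le> L" unfolding L_def using n2 by (intro log_factor_bounds[OF \<epsilon>]) simp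
  have "ln 2 \<le> ln (real n)" using n2 by (intro ln_mono) auto
  then have lnn: "2/3 \<le> ln (real n)" using ln2_ge_two_thirds by linarith
  define D where "D = 32 * (\<sigma> + 2) * ln (real n) * L"
  have "32 * 2 * (2/3) * (2/3) \<le> D"
    unfolding D_def using L lnn \<sigma> by (intro mult_mono) auto
  then have D: "5 \<le> D" by simp
  have size': "real k * D \<le> real n"
    using size D by (simp add: D_def L_def pos_le_divide_eq)
  have "real k * 5 \<le> real k * D" using D by (intro mult_left_mono) auto
  then have "5 * real k \<le> real n" using size' by linarith
  then have sep: "390 * real k \<le> real n" using \<sigma> by (intro separation_from_exponent[OF k _ _ s]) simp_all
  have n_pos: "real n > 0" using n2 by simp
  \<comment> \<open>The factor 4 makes 8 * 4 = 32 match the size condition, and the window exponent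
    (3/8) n \<mu>^2 becomes (3/2) (\<sigma> + 2) ln n.\<close>
  define \<mu> where "\<mu> = sqrt (4 * (\<sigma> + 2) * ln (real n) / real n)"
  have \<mu>_sq: "\<mu>\<^sup>2 = 4 * (\<sigma> + 2) * ln (real n) / real n" and \<mu>: "\<mu> \<ge> 0"
    unfolding \<mu>_def using \<sigma> lnn n_pos by simp_all
  define V where "V = real n / (real k * (4 * (\<sigma> + 2) * ln (real n)))"
  have den: "0 < real k * (4 * (\<sigma> + 2) * ln (real n))" using k_pos \<sigma> lnn by simp
  then have V: "V > 0" using n_pos by (simp add: V_def)
  have kV: "real k * \<mu>\<^sup>2 * V \<le> 1"
  proof -
    have "real k * \<mu>\<^sup>2 * V = (real k * (4 * (\<sigma> + 2) * ln (real n))) / (real k * (4 * (\<sigma> + 2) * ln (real n))) * (real n / real n)"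
      by (simp only: \<mu>_sq V_def times_divide_eq_left times_divide_eq_right divide_divide_eq_left mult_ac)
    also have "\<dots> = 1" using den n_pos by (metis divide_self less_irrefl mult_1)
    finally show ?thesis by simp
  qed
  have VL: "8 * ln (2 * real n ^ 2 / \<epsilon>) \<le> V"
  proof -
    have "8 * L * (real k * (4 * (\<sigma> + 2) * ln (real n))) = real k * D"
      by (simp add: D_def algebra_simps)
    then show ?thesis
      unfolding V_def L_def[symmetric] pos_le_divide_eq[OF den] using size' by linarith
  qed
  have fixed: "measure M {\<omega> \<in> space M. bp_fails n (scaled_window n h) (x \<omega>)} \<le> \<epsilon>" if h: "coherent_window n \<mu> h" for h
  proof (rule recovery_failure_given_window[OF M _ supp arr phases sep _ \<mu> _ V kV \<epsilon> VL])
    show "(cmod (scaled_window n h q))\<^sup>2 = 1 / real n" if "q < n" for q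
      using h that by (simp add: coherent_window_def scaled_window_def norm_divide power_divide)
  qed (use h k in \<open>auto simp: coherent_window_def\<close>)
  note fail = random_window_failure[OF M n _ arr supp u indep \<mu> _ fixed]
  show "{\<omega> \<in> space M. bp_fails n (scaled_window n (u \<omega>)) (x \<omega>)} \<in> sets M"
    using n2 \<epsilon> by (intro fail(1)) auto
  \<comment> \<open>The power of n is -1 - 3 \<sigma> / 2, at most -1 - \<sigma>; the spare factor 1
    / n, at most 1/3, reduces the constant 12 to 4.\<close>
  have "12 * (real n)\<^sup>2 * exp (- (3/8) * (real n * \<mu>\<^sup>2)) \<le> 4 * real n powr (- \<sigma>)"
  proof -
    have "- (3/8) * (real n * \<mu>\<^sup>2) = - (3/2) * (\<sigma> + 2) * ln (real n)"
      using n_pos by (simp add: \<mu>_sq)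
    then have "exp (- (3/8) * (real n * \<mu>\<^sup>2)) = real n powr (- (3/2) * (\<sigma> + 2))"
      using n_pos by (simp add: powr_def)
    then have "(real n)\<^sup>2 * exp (- (3/8) * (real n * \<mu>\<^sup>2)) = real n powr (2 + - (3/2) * (\<sigma> + 2))"
      using n_pos by (simp only: powr_add powr_numeral)
    also have "\<dots> \<le> real n powr (- \<sigma> + - 1)"
    proof (rule powr_mono)
      show "2 + - (3/2) * (\<sigma> + 2) \<le> - \<sigma> + - 1" using \<sigma> by (simp add: field_simps)
    qed (use n2 in simp)
    also have "\<dots> = real n powr (- \<sigma>) / real n"
      using n_pos by (simp only: powr_add powr_minus_divide powr_one) simp
    also have "\<dots> \<le> real n powr (- \<sigma>) / 3"
      using sep k by (intro divide_left_mono) auto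
    finally show ?thesis by simp
  qed
  moreover have "measure M {\<omega> \<in> space M. bp_fails n (scaled_window n (u \<omega>)) (x \<omega>)}
      \<le> \<epsilon> + 12 * (real n)\<^sup>2 * exp (- (3/8) * (real n * \<mu>\<^sup>2))"
    using n2 \<epsilon> by (intro fail(2)) auto
  ultimately show "measure M {\<omega> \<in> space M. bp_fails n (scaled_window n (u \<omega>)) (x \<omega>)} \<le> \<epsilon> + 4 * real n powr (- \<sigma>)"
    by linarith
qed

theorem theorem2p5:
  fixes M :: "'w measure" and n k :: nat
    and \<Lambda> :: "'w \<Rightarrow> (nat \<times> nat) set" and x :: "'w \<Rightarrow> nat \<times> nat \<Rightarrow> complex"
  assumes "prob_space M"
    and "k \<ge> 3"
    and "uniform_random_support M n k \<Lambda>"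
    and "random_array_with_support M n \<Lambda> x"
    and "uniform_random_phases M n \<Lambda> x"
  shows
   "(prime n \<longrightarrow>
      (\<forall>(\<epsilon>::real) (s::real).
         \<epsilon> > 0 \<and>
         real k \<le> real n / (8 * ln (2 * real n ^ 2 / \<epsilon>)) \<and>
         s = 1 / 144 * (exp (- (1 / 4)) / 2 - 2 * real k / real n) ^ 2
               * (real n / (real k * ln (real k / 2 + 1))) \<and>
         s \<ge> 1 \<longrightarrow>
         measure M {\<omega> \<in> space M.
             bp_recovers n (alltop_window n)
               (tf_operator n (\<Lambda> \<omega>) (x \<omega>) (alltop_window n)) (x \<omega>)}
           \<ge> 1 - (\<epsilon> + (real k / 2) powr (- s))))
    \<and>
    (even n \<longrightarrow>
      (\<forall>(u :: 'w \<Rightarrow> nat \<Rightarrow> complex) (\<epsilon>::real) (\<sigma>::real) (s::real).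
         uniform_random_torus_vector M n u \<and>
         indep_of_signal M n k u \<Lambda> x \<and>
         \<epsilon> > 0 \<and> \<sigma> > 0 \<and>
         real k \<le> real n / (32 * (\<sigma> + 2) * ln (real n) * ln (2 * real n ^ 2 / \<epsilon>)) \<and>
         s = 1 / (576 * (\<sigma> + 2)) * (exp (- (1 / 4)) / 2 - 2 * real k / real n) ^ 2
               * (real n / (real k * ln (real k / 2 + 1))) \<and>
         s \<ge> 1 \<longrightarrow>
         measure M {\<omega> \<in> space M.
             bp_recovers n (scaled_window n (u \<omega>))
               (tf_operator n (\<Lambda> \<omega>) (x \<omega>) (scaled_window n (u \<omega>))) (x \<omega>)}
           \<ge> 1 - (\<epsilon> + 4 * real n powr (- \<sigma>) + (real k / 2) powr (- s))))"
proof (intro conjI impI allI; elim conjE)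
  fix \<epsilon> s :: real
  assume n: "prime n" and \<epsilon>: "\<epsilon> > 0" and size: "real k \<le> real n / (8 * ln (2 * real n ^ 2 / \<epsilon>))"
    and s: "s = 1 / 144 * (exp (- (1 / 4)) / 2 - 2 * real k / real n) ^ 2
               * (real n / (real k * ln (real k / 2 + 1)))" "s \<ge> 1"
  have pw: "0 \<le> (real k / 2) powr (- s)" by simp
  let ?R = "{\<omega> \<in> space M. bp_recovers n (alltop_window n) (tf_operator n (\<Lambda> \<omega>) (x \<omega>) (alltop_window n)) (x \<omega>)}"
  show "measure M ?R \<ge> 1 - (\<epsilon> + (real k / 2) powr (- s))"
  proof (cases "\<epsilon> \<le> 1")
    case True
    have "measure M ?R = 1 - measure M {\<omega> \<in> space M. bp_fails n (alltop_window n) (x \<omega>)}"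
      by (rule prob_recovery_eq[OF assms(1,4) bp_fails_event[OF assms(4)]])
    moreover have "measure M {\<omega> \<in> space M. bp_fails n (alltop_window n) (x \<omega>)} \<le> \<epsilon>"
      by (rule alltop_recovery_failure[OF assms n \<epsilon> True size s(2)[unfolded s(1)]])
    ultimately show ?thesis using pw by linarith
  next
    \<comment> \<open>For \<epsilon> > 1 the claimed lower bound is negative.\<close>
    case False
    then show ?thesis using pw measure_nonneg[of M ?R] by linarith
  qed
next
  fix u :: "'w \<Rightarrow> nat \<Rightarrow> complex" and \<epsilon> \<sigma> s :: real
  assume n: "even n" and u: "uniform_random_torus_vector M n u" and indep: "indep_of_signal M n k u \<Lambda> x"
    and \<epsilon>: "\<epsilon> > 0" and \<sigma>: "\<sigma> > 0"
    and size: "real k \<le> real n / (32 * (\<sigma> + 2) * ln (real n) * ln (2 * real n ^ 2 / \<epsilon>))"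
    and s: "s = 1 / (576 * (\<sigma> + 2)) * (exp (- (1 / 4)) / 2 - 2 * real k / real n) ^ 2
               * (real n / (real k * ln (real k / 2 + 1)))" "s \<ge> 1"
  have pw: "0 \<le> (real k / 2) powr (- s)" "0 \<le> real n powr (- \<sigma>)" by simp_all
  let ?R = "{\<omega> \<in> space M. bp_recovers n (scaled_window n (u \<omega>))
      (tf_operator n (\<Lambda> \<omega>) (x \<omega>) (scaled_window n (u \<omega>))) (x \<omega>)}"
  show "measure M ?R \<ge> 1 - (\<epsilon> + 4 * real n powr (- \<sigma>) + (real k / 2) powr (- s))"
  proof (cases "\<epsilon> \<le> 1")
    case True
    note fail = random_window_recovery_failure[OF assms n u indep \<epsilon> True \<sigma> size s(2)[unfolded s(1)]]
    have "measure M ?R = 1 - measure M {\<omega> \<in> space M. bp_fails n (scaled_window n (u \<omega>)) (x \<omega>)}"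
      by (rule prob_recovery_eq[OF assms(1,4) fail(1)])
    then show ?thesis using fail(2) pw by linarith
  next
    case False
    then show ?thesis using pw measure_nonneg[of M ?R] by linarith
  qed
qed

end
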